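(* Let $d\ge 2$. Suppose that $\mathbb{E}[\tau_e^2]<\infty$ and $\mathbb{P}(\tau_e=0)<p_c(d)$. Then there exists a positive constant $C$ such that $$\lim_{N\to\infty}\mathbb{P}\left(\sup_{\gamma\in\mathbb{O}_N}\mathcal{M}(\gamma)\le C\,\mathrm{f}_{d,0}(N)\right)=1,\qquad \mathrm{f}_{d,0}(N)=\frac{\log N}{\log\log N}.$$
   Context: First-passage percolation on $\mathbb{Z}^d$: $\mathrm{E}^d$ is the set of non-oriented nearest-neighbour edges $\langle v,w\rangle$, $v,w\in\mathbb{Z}^d$, $|v-w|_1=1$. The weights $\tau=\{\tau_e\}_{e\in \mathrm{E}^d}$ are i.i.d. non-negative random variables. A path $\gamma$ from $v$ to $w$ is a finite sequence $(x_0,\dots,x_l)$ of vertices with $x_0=v$, $x_l=w$ and consecutive vertices adjacent; it is also regarded as a sequence of edges. $\mathrm{T}(\gamma)=\sum_{e\in\gamma}\tau_e$, $\mathrm{T}(v,w)=\inf_{\gamma:v\to w}\mathrm{T}(\gamma)$, and $\mathbb{O}(v,w)$ is the set of paths $\gamma:v\to w$ with $\mathrm{T}(\gamma)=\mathrm{T}(v,w)$ (optimal paths). $\mathbb{O}_N=\mathbb{O}(0,N\mathbf{e}_1)$, where $\mathbf{e}_1$ is the first unit coordinate vector. $\mathcal{M}(\gamma)=\sup_{e\in\gamma}\tau_e$. $p_c(d)$ is the critical probability of (bond) percolation on $\mathbb{Z}^d$. *)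

theory Defs
  imports "HOL-Probability.Probability"
begin

text \<open>
  The lattice of dimension \<open>d\<close> consists of the integer sequences vanishing from index \<open>d\<close> on, so
  that \<open>d\<close> is an ordinary natural number and the first coordinate is the one with index \<open>0\<close>.
\<close>

type_synonym vertex = "nat \<Rightarrow> int"
type_synonym edge = "vertex set"

definition lattice :: "nat \<Rightarrow> vertex set" where
  "lattice d = {x. \<forall>i\<ge>d. x i = 0}"

definition adjacent :: "nat \<Rightarrow> vertex \<Rightarrow> vertex \<Rightarrow> bool" where
  "adjacent d v w \<longleftrightarrow> v \<in> lattice d \<and> w \<in> lattice d \<and> (\<Sum>i<d. \<bar>v i - w i\<bar>) = 1"

definition edges :: "nat \<Rightarrow> edge set" where
  "edges d = {{v, w} | v w. adjacent d v w}"

definition origin :: vertex where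
  "origin = (\<lambda>i. 0)"

definition e1 :: vertex where
  "e1 = (\<lambda>i. if i = 0 then 1 else 0)"

text \<open>Paths need not be self-avoiding.\<close>

definition is_path :: "nat \<Rightarrow> vertex \<Rightarrow> vertex \<Rightarrow> vertex list \<Rightarrow> bool" where
  "is_path d v w \<gamma> \<longleftrightarrow>
     \<gamma> \<noteq> [] \<and> set \<gamma> \<subseteq> lattice d \<and> hd \<gamma> = v \<and> last \<gamma> = w \<and> successively (adjacent d) \<gamma>"

definition path_edges :: "vertex list \<Rightarrow> edge list" where
  "path_edges \<gamma> = map (\<lambda>(x, y). {x, y}) (zip \<gamma> (tl \<gamma>))"

text \<open>
  In the following definitions \<open>t\<close> is a single realization of the edge weights. An edge that a path
  traverses several times contributes once per traversal to the passage time.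
\<close>

definition path_time :: "(edge \<Rightarrow> real) \<Rightarrow> vertex list \<Rightarrow> real" where
  "path_time t \<gamma> = (\<Sum>e\<leftarrow>path_edges \<gamma>. t e)"

definition passage_time :: "nat \<Rightarrow> (edge \<Rightarrow> real) \<Rightarrow> vertex \<Rightarrow> vertex \<Rightarrow> real" where
  "passage_time d t v w = (INF \<gamma>\<in>{\<gamma>. is_path d v w \<gamma>}. path_time t \<gamma>)"

definition optimal_paths :: "nat \<Rightarrow> (edge \<Rightarrow> real) \<Rightarrow> vertex \<Rightarrow> vertex \<Rightarrow> vertex list set" where
  "optimal_paths d t v w = {\<gamma>. is_path d v w \<gamma> \<and> path_time t \<gamma> = passage_time d t v w}"

text \<open>
  Suprema of weights are taken in the extended reals: the set of optimal paths may be infinite or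
  (on a null set) empty, and the supremum over it must still be meaningful.
\<close>

definition max_weight :: "(edge \<Rightarrow> real) \<Rightarrow> vertex list \<Rightarrow> ereal" where
  "max_weight t \<gamma> = (SUP e\<in>set (path_edges \<gamma>). ereal (t e))"

definition open_cluster :: "nat \<Rightarrow> (edge \<Rightarrow> bool) \<Rightarrow> vertex set" where
  "open_cluster d \<omega> = {x. \<exists>\<gamma>. is_path d origin x \<gamma> \<and> (\<forall>e\<in>set (path_edges \<gamma>). \<omega> e)}"

definition percolation_measure :: "nat \<Rightarrow> real \<Rightarrow> (edge \<Rightarrow> bool) measure" where
  "percolation_measure d p = (\<Pi>\<^sub>M e\<in>edges d. measure_pmf (bernoulli_pmf p))"

definition percolation_prob :: "nat \<Rightarrow> real \<Rightarrow> real" where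
  "percolation_prob d p =
     measure (percolation_measure d p)
       {\<omega> \<in> space (percolation_measure d p). infinite (open_cluster d \<omega>)}"

definition critical_prob :: "nat \<Rightarrow> real" where
  "critical_prob d = Sup {p \<in> {0..1}. percolation_prob d p = 0}"

end

theory Submission
  imports Defs "HOL-Real_Asymp.Real_Asymp"
begin

text \<open>
  \<^bold>\<open>Why the order is log N / log log N.\<close> Suppose that an optimal path traverses an edge of weight
  more than \<open>m\<close>, leaving from the vertex \<open>x\<close>, and that both of its ends have sup-norm distance at
  least \<open>J\<close> from \<open>x\<close>. For every \<open>k\<close> from \<open>1\<close> to \<open>J\<close> the path visits the sphere of radius \<open>k\<close> about \<open>x\<close>
  both before and after the heavy edge. Hence these two points cannot be joined inside the
  sphere at a cost of at most \<open>m\<close>, since otherwise a shortcut would avoid the heavy edge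
  (\<open>shells_slow_around_heavy_edge\<close>). Different spheres have disjoint sets of edges, so the \<open>J\<close>
  obstacles are independent, and each of them has probability at most \<open>C / m\<close> if \<open>J \<le> c m\<close>
  (\<open>prob_slow_shell\<close>). With \<open>J = c m\<close> this gives \<open>(C / m) ^ (c m) = exp (- (c + o(1)) m log m)\<close>, and
  for \<open>m = A log N / log log N\<close> the exponent is of the order of \<open>- c A log N\<close>: for large \<open>A\<close> the bound
  beats the number of vertices of any box whose size is a given power of \<open>N\<close>.

  \<^bold>\<open>One slow sphere.\<close> Two points of a sphere are joined through its top corner by raising
  coordinates one at a time. Each step has \<open>d - 1\<close> edge-disjoint local realizations inside the
  sphere, so by Chebyshev's inequality all of them contain an edge of weight of order \<open>m\<close> with
  probability at most a multiple of \<open>m ^ (- 2 (d - 1))\<close>; a sphere has of the order of \<open>m ^ (d - 1)\<close>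
  steps. Weights below such a level have exponential moments, and the sum of \<open>O(k)\<close> of them exceeds
  \<open>m / 2\<close> with probability at most any given power of \<open>1 / m\<close>, if \<open>k \<le> c m\<close> with \<open>c\<close> small.

  \<^bold>\<open>Confinement.\<close> By Markov's inequality the passage time is below \<open>N ^ 2\<close> with high probability.
  That such a cheap path stays in a box of polynomial size is where subcriticality enters
  (\<open>linear_growth\<close>). By the argument of Duminil-Copin and Tassion, if the expected number of open
  edges through which the cluster of the origin leaves a finite set \<open>S\<close> were at least \<open>1\<close> for every
  \<open>S\<close>, there would be percolation at every larger parameter. So it is less than \<open>1\<close> for some \<open>S\<close> when
  the open edges are those of weight \<open>0\<close>. The indicator that a connection is open is the limit of
  \<open>exp (- l T)\<close> as \<open>l\<close> tends to infinity, where \<open>T\<close> is the time of the cheapest connection. For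
  large \<open>l\<close> the expected total damped weight of leaving \<open>S\<close> is therefore some \<open>\<rho> < 1\<close>. A path to distance
  \<open>m L\<close> leaves \<open>m\<close> translates of \<open>S\<close> in succession along disjoint edges, and a functional form of the
  van den Berg--Kesten inequality (\<open>BK_inequality_sup\<close>) bounds the expectation of \<open>exp (- l T)\<close> by
  \<open>\<rho> ^ m\<close>.

  \<^bold>\<open>Near the ends.\<close> There are only \<open>O(m ^ d)\<close> vertices within distance \<open>J\<close> of an end of the path, so
  \<open>d + 1\<close> spheres suffice for them, and only a bounded number of vertices where \<open>d + 1\<close> spheres do not
  fit (\<open>light_event_bound\<close>).
\<close>

section \<open>Paths in the lattice\<close>

lemma adjacent_sym: "adjacent d v w \<longleftrightarrow> adjacent d w v"
  by (auto simp: adjacent_def abs_minus_commute)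

lemma edge_in_edges_iff [simp]: "{v, w} \<in> edges d \<longleftrightarrow> adjacent d v w"
  unfolding edges_def by (auto simp: doubleton_eq_iff adjacent_sym)

lemma path_edges_simps [simp]:
  "path_edges [] = []" "path_edges [v] = []"
  "path_edges (v # w # \<gamma>) = {v, w} # path_edges (w # \<gamma>)"
  by (simp_all add: path_edges_def)

lemma path_edges_append:
  "\<gamma> \<noteq> [] \<Longrightarrow> \<delta> \<noteq> [] \<Longrightarrow>
    path_edges (\<gamma> @ \<delta>) = path_edges \<gamma> @ {last \<gamma>, hd \<delta>} # path_edges \<delta>"
proof (induction \<gamma> rule: induct_list012)
  case (2 v) then show ?case by (cases \<delta>) auto
qed auto

lemma path_edges_join:
  "path_edges (\<gamma> @ v # \<delta>) = path_edges (\<gamma> @ [v]) @ path_edges (v # \<delta>)"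
  by (cases "\<gamma> = []") (simp_all add: path_edges_append)

lemma path_edges_rev: "path_edges (rev \<gamma>) = rev (path_edges \<gamma>)"
proof (induction \<gamma> rule: induct_list012)
  case (3 v w \<gamma>)
  then show ?case using path_edges_append[of "rev \<gamma> @ [w]" "[v]"]
    by (simp add: insert_commute)
qed auto

lemma path_edges_subset: "e \<in> set (path_edges \<gamma>) \<Longrightarrow> e \<subseteq> set \<gamma>"
  by (induction \<gamma> rule: induct_list012) auto

lemma path_edges_in_edges: "successively (adjacent d) \<gamma> \<Longrightarrow> set (path_edges \<gamma>) \<subseteq> edges d"
  by (induction \<gamma> rule: induct_list012) auto

lemma distinct_path_edges: "distinct \<gamma> \<Longrightarrow> distinct (path_edges \<gamma>)"
proof (induction \<gamma> rule: induct_list012)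
  case (3 v w \<gamma>)
  then show ?case using path_edges_subset[of "{v, w}" "w # \<gamma>"] by auto
qed auto

lemma path_edges_split:
  assumes "e \<in> set (path_edges \<gamma>)"
  obtains \<alpha> x y \<beta> where "\<gamma> = \<alpha> @ x # y # \<beta>" "e = {x, y}"
  using assms
proof (induction \<gamma> arbitrary: thesis rule: induct_list012)
  case (3 v w \<gamma>)
  show ?case
  proof (cases "e = {v, w}")
    case True then show ?thesis using "3.prems"(1)[of "[]" v w \<gamma>] by simp
  next
    case False
    then have "e \<in> set (path_edges (w # \<gamma>))" using "3.prems"(2) by simp
    then obtain \<alpha> x y \<beta> where "w # \<gamma> = \<alpha> @ x # y # \<beta>" "e = {x, y}"
      using "3.IH"(2) by metis
    then show ?thesis using "3.prems"(1)[of "v # \<alpha>" x y \<beta>] by simp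
  qed
qed auto

lemma path_time_simps [simp]:
  "path_time t [] = 0" "path_time t [v] = 0"
  "path_time t (v # w # \<gamma>) = t {v, w} + path_time t (w # \<gamma>)"
  by (simp_all add: path_time_def)

lemma path_time_join:
  "path_time t (\<gamma> @ v # \<delta>) = path_time t (\<gamma> @ [v]) + path_time t (v # \<delta>)"
  by (simp add: path_time_def path_edges_join[of \<gamma> v \<delta>])

lemma path_time_rev: "path_time t (rev \<gamma>) = path_time t \<gamma>"
  by (simp add: path_time_def path_edges_rev rev_map[symmetric])

lemma path_time_nonneg:
  assumes "\<And>e. e \<in> edges d \<Longrightarrow> 0 \<le> t e" "successively (adjacent d) \<gamma>"
  shows "0 \<le> path_time t \<gamma>"
  unfolding path_time_def using assms path_edges_in_edges[of d \<gamma>]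
  by (intro sum_list_nonneg) auto

lemma path_time_distinct:
  "distinct \<gamma> \<Longrightarrow> path_time t \<gamma> = (\<Sum>e\<in>set (path_edges \<gamma>). t e)"
  by (simp add: path_time_def distinct_path_edges sum_list_distinct_conv_sum_set)

lemma sum_set_le_path_time:
  assumes "\<And>e. e \<in> edges d \<Longrightarrow> 0 \<le> t e" "successively (adjacent d) \<gamma>"
  shows "(\<Sum>e\<in>set (path_edges \<gamma>). t e) \<le> path_time t \<gamma>"
proof -
  have "(\<Sum>e\<in>set xs. t e) \<le> (\<Sum>e\<leftarrow>xs. t e)" if "\<And>e. e \<in> set xs \<Longrightarrow> 0 \<le> t e" for xs
    using that
  proof (induction xs)
    case (Cons x xs)
    then have "(\<Sum>e\<in>set xs. t e) \<le> (\<Sum>e\<leftarrow>xs. t e)" "0 \<le> t x" by auto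
    then show ?case by (simp add: sum.insert_if)
  qed simp
  then show ?thesis unfolding path_time_def using assms path_edges_in_edges[of d \<gamma>] by blast
qed

lemma is_path_join:
  assumes "is_path d u v \<gamma>" "is_path d v w \<delta>"
  shows "is_path d u w (\<gamma> @ tl \<delta>)"
    and "set (path_edges (\<gamma> @ tl \<delta>)) = set (path_edges \<gamma>) \<union> set (path_edges \<delta>)"
    and "path_time t (\<gamma> @ tl \<delta>) = path_time t \<gamma> + path_time t \<delta>"
proof -
  obtain \<alpha> \<beta> where eq: "\<gamma> = \<alpha> @ [v]" "\<delta> = v # \<beta>"
    using assms unfolding is_path_def
    by (metis append_butlast_last_id list.collapse)
  show "is_path d u w (\<gamma> @ tl \<delta>)" using assms unfolding eq is_path_def
    by (auto simp: successively_append_iff successively_Cons hd_append split: if_splits)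
  show "set (path_edges (\<gamma> @ tl \<delta>)) = set (path_edges \<gamma>) \<union> set (path_edges \<delta>)"
    unfolding eq using path_edges_join[of \<alpha> v \<beta>] by simp
  show "path_time t (\<gamma> @ tl \<delta>) = path_time t \<gamma> + path_time t \<delta>"
    unfolding eq using path_time_join[of t \<alpha> v \<beta>] by simp
qed

lemma is_path_rev: "is_path d u v \<gamma> \<Longrightarrow> is_path d v u (rev \<gamma>)"
  unfolding is_path_def by (simp add: hd_rev last_rev adjacent_sym)

definition joined :: "edge set \<Rightarrow> vertex \<Rightarrow> vertex \<Rightarrow> bool" where
  "joined F v w \<longleftrightarrow> (v, w) \<in> {(a, b). {a, b} \<in> F}\<^sup>*"

lemma joined_refl [simp]: "joined F v v"
  by (simp add: joined_def)

lemma joined_trans: "joined F u v \<Longrightarrow> joined F v w \<Longrightarrow> joined F u w"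
  unfolding joined_def by (rule rtrancl_trans)

lemma joined_edge: "{v, w} \<in> F \<Longrightarrow> joined F v w"
  unfolding joined_def by auto

lemma joined_mono: "joined F v w \<Longrightarrow> F \<subseteq> G \<Longrightarrow> joined G v w"
  unfolding joined_def using rtrancl_mono[of "{(a, b). {a, b} \<in> F}" "{(a, b). {a, b} \<in> G}"] by blast

lemma joined_sym: "joined F v w \<Longrightarrow> joined F w v"
proof -
  have "sym {(a, b). {a, b} \<in> F}" by (auto simp: sym_def insert_commute)
  then show "joined F v w \<Longrightarrow> joined F w v"
    unfolding joined_def using sym_rtrancl symD by metis
qed

lemma joined_induct [consumes 1, case_names refl step]:
  assumes "joined F v w" "P v"
    "\<And>a b. joined F v a \<Longrightarrow> {a, b} \<in> F \<Longrightarrow> P a \<Longrightarrow> P b"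
  shows "P w"
  using assms(1) unfolding joined_def
  by (induction rule: rtrancl_induct) (use assms joined_def in auto)

lemma joined_if_path:
  "set (path_edges \<gamma>) \<subseteq> F \<Longrightarrow> \<gamma> \<noteq> [] \<Longrightarrow> joined F (hd \<gamma>) (last \<gamma>)"
  by (induction \<gamma> rule: induct_list012) (auto intro: joined_trans joined_edge)

lemma path_if_joined:
  assumes "joined F v w" "v \<in> lattice d" "F \<subseteq> edges d"
  obtains \<gamma> where "is_path d v w \<gamma>" "set (path_edges \<gamma>) \<subseteq> F"
proof -
  have "\<exists>\<gamma>. is_path d v w \<gamma> \<and> set (path_edges \<gamma>) \<subseteq> F"
    using assms(1)
  proof (induction rule: joined_induct)
    case refl
    then show ?case using assms by (intro exI[of _ "[v]"]) (simp add: is_path_def)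
  next
    case (step a b)
    then obtain \<gamma> where \<gamma>: "is_path d v a \<gamma>" "set (path_edges \<gamma>) \<subseteq> F" by blast
    have "adjacent d a b" using step assms by auto
    then have "is_path d a b [a, b]" by (auto simp: is_path_def adjacent_def)
    from is_path_join[OF \<gamma>(1) this] \<gamma>(2) step show ?case
      by (intro exI[of _ "\<gamma> @ [b]"]) auto
  qed
  then show thesis using that by blast
qed

text \<open>
  A shortest path inside \<open>F\<close> has no repeated vertex, since the loop at a repetition could be cut out.
\<close>

lemma distinct_path_if_joined:
  assumes "joined F v w" "v \<in> lattice d" "F \<subseteq> edges d"
  obtains \<gamma> where "is_path d v w \<gamma>" "set (path_edges \<gamma>) \<subseteq> F" "distinct \<gamma>"
proof -
  define P where "P \<gamma> \<longleftrightarrow> is_path d v w \<gamma> \<and> set (path_edges \<gamma>) \<subseteq> F" for \<gamma>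
  have "\<exists>\<gamma>. P \<gamma>" using path_if_joined[OF assms] P_def by metis
  then obtain \<gamma> where \<gamma>: "P \<gamma>" and least: "\<And>\<delta>. P \<delta> \<Longrightarrow> length \<gamma> \<le> length \<delta>"
    using ex_has_least_nat[of P _ length] by blast
  have "distinct \<gamma>"
  proof (rule ccontr)
    assume "\<not> distinct \<gamma>"
    then obtain \<alpha> u \<beta> \<eta> where eq: "\<gamma> = \<alpha> @ [u] @ \<beta> @ [u] @ \<eta>"
      using not_distinct_decomp by blast
    have "is_path d v w (\<alpha> @ u # \<eta>)"
      using \<gamma> unfolding P_def eq is_path_def
      by (auto simp: successively_append_iff successively_Cons hd_append split: if_splits)
    moreover have "set (path_edges (\<alpha> @ u # \<eta>)) \<subseteq> F"
      using \<gamma> unfolding P_def eq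
      by (simp add: path_edges_join[of \<alpha> u \<eta>] path_edges_join[of \<alpha> u "\<beta> @ u # \<eta>"]
          path_edges_join[of "u # \<beta>" u \<eta>, simplified])
    ultimately have "length \<gamma> \<le> length (\<alpha> @ u # \<eta>)" using least P_def by blast
    then show False by (simp add: eq)
  qed
  then show thesis using \<gamma> that P_def by blast
qed

section \<open>Cubes and spheres\<close>

definition supdist :: "nat \<Rightarrow> vertex \<Rightarrow> vertex \<Rightarrow> int" where
  "supdist d x z = Max ((\<lambda>i. \<bar>z i - x i\<bar>) ` {..<d})"

lemma supdist_le_iff: "d > 0 \<Longrightarrow> supdist d x z \<le> k \<longleftrightarrow> (\<forall>i<d. \<bar>z i - x i\<bar> \<le> k)"
  unfolding supdist_def by (subst Max_le_iff) (auto simp: lessThan_empty_iff)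

lemma coordinate_le_supdist: "i < d \<Longrightarrow> \<bar>z i - x i\<bar> \<le> supdist d x z"
  unfolding supdist_def by (rule Max_ge) auto

lemma supdist_attained:
  assumes "d > 0" obtains i where "i < d" "\<bar>z i - x i\<bar> = supdist d x z"
proof -
  have "supdist d x z \<in> (\<lambda>i. \<bar>z i - x i\<bar>) ` {..<d}"
    unfolding supdist_def using assms by (intro Max_in) (auto simp: lessThan_empty_iff)
  then show thesis using that by (metis (no_types, lifting) imageE lessThan_iff)
qed

lemma supdist_commute: "supdist d x z = supdist d z x"
  by (simp add: supdist_def abs_minus_commute)

lemma supdist_triangle:
  assumes "d > 0" shows "supdist d x z \<le> supdist d x y + supdist d y z"
  unfolding supdist_le_iff[OF assms]
proof (intro allI impI)
  fix i assume "i < d"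
  with coordinate_le_supdist[OF this, of y x] coordinate_le_supdist[OF this, of z y]
  show "\<bar>z i - x i\<bar> \<le> supdist d x y + supdist d y z" by linarith
qed

lemma supdist_self: "d > 0 \<Longrightarrow> supdist d x x = 0"
  using supdist_attained[of d x x] by force

lemma supdist_adjacent:
  assumes "adjacent d v w" "d > 0"
  shows "supdist d v w \<le> 1"
  unfolding supdist_le_iff[OF assms(2)]
proof (intro allI impI)
  fix i assume "i < d"
  then have "\<bar>v i - w i\<bar> \<le> (\<Sum>i<d. \<bar>v i - w i\<bar>)" by (intro member_le_sum) auto
  then show "\<bar>w i - v i\<bar> \<le> 1" using assms by (simp add: adjacent_def)
qed

lemma supdist_step:
  assumes "adjacent d v w" "d > 0"
  shows "\<bar>supdist d x w - supdist d x v\<bar> \<le> 1"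
  using supdist_adjacent[OF assms] supdist_triangle[OF assms(2), of x v w]
    supdist_triangle[OF assms(2), of x w v] supdist_commute[of d v w] by linarith

text \<open>
  A discrete intermediate value theorem. That the hit is the first one keeps the initial part of
  the path below the level.
\<close>

lemma path_hits_level:
  fixes f :: "vertex \<Rightarrow> int"
  assumes "\<And>a b. adjacent d a b \<Longrightarrow> \<bar>f b - f a\<bar> \<le> 1"
    and "successively (adjacent d) \<gamma>" "\<gamma> \<noteq> []" "f (hd \<gamma>) \<le> k" "k \<le> f (last \<gamma>)"
  obtains \<alpha> u \<beta> where "\<gamma> = \<alpha> @ u # \<beta>" "f u = k" "\<And>a. a \<in> set \<alpha> \<Longrightarrow> f a < k"
  using assms(2-)
proof (induction \<gamma> arbitrary: thesis)
  case (Cons v \<gamma>)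
  show ?case
  proof (cases "f v = k")
    case True then show ?thesis using Cons.prems(1)[of "[]" v \<gamma>] by simp
  next
    case False
    then have less: "f v < k" using Cons.prems by simp
    then have ne: "\<gamma> \<noteq> []" using Cons.prems by auto
    have "adjacent d v (hd \<gamma>)" using Cons.prems(2) ne by (cases \<gamma>) auto
    then have "f (hd \<gamma>) \<le> k" using assms(1)[of v "hd \<gamma>"] less by linarith
    then obtain \<alpha> u \<beta> where "\<gamma> = \<alpha> @ u # \<beta>" "f u = k" "\<And>a. a \<in> set \<alpha> \<Longrightarrow> f a < k"
      using Cons.IH Cons.prems ne by (metis last_ConsR successively_Cons)
    then show ?thesis using Cons.prems(1)[of "v # \<alpha>" u \<beta>] less by auto
  qed
qed simp

lemma bij_betw_lattice_PiE:
  "bij_betw (\<lambda>z. restrict z {..<d}) {z \<in> lattice d. \<forall>i<d. z i \<in> B i} (PiE {..<d} B)"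
proof (rule bij_betw_byWitness[where f' = "\<lambda>g i. if i < d then g i else 0"])
  show "\<forall>z\<in>{z \<in> lattice d. \<forall>i<d. z i \<in> B i}.
      (\<lambda>i. if i < d then restrict z {..<d} i else 0) = z"
    by (auto simp: lattice_def fun_eq_iff)
  show "\<forall>g\<in>PiE {..<d} B. restrict (\<lambda>i. if i < d then g i else 0) {..<d} = g"
    by (auto simp: fun_eq_iff restrict_def PiE_def extensional_def)
  show "(\<lambda>z. restrict z {..<d}) ` {z \<in> lattice d. \<forall>i<d. z i \<in> B i} \<subseteq> PiE {..<d} B"
    by (intro image_subsetI) (simp add: PiE_iff)
  show "(\<lambda>g i. if i < d then g i else 0) ` PiE {..<d} B \<subseteq> {z \<in> lattice d. \<forall>i<d. z i \<in> B i}"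
    by (intro image_subsetI) (simp add: lattice_def PiE_iff)
qed

lemma countable_lattice: "countable (lattice d)"
proof -
  have "bij_betw (\<lambda>z. restrict z {..<d}) (lattice d) (PiE {..<d} (\<lambda>_. UNIV))"
    using bij_betw_lattice_PiE[of d "\<lambda>_. UNIV"] by simp
  moreover have "countable (PiE {..<d} (\<lambda>_. UNIV :: int set))" by (intro countable_PiE) auto
  ultimately show ?thesis using countableI_bij2 by blast
qed

lemma finite_lattice_box:
  assumes "\<And>i. i < d \<Longrightarrow> finite (B i)"
  shows "finite {z \<in> lattice d. \<forall>i<d. z i \<in> B i}"
  using bij_betw_finite[OF bij_betw_lattice_PiE, of d B] assms by (auto intro!: finite_PiE)

lemma card_lattice_box: "card {z \<in> lattice d. \<forall>i<d. z i \<in> B i} = (\<Prod>i<d. card (B i))"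
  using bij_betw_same_card[OF bij_betw_lattice_PiE, of d B] by (simp add: card_PiE)

definition cube :: "nat \<Rightarrow> vertex \<Rightarrow> int \<Rightarrow> vertex set" where
  "cube d x k = {z \<in> lattice d. supdist d x z \<le> k}"

definition shell :: "nat \<Rightarrow> vertex \<Rightarrow> int \<Rightarrow> vertex set" where
  "shell d x k = {z \<in> lattice d. supdist d x z = k}"

lemma cube_eq: "d > 0 \<Longrightarrow> cube d x k = {z \<in> lattice d. \<forall>i<d. z i \<in> {x i - k..x i + k}}"
  by (auto simp: cube_def supdist_le_iff abs_le_iff algebra_simps)

lemma finite_cube: "d > 0 \<Longrightarrow> finite (cube d x k)"
  unfolding cube_eq by (rule finite_lattice_box) simp

lemma card_cube: "d > 0 \<Longrightarrow> 0 \<le> k \<Longrightarrow> card (cube d x k) = nat (2 * k + 1) ^ d"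
  unfolding cube_eq card_lattice_box by (simp add: algebra_simps)

lemma shell_subset_cube: "shell d x k \<subseteq> cube d x k"
  by (auto simp: shell_def cube_def)

lemma finite_shell: "d > 0 \<Longrightarrow> finite (shell d x k)"
  using finite_cube shell_subset_cube finite_subset by metis

text \<open>
  A sphere is the union of \<open>2 d\<close> faces, on each of which one coordinate is fixed. The exponent
  \<open>d - 1\<close> is what the count of blocked steps below depends on.
\<close>

lemma card_shell:
  assumes "d > 0" "0 \<le> k"
  shows "card (shell d x k) \<le> 2 * d * nat (2 * k + 1) ^ (d - 1)"
proof -
  define B where "B i c j = (if j = i then {c} else {x j - k..x j + k})" for i j :: nat and c :: int
  define face where "face i c = {z \<in> lattice d. \<forall>j<d. z j \<in> B i c j}" for i c
  have card_face: "card (face i c) = nat (2 * k + 1) ^ (d - 1)" if "i < d" for i c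
  proof -
    have "card (face i c) = (\<Prod>j<d. if j = i then 1 else nat (2 * k + 1))"
      unfolding face_def card_lattice_box
      by (intro prod.cong) (auto simp: B_def algebra_simps)
    also have "\<dots> = (\<Prod>j\<in>{..<d} - {i}. nat (2 * k + 1))"
      using that by (subst prod.remove[of _ i]) auto
    finally show ?thesis using that by (simp add: card_Diff_singleton)
  qed
  have "shell d x k \<subseteq> (\<Union>i<d. face i (x i + k) \<union> face i (x i - k))"
  proof
    fix z assume "z \<in> shell d x k"
    then have z: "z \<in> lattice d" "supdist d x z = k" by (auto simp: shell_def)
    obtain i where i: "i < d" "\<bar>z i - x i\<bar> = k" using supdist_attained[OF assms(1)] z by metis
    have "\<bar>z j - x j\<bar> \<le> k" if "j < d" for j using coordinate_le_supdist[OF that, of z x] z by simp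
    then have "z \<in> face i (z i)" using z by (auto simp: face_def B_def abs_le_iff algebra_simps)
    moreover have "z i = x i + k \<or> z i = x i - k" using i by linarith
    ultimately have "z \<in> face i (x i + k) \<union> face i (x i - k)" by auto
    then show "z \<in> (\<Union>i<d. face i (x i + k) \<union> face i (x i - k))" using i(1) by blast
  qed
  moreover have "finite (\<Union>i<d. face i (x i + k) \<union> face i (x i - k))"
    unfolding face_def by (intro finite_UN_I finite_UnI finite_lattice_box) (auto simp: B_def)
  ultimately have "card (shell d x k) \<le> card (\<Union>i<d. face i (x i + k) \<union> face i (x i - k))"
    by (rule card_mono[rotated])
  also have "\<dots> \<le> (\<Sum>i<d. card (face i (x i + k) \<union> face i (x i - k)))" by (rule card_UN_le) simp
  also have "\<dots> \<le> (\<Sum>i<d. 2 * nat (2 * k + 1) ^ (d - 1))"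
    by (intro sum_mono order_trans[OF card_Un_le]) (simp add: card_face)
  finally show ?thesis by simp
qed

definition inner_edges :: "nat \<Rightarrow> vertex set \<Rightarrow> edge set" where
  "inner_edges d S = {e \<in> edges d. e \<subseteq> S}"

lemma finite_inner_edges: "finite S \<Longrightarrow> finite (inner_edges d S)"
  by (rule finite_subset[of _ "Pow S"]) (auto simp: inner_edges_def)

lemma inner_edges_subset: "inner_edges d S \<subseteq> edges d"
  by (auto simp: inner_edges_def)

lemma edge_in_inner_edges_iff: "{v, w} \<in> inner_edges d S \<longleftrightarrow> adjacent d v w \<and> v \<in> S \<and> w \<in> S"
  by (auto simp: inner_edges_def)

section \<open>Bernoulli configurations on finitely many edges\<close>

text \<open>
  The probability of \<open>A\<close> when each element of \<open>E\<close> is open independently with probability \<open>p\<close>; a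
  configuration is the set of its open elements. As an explicit polynomial in \<open>p\<close> it can be
  differentiated.
\<close>

definition bern :: "'e set \<Rightarrow> real \<Rightarrow> ('e set \<Rightarrow> bool) \<Rightarrow> real" where
  "bern E p A = (\<Sum>\<omega> | \<omega> \<subseteq> E \<and> A \<omega>. p ^ card \<omega> * (1 - p) ^ card (E - \<omega>))"

lemma bern_cong:
  assumes "\<And>\<omega>. \<omega> \<subseteq> E \<Longrightarrow> A \<omega> \<longleftrightarrow> B \<omega>"
  shows "bern E p A = bern E p B"
  unfolding bern_def using assms by (intro sum.cong) auto

lemma bern_nonneg: "0 \<le> p \<Longrightarrow> p \<le> 1 \<Longrightarrow> 0 \<le> bern E p A"
  unfolding bern_def by (intro sum_nonneg) auto

lemma bern_True:
  assumes "finite E" shows "bern E p (\<lambda>_. True) = 1"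
  using prod_add[OF assms, of "\<lambda>_. p" "\<lambda>_. 1 - p"] by (simp add: bern_def Pow_def)

lemma bern_compl:
  assumes "finite E" shows "bern E p (\<lambda>\<omega>. \<not> A \<omega>) = 1 - bern E p A"
proof -
  have "bern E p (\<lambda>_. True) = bern E p A + bern E p (\<lambda>\<omega>. \<not> A \<omega>)"
    unfolding bern_def using assms by (subst sum.union_disjoint[symmetric]) (auto intro!: sum.cong)
  then show ?thesis using bern_True[OF assms, of p] by simp
qed

lemma bern_eq_sum_indicator:
  assumes "finite E"
  shows "bern E p A = (\<Sum>\<omega>\<in>Pow E. p ^ card \<omega> * (1 - p) ^ card (E - \<omega>) * of_bool (A \<omega>))"
  unfolding bern_def using assms
  by (intro sum.mono_neutral_cong_left) auto

lemma bern_product: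
  assumes "finite E" "finite F" "E \<inter> F = {}"
  shows "bern (E \<union> F) p (\<lambda>\<omega>. A (\<omega> \<inter> E) \<and> B (\<omega> \<inter> F)) = bern E p A * bern F p B"
proof -
  let ?W = "\<lambda>E \<omega>. p ^ card \<omega> * (1 - p) ^ card (E - \<omega>)"
  have "bern E p A * bern F p B = (\<Sum>(\<omega>, \<eta>)\<in>{\<omega>. \<omega> \<subseteq> E \<and> A \<omega>} \<times> {\<eta>. \<eta> \<subseteq> F \<and> B \<eta>}. ?W E \<omega> * ?W F \<eta>)"
    unfolding bern_def sum_product sum.cartesian_product ..
  also have "\<dots> = (\<Sum>\<omega> | \<omega> \<subseteq> E \<union> F \<and> A (\<omega> \<inter> E) \<and> B (\<omega> \<inter> F). ?W (E \<union> F) \<omega>)"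
  proof (rule sum.reindex_bij_witness[where i = "\<lambda>\<omega>. (\<omega> \<inter> E, \<omega> \<inter> F)" and j = "\<lambda>(\<omega>, \<eta>). \<omega> \<union> \<eta>"], goal_cases)
    case (1 a)
    then show ?case using assms by auto
  next
    case (2 a)
    obtain \<omega> \<eta> where a: "a = (\<omega>, \<eta>)" by force
    then have "(\<omega> \<union> \<eta>) \<inter> E = \<omega>" "(\<omega> \<union> \<eta>) \<inter> F = \<eta>" using 2 assms by auto
    then show ?case using 2 a by auto
  next
    case (5 a)
    obtain \<omega> \<eta> where a: "a = (\<omega>, \<eta>)" by force
    have sub: "\<omega> \<subseteq> E" "\<eta> \<subseteq> F" using 5 a by auto
    then have fin: "finite \<omega>" "finite \<eta>" using assms finite_subset by blast+
    have "card (\<omega> \<union> \<eta>) = card \<omega> + card \<eta>"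
      using sub fin assms by (intro card_Un_disjoint) auto
    moreover have "card (E \<union> F - (\<omega> \<union> \<eta>)) = card (E - \<omega>) + card (F - \<eta>)"
    proof -
      have "E \<union> F - (\<omega> \<union> \<eta>) = (E - \<omega>) \<union> (F - \<eta>)" using sub assms by auto
      then show ?thesis using assms by (simp, subst card_Un_disjoint) auto
    qed
    ultimately show ?case using a by (simp add: power_add)
  qed (use assms in auto)
  finally show ?thesis by (simp add: bern_def)
qed

lemma bern_marginal:
  assumes "finite F" "E \<subseteq> F"
  shows "bern F p (\<lambda>\<omega>. A (\<omega> \<inter> E)) = bern E p A"
  using bern_product[of E "F - E" p A "\<lambda>_. True"] assms finite_subset[OF assms(2,1)]
  by (simp add: Un_absorb1 bern_True)

text \<open>
  Russo's formula. The derivative of the weight of a configuration has one term for each edge. For a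
  fixed edge \<open>e\<close> the terms of a configuration without \<open>e\<close> and of the same configuration with \<open>e\<close> cancel,
  unless exactly one of the two is in the event. Multiplication by \<open>1 - p\<close>, the
  probability that \<open>e\<close> is closed, turns the probability that \<open>e\<close> is pivotal into the probability
  that it is pivotal and closed.
\<close>

lemma russo_formula:
  assumes "finite E" and mono: "\<And>\<omega> \<eta>. A \<omega> \<Longrightarrow> \<omega> \<subseteq> \<eta> \<Longrightarrow> \<eta> \<subseteq> E \<Longrightarrow> A \<eta>"
  obtains D where "((\<lambda>p. bern E p A) has_real_derivative D) (at p)"
    "(1 - p) * D = (\<Sum>e\<in>E. bern E p (\<lambda>\<omega>. e \<notin> \<omega> \<and> \<not> A \<omega> \<and> A (insert e \<omega>)))"
proof -
  define m where "m = card E"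
  define W where "W \<omega> = p ^ card \<omega> * (1 - p) ^ card (E - \<omega>)" for \<omega>
  define V where "V \<omega> e = (if e \<in> \<omega> then p ^ (card \<omega> - 1) * (1 - p) ^ card (E - \<omega>)
    else - (p ^ card \<omega> * (1 - p) ^ (card (E - \<omega>) - 1)))" for \<omega> e
  define D where "D = (\<Sum>\<omega> | \<omega> \<subseteq> E \<and> A \<omega>. \<Sum>e\<in>E. V \<omega> e)"
  have fin: "finite \<omega>" if "\<omega> \<subseteq> E" for \<omega> using that assms(1) finite_subset by blast
  have "((\<lambda>p. p ^ card \<omega> * (1 - p) ^ card (E - \<omega>)) has_real_derivative (\<Sum>e\<in>E. V \<omega> e)) (at p)"
    if "\<omega> \<subseteq> E" for \<omega>
  proof -
    have "(\<Sum>e\<in>E. V \<omega> e) = (\<Sum>e\<in>\<omega>. V \<omega> e) + (\<Sum>e\<in>E-\<omega>. V \<omega> e)"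
      using that assms(1) by (metis sum.subset_diff add.commute)
    also have "\<dots> = real (card \<omega>) * p ^ (card \<omega> - 1) * (1 - p) ^ card (E - \<omega>)
        - p ^ card \<omega> * (real (card (E - \<omega>)) * (1 - p) ^ (card (E - \<omega>) - 1))"
      by (simp add: V_def)
    finally show ?thesis
      by (auto intro!: derivative_eq_intros simp: algebra_simps)
  qed
  then have "((\<lambda>p. bern E p A) has_real_derivative D) (at p)"
    unfolding bern_def D_def by (intro DERIV_sum) auto
  moreover have "(1 - p) * D = (\<Sum>e\<in>E. bern E p (\<lambda>\<omega>. e \<notin> \<omega> \<and> \<not> A \<omega> \<and> A (insert e \<omega>)))"
  proof -
    have "(1 - p) * (\<Sum>\<omega> | \<omega> \<subseteq> E \<and> A \<omega>. V \<omega> e) = bern E p (\<lambda>\<omega>. e \<notin> \<omega> \<and> \<not> A \<omega> \<and> A (insert e \<omega>))"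
      if e: "e \<in> E" for e
    proof -
      have fE: "finite {\<omega>. \<omega> \<subseteq> E \<and> Q \<omega>}" for Q using assms(1) by auto
      \<comment> \<open>Multiplied by \<open>1 - p\<close>, the term of a configuration containing \<open>e\<close> becomes the weight of
        that configuration with \<open>e\<close> removed.\<close>
      have V_in: "(1 - p) * V \<omega> e = W (\<omega> - {e})" if "\<omega> \<subseteq> E" "e \<in> \<omega>" for \<omega>
      proof -
        have "E - (\<omega> - {e}) = insert e (E - \<omega>)" using that e by auto
        then have "card (E - (\<omega> - {e})) = Suc (card (E - \<omega>))" using assms(1) that by simp
        then show ?thesis using that fin by (simp add: V_def W_def)
      qed
      have V_out: "(1 - p) * V \<omega> e = - W \<omega>" if "\<omega> \<subseteq> E" "e \<notin> \<omega>" for \<omega>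
      proof -
        have "card (E - \<omega>) > 0" using that e assms(1) by (auto simp: card_gt_0_iff)
        then show ?thesis using that by (simp add: V_def W_def power_eq_if)
      qed
      have "(1 - p) * (\<Sum>\<omega> | \<omega> \<subseteq> E \<and> A \<omega>. V \<omega> e)
          = (\<Sum>\<omega> | \<omega> \<subseteq> E \<and> A \<omega>. (1 - p) * V \<omega> e)" by (simp add: sum_distrib_left)
      also have "\<dots> = (\<Sum>\<omega> | \<omega> \<subseteq> E \<and> (A \<omega> \<and> e \<in> \<omega>). (1 - p) * V \<omega> e)
          + (\<Sum>\<omega> | \<omega> \<subseteq> E \<and> (A \<omega> \<and> e \<notin> \<omega>). (1 - p) * V \<omega> e)"
        using fE by (subst sum.union_disjoint[symmetric]) (auto intro!: sum.cong)
      also have "(\<Sum>\<omega> | \<omega> \<subseteq> E \<and> (A \<omega> \<and> e \<notin> \<omega>). (1 - p) * V \<omega> e)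
          = - (\<Sum>\<omega> | \<omega> \<subseteq> E \<and> (A \<omega> \<and> e \<notin> \<omega>). W \<omega>)"
        unfolding sum_negf[symmetric] by (intro sum.cong) (auto simp: V_out)
      also have "(\<Sum>\<omega> | \<omega> \<subseteq> E \<and> (A \<omega> \<and> e \<in> \<omega>). (1 - p) * V \<omega> e)
          = (\<Sum>\<omega> | \<omega> \<subseteq> E \<and> (A (insert e \<omega>) \<and> e \<notin> \<omega>). W \<omega>)"
        by (rule sum.reindex_bij_witness[where i = "insert e" and j = "\<lambda>\<omega>. \<omega> - {e}"])
          (use e in \<open>auto simp: V_in insert_absorb\<close>)
      also have "(\<Sum>\<omega> | \<omega> \<subseteq> E \<and> (A (insert e \<omega>) \<and> e \<notin> \<omega>). W \<omega>)
          = (\<Sum>\<omega> | \<omega> \<subseteq> E \<and> (A \<omega> \<and> e \<notin> \<omega>). W \<omega>)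
          + (\<Sum>\<omega> | \<omega> \<subseteq> E \<and> (e \<notin> \<omega> \<and> \<not> A \<omega> \<and> A (insert e \<omega>)). W \<omega>)"
        using fE by (subst sum.union_disjoint[symmetric])
          (auto intro!: sum.cong intro: mono[OF _ subset_insertI] simp: e)
      finally show ?thesis by (simp add: bern_def W_def)
    qed
    then show ?thesis unfolding D_def by (subst sum.swap) (simp add: sum_distrib_left)
  qed
  ultimately show thesis using that by blast
qed

section \<open>The Duminil-Copin--Tassion argument\<close>

definition exits :: "nat \<Rightarrow> vertex set \<Rightarrow> (vertex \<times> vertex) set" where
  "exits d S = {(x, y). x \<in> S \<and> y \<notin> S \<and> adjacent d x y}"

text \<open>
  The expected number of open edges that leave \<open>S\<close> from a vertex joined to the origin inside \<open>S\<close>.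
\<close>

definition dct_phi :: "nat \<Rightarrow> real \<Rightarrow> vertex set \<Rightarrow> real" where
  "dct_phi d p S = p * (\<Sum>(x, y)\<in>exits d S. bern (inner_edges d S) p (\<lambda>\<omega>. joined \<omega> origin x))"

definition reaches_boundary :: "nat \<Rightarrow> int \<Rightarrow> edge set \<Rightarrow> vertex \<Rightarrow> bool" where
  "reaches_boundary d n \<omega> v \<longleftrightarrow> (\<exists>z\<in>shell d origin n. joined \<omega> v z)"

lemma finite_exits:
  assumes "finite S" "d > 0" shows "finite (exits d S)"
proof -
  have "exits d S \<subseteq> (SIGMA x:S. cube d x 1)"
    using supdist_adjacent[OF _ assms(2)] by (auto simp: exits_def cube_def adjacent_def)
  then show ?thesis using assms finite_cube by (meson finite_SigmaI finite_subset)
qed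

lemma origin_in_lattice [simp]: "origin \<in> lattice d"
  by (simp add: origin_def lattice_def)

text \<open>
  Being joined is an increasing event, so the derivative given by Russo's formula is nonnegative.
\<close>

lemma dct_phi_mono:
  assumes "finite S" "d > 0" "0 \<le> p" "p \<le> q" "q \<le> 1"
  shows "dct_phi d p S \<le> dct_phi d q S"
proof -
  have "bern (inner_edges d S) p (\<lambda>\<omega>. joined \<omega> origin x)
      \<le> bern (inner_edges d S) q (\<lambda>\<omega>. joined \<omega> origin x)" for x
  proof (rule DERIV_nonneg_imp_increasing_open[OF assms(4)])
    fix r assume r: "p < r" "r < q"
    have fin: "finite (inner_edges d S)" using assms finite_inner_edges by blast
    obtain D where D: "((\<lambda>p. bern (inner_edges d S) p (\<lambda>\<omega>. joined \<omega> origin x)) has_real_derivative D) (at r)"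
      "(1 - r) * D = (\<Sum>e\<in>inner_edges d S. bern (inner_edges d S) r (\<lambda>\<omega>. e \<notin> \<omega> \<and>
          \<not> joined \<omega> origin x \<and> joined (insert e \<omega>) origin x))"
      by (rule russo_formula[OF fin, of "\<lambda>\<omega>. joined \<omega> origin x" r]) (auto intro: joined_mono)
    have "0 \<le> (1 - r) * D" unfolding D(2) using r assms by (intro sum_nonneg bern_nonneg) auto
    then have "0 \<le> D" using r assms by (simp add: zero_le_mult_iff)
    then show "\<exists>y. ((\<lambda>p. bern (inner_edges d S) p (\<lambda>\<omega>. joined \<omega> origin x)) has_real_derivative y) (at r) \<and> 0 \<le> y"
      using D(1) by blast
  next
    show "continuous_on {p..q} (\<lambda>p. bern (inner_edges d S) p (\<lambda>\<omega>. joined \<omega> origin x))"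
      unfolding bern_def by (intro continuous_intros)
  qed
  then show ?thesis unfolding dct_phi_def using assms
    by (intro mult_mono sum_mono) (auto intro!: sum_nonneg bern_nonneg)
qed

text \<open>
  Let \<open>cut \<omega>\<close> be the set of vertices that are not joined to the boundary. If it contains the
  origin, every edge leaving it from the cluster of the origin is pivotal. Given that it equals
  \<open>S\<close>, which depends only on edges not inside \<open>S\<close>, the cluster of the origin inside \<open>S\<close> is still that
  of independent percolation, and so the conditional expectation of the number of pivotal edges is
  at least \<open>dct_phi d p S\<close>.
\<close>

lemma sharpness_inequality:
  fixes n :: int
  assumes "d > 0" "0 < n" "0 \<le> p" "p \<le> 1"
    and phi: "\<And>S. finite S \<Longrightarrow> S \<subseteq> lattice d \<Longrightarrow> origin \<in> S \<Longrightarrow> 1 \<le> dct_phi d p S"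
    and E: "E = inner_edges d (cube d origin n)"
    and A: "A = (\<lambda>\<omega>. reaches_boundary d n \<omega> origin)"
  shows "1 - bern E p A \<le> (\<Sum>e\<in>E. bern E p (\<lambda>\<omega>. e \<notin> \<omega> \<and> \<not> A \<omega> \<and> A (insert e \<omega>)))"
proof -
  define \<Lambda> where "\<Lambda> = cube d origin n"
  have fin\<Lambda>: "finite \<Lambda>" using assms(1) finite_cube \<Lambda>_def by blast
  have finE: "finite E" unfolding E using finite_inner_edges fin\<Lambda> \<Lambda>_def by blast
  define cut where "cut \<omega> = {x \<in> \<Lambda>. \<not> reaches_boundary d n \<omega> x}" for \<omega>
  define W where "W \<omega> = p ^ card \<omega> * (1 - p) ^ card (E - \<omega>)" for \<omega>
  have W_nonneg: "0 \<le> W \<omega>" for \<omega> using assms by (simp add: W_def)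
  have origin_in: "origin \<in> \<Lambda>"
    using assms by (simp add: \<Lambda>_def cube_def supdist_self)
  have cut_shell: "cut \<omega> \<inter> shell d origin n = {}" for \<omega>
    unfolding cut_def reaches_boundary_def by force
  \<comment> \<open>A neighbour of the cut-off region stays in the box, because the region avoids the boundary.\<close>
  have exit_in: "{x, y} \<in> E" "y \<in> \<Lambda>"
    if "(x, y) \<in> exits d (cut \<omega>)" for x y \<omega>
  proof -
    have x: "x \<in> \<Lambda>" "x \<notin> shell d origin n" "adjacent d x y" "x \<in> cut \<omega>"
      using that cut_shell by (auto simp: exits_def cut_def)
    then have "supdist d origin x < n" by (auto simp: \<Lambda>_def cube_def shell_def)
    then have "supdist d origin y \<le> n" using supdist_step[OF x(3) assms(1), of origin] by linarith
    then show "y \<in> \<Lambda>" using x by (simp add: \<Lambda>_def cube_def adjacent_def)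
    then show "{x, y} \<in> E" using x by (simp add: E edge_in_inner_edges_iff \<Lambda>_def)
  qed
  have exit_y: "reaches_boundary d n \<omega> y" if "(x, y) \<in> exits d (cut \<omega>)" for x y \<omega>
    using that exit_in(2)[OF that] by (auto simp: exits_def cut_def)
  \<comment> \<open>Opening an exit of the cut-off region next to the cluster of the origin joins the origin to the boundary.\<close>
  have pivotal: "{x, y} \<notin> \<omega>" "A (insert {x, y} \<omega>)"
    if piv: "\<not> A \<omega>" "(x, y) \<in> exits d (cut \<omega>)" "joined \<omega> origin x" for x y \<omega>
  proof -
    obtain z where z: "z \<in> shell d origin n" "joined \<omega> y z"
      using exit_y[OF piv(2)] by (auto simp: reaches_boundary_def)
    show "{x, y} \<notin> \<omega>"
    proof
      assume "{x, y} \<in> \<omega>"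
      then have "joined \<omega> origin z" using piv(3) z(2) joined_edge joined_trans by metis
      then show False using piv(1) z(1) by (auto simp: A reaches_boundary_def)
    qed
    have "joined (insert {x, y} \<omega>) origin z"
      using joined_mono[OF piv(3)] joined_mono[OF z(2)] joined_edge[of x y "insert {x, y} \<omega>"]
        joined_trans by (metis insertI1 subset_insertI)
    then show "A (insert {x, y} \<omega>)" using z(1) by (auto simp: A reaches_boundary_def)
  qed
  have count: "card {(x, y) \<in> exits d (cut \<omega>). joined (\<omega> \<inter> inner_edges d (cut \<omega>)) origin x}
      \<le> card {e \<in> E. e \<notin> \<omega> \<and> A (insert e \<omega>)}" if "\<not> A \<omega>" for \<omega>
  proof (rule card_inj_on_le[where f = "\<lambda>(x, y). {x, y}"])
    show "inj_on (\<lambda>(x, y). {x, y})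
        {(x, y) \<in> exits d (cut \<omega>). joined (\<omega> \<inter> inner_edges d (cut \<omega>)) origin x}"
      by (auto simp: inj_on_def exits_def doubleton_eq_iff)
    show "(\<lambda>(x, y). {x, y}) ` {(x, y) \<in> exits d (cut \<omega>). joined (\<omega> \<inter> inner_edges d (cut \<omega>)) origin x}
        \<subseteq> {e \<in> E. e \<notin> \<omega> \<and> A (insert e \<omega>)}"
      using exit_in(1) pivotal[OF that] joined_mono[of "\<omega> \<inter> inner_edges d (cut \<omega>)" origin _ \<omega>] by auto
  qed (use finE in auto)
  \<comment> \<open>The cut-off region is determined by the edges that are not inside it.\<close>
  have cut_local: "cut (\<omega> - inner_edges d S) = S \<longleftrightarrow> cut \<omega> = S" if "\<omega> \<subseteq> E" for \<omega> S
  proof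
    assume S: "cut \<omega> = S"
    have "reaches_boundary d n (\<omega> - inner_edges d S) y" if y: "reaches_boundary d n \<omega> y" for y
    proof -
      obtain z where z: "z \<in> shell d origin n" "joined \<omega> y z"
        using y by (auto simp: reaches_boundary_def)
      have "joined (\<omega> - inner_edges d S) z y" using joined_sym[OF z(2)]
      proof (induction rule: joined_induct)
        case (step a b)
        have "reaches_boundary d n \<omega> a"
          using step(1) z(1) joined_sym by (auto simp: reaches_boundary_def)
        then have "a \<notin> S" using S by (auto simp: cut_def)
        then have "{a, b} \<in> \<omega> - inner_edges d S" using step(2) by (auto simp: inner_edges_def)
        then show ?case using step(3) joined_edge joined_trans by metis
      qed simp
      then show ?thesis using z(1) joined_sym by (auto simp: reaches_boundary_def)
    qed
    moreover have "reaches_boundary d n \<omega> y" if "reaches_boundary d n (\<omega> - inner_edges d S) y" for y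
      using that joined_mono[of "\<omega> - inner_edges d S" _ _ \<omega>] by (auto simp: reaches_boundary_def)
    ultimately show "cut (\<omega> - inner_edges d S) = S" using S unfolding cut_def by blast
  next
    assume S: "cut (\<omega> - inner_edges d S) = S"
    have "reaches_boundary d n (\<omega> - inner_edges d S) y" if y: "reaches_boundary d n \<omega> y" "y \<in> \<Lambda>" for y
    proof -
      obtain z where z: "z \<in> shell d origin n" "joined \<omega> y z"
        using y by (auto simp: reaches_boundary_def)
      have "reaches_boundary d n (\<omega> - inner_edges d S) y \<and> y \<in> \<Lambda>" using joined_sym[OF z(2)]
      proof (induction rule: joined_induct)
        case refl
        have "z \<in> \<Lambda>" using z(1) shell_subset_cube unfolding \<Lambda>_def by blast
        then show ?case unfolding reaches_boundary_def by (intro conjI bexI[OF joined_refl z(1)])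
      next
        case (step a b)
        have "a \<notin> cut (\<omega> - inner_edges d S)" using step(3) by (simp add: cut_def)
        then have "a \<notin> S" unfolding S .
        then have "{b, a} \<in> \<omega> - inner_edges d S"
          using step(2) by (auto simp: inner_edges_def insert_commute)
        then have "joined (\<omega> - inner_edges d S) b a" by (rule joined_edge)
        then have "reaches_boundary d n (\<omega> - inner_edges d S) b"
          using step(3) joined_trans unfolding reaches_boundary_def by blast
        moreover have "{a, b} \<in> E" using step(2) \<open>\<omega> \<subseteq> E\<close> by blast
        then have "b \<in> \<Lambda>" by (simp add: E \<Lambda>_def edge_in_inner_edges_iff)
        ultimately show ?case by blast
      qed
      then show ?thesis ..
    qed
    moreover have "reaches_boundary d n \<omega> y" if "reaches_boundary d n (\<omega> - inner_edges d S) y" for y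
      using that joined_mono[of "\<omega> - inner_edges d S" _ _ \<omega>] by (auto simp: reaches_boundary_def)
    ultimately show "cut \<omega> = S" using S unfolding cut_def by blast
  qed
  define \<S> where "\<S> = {S. S \<subseteq> \<Lambda> \<and> origin \<in> S}"
  have fin\<S>: "finite \<S>" unfolding \<S>_def using fin\<Lambda> by auto
  have cut_in: "cut \<omega> \<in> \<S>" if "\<not> A \<omega>" for \<omega>
    using that origin_in by (auto simp: \<S>_def cut_def A)
  have not_A: "\<not> A \<omega>" if "cut \<omega> \<in> \<S>" for \<omega>
    using that by (auto simp: \<S>_def cut_def A)
  have region: "bern E p (\<lambda>\<omega>. cut \<omega> = S)
      \<le> (\<Sum>(x, y)\<in>exits d S. bern E p (\<lambda>\<omega>. cut \<omega> = S \<and> joined (\<omega> \<inter> inner_edges d S) origin x))"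
    if S: "S \<in> \<S>" for S
  proof -
    let ?I = "inner_edges d S"
    have "?I \<subseteq> E" using S by (auto simp: \<S>_def E inner_edges_def \<Lambda>_def)
    then have split: "E = (E - ?I) \<union> ?I" "finite ?I" using finE finite_subset by auto
    have prod: "bern E p (\<lambda>\<omega>. cut \<omega> = S \<and> joined (\<omega> \<inter> ?I) origin x)
        = bern E p (\<lambda>\<omega>. cut \<omega> = S) * bern ?I p (\<lambda>\<omega>. joined \<omega> origin x)" for x
    proof -
      have diff: "\<omega> \<inter> (E - ?I) = \<omega> - ?I" if "\<omega> \<subseteq> E" for \<omega> using that by auto
      have "bern E p (\<lambda>\<omega>. cut \<omega> = S \<and> joined (\<omega> \<inter> ?I) origin x)
          = bern E p (\<lambda>\<omega>. cut (\<omega> \<inter> (E - ?I)) = S \<and> joined (\<omega> \<inter> ?I) origin x)"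
        by (rule bern_cong) (simp add: diff cut_local)
      also have "\<dots> = bern (E - ?I) p (\<lambda>\<omega>. cut \<omega> = S) * bern ?I p (\<lambda>\<omega>. joined \<omega> origin x)"
        using bern_product[of "E - ?I" ?I p "\<lambda>\<omega>. cut \<omega> = S" "\<lambda>\<omega>. joined \<omega> origin x"] finE split by auto
      also have "bern (E - ?I) p (\<lambda>\<omega>. cut \<omega> = S) = bern E p (\<lambda>\<omega>. cut (\<omega> \<inter> (E - ?I)) = S)"
        by (rule bern_marginal[symmetric]) (use finE in auto)
      also have "\<dots> = bern E p (\<lambda>\<omega>. cut \<omega> = S)"
        by (rule bern_cong) (simp add: diff cut_local)
      finally show ?thesis .
    qed
    have "finite S" "S \<subseteq> lattice d" "origin \<in> S"
      using S fin\<Lambda> finite_subset by (auto simp: \<S>_def \<Lambda>_def cube_def)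
    then have "1 \<le> dct_phi d p S" by (rule phi)
    also have "\<dots> \<le> (\<Sum>(x, y)\<in>exits d S. bern ?I p (\<lambda>\<omega>. joined \<omega> origin x))"
      unfolding dct_phi_def using assms
      by (intro mult_left_le_one_le sum_nonneg) (auto intro!: bern_nonneg)
    finally have "bern E p (\<lambda>\<omega>. cut \<omega> = S) * 1
        \<le> bern E p (\<lambda>\<omega>. cut \<omega> = S) * (\<Sum>(x, y)\<in>exits d S. bern ?I p (\<lambda>\<omega>. joined \<omega> origin x))"
      using assms by (intro mult_left_mono bern_nonneg)
    then show ?thesis by (simp add: prod sum_distrib_left case_prod_unfold)
  qed
  have "1 - bern E p A = bern E p (\<lambda>\<omega>. \<not> A \<omega>)" using bern_compl[OF finE] by simp
  also have "\<dots> = (\<Sum>S\<in>\<S>. bern E p (\<lambda>\<omega>. cut \<omega> = S))"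
  proof -
    have "(\<Sum>S\<in>\<S>. bern E p (\<lambda>\<omega>. cut \<omega> = S)) = (\<Sum>\<omega>\<in>Pow E. \<Sum>S\<in>\<S>. W \<omega> * of_bool (cut \<omega> = S))"
      unfolding bern_eq_sum_indicator[OF finE] W_def by (rule sum.swap)
    also have "\<dots> = (\<Sum>\<omega>\<in>Pow E. W \<omega> * of_bool (\<not> A \<omega>))"
    proof (intro sum.cong refl)
      fix \<omega>
      have "(\<Sum>S\<in>\<S>. of_bool (cut \<omega> = S)) = (of_bool (cut \<omega> \<in> \<S>) :: real)"
        using fin\<S> by (simp add: of_bool_def sum.delta)
      then show "(\<Sum>S\<in>\<S>. W \<omega> * of_bool (cut \<omega> = S)) = W \<omega> * of_bool (\<not> A \<omega>)"
        using cut_in not_A by (auto simp: sum_distrib_left[symmetric])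
    qed
    finally show ?thesis by (simp add: bern_eq_sum_indicator[OF finE] W_def)
  qed
  also have "\<dots> \<le> (\<Sum>S\<in>\<S>. \<Sum>(x, y)\<in>exits d S.
      bern E p (\<lambda>\<omega>. cut \<omega> = S \<and> joined (\<omega> \<inter> inner_edges d S) origin x))"
    by (intro sum_mono region)
  also have "\<dots> = (\<Sum>\<omega>\<in>Pow E. W \<omega> * (\<Sum>S\<in>\<S>. \<Sum>(x, y)\<in>exits d S.
      of_bool (cut \<omega> = S \<and> joined (\<omega> \<inter> inner_edges d S) origin x)))"
    unfolding bern_eq_sum_indicator[OF finE] W_def sum_distrib_left case_prod_unfold
    by (subst sum.swap, subst sum.swap) (rule refl)
  also have "\<dots> \<le> (\<Sum>\<omega>\<in>Pow E. W \<omega> * (\<Sum>e\<in>E. of_bool (e \<notin> \<omega> \<and> \<not> A \<omega> \<and> A (insert e \<omega>))))"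
  proof (intro sum_mono mult_left_mono W_nonneg)
    fix \<omega> assume "\<omega> \<in> Pow E"
    show "(\<Sum>S\<in>\<S>. \<Sum>(x, y)\<in>exits d S. of_bool (cut \<omega> = S \<and> joined (\<omega> \<inter> inner_edges d S) origin x))
        \<le> (\<Sum>e\<in>E. of_bool (e \<notin> \<omega> \<and> \<not> A \<omega> \<and> A (insert e \<omega>)) :: real)"
    proof (cases "A \<omega>")
      case True
      then have "cut \<omega> \<noteq> S" if "S \<in> \<S>" for S using not_A that by blast
      then show ?thesis using True by (simp add: case_prod_unfold)
    next
      case False
      let ?g = "\<lambda>S. \<Sum>(x, y)\<in>exits d S. of_bool (joined (\<omega> \<inter> inner_edges d S) origin x) :: real"
      have "(\<Sum>S\<in>\<S>. \<Sum>(x, y)\<in>exits d S. of_bool (cut \<omega> = S \<and> joined (\<omega> \<inter> inner_edges d S) origin x))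
          = (\<Sum>S\<in>\<S>. if cut \<omega> = S then ?g S else 0)"
        by (intro sum.cong) (auto simp: case_prod_unfold)
      also have "\<dots> = ?g (cut \<omega>)"
        using fin\<S> cut_in[OF False] by simp
      also have "\<dots> = real (card {(x, y) \<in> exits d (cut \<omega>). joined (\<omega> \<inter> inner_edges d (cut \<omega>)) origin x})"
        using finite_exits[OF _ assms(1), of "cut \<omega>"] fin\<Lambda>
        by (simp add: case_prod_unfold Int_def cut_def)
      also have "\<dots> \<le> real (card {e \<in> E. e \<notin> \<omega> \<and> A (insert e \<omega>)})"
        using count[OF False] by simp
      also have "\<dots> = (\<Sum>e\<in>E. of_bool (e \<notin> \<omega> \<and> \<not> A \<omega> \<and> A (insert e \<omega>)))"
        using finE False by (simp add: Int_def)
      finally show ?thesis .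
    qed
  qed
  also have "\<dots> = (\<Sum>e\<in>E. bern E p (\<lambda>\<omega>. e \<notin> \<omega> \<and> \<not> A \<omega> \<and> A (insert e \<omega>)))"
    unfolding bern_eq_sum_indicator[OF finE] W_def sum_distrib_left by (rule sum.swap)
  finally show ?thesis .
qed

text \<open>
  If \<open>f\<close> is the probability of reaching the boundary, Russo's formula turns the preceding inequality
  into \<open>f' \<ge> 1 - f\<close>, so that \<open>(1 - f r) * exp r\<close> decreases in \<open>r\<close>. The bound does not depend on \<open>n\<close>.
\<close>

lemma boundary_probability_lower_bound:
  fixes n :: int
  assumes "d > 0" "0 < n" "0 \<le> p" "p \<le> q" "q \<le> 1"
    and phi: "\<And>S. finite S \<Longrightarrow> S \<subseteq> lattice d \<Longrightarrow> origin \<in> S \<Longrightarrow> 1 \<le> dct_phi d p S"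
  shows "1 - exp (p - q)
    \<le> bern (inner_edges d (cube d origin n)) q (\<lambda>\<omega>. reaches_boundary d n \<omega> origin)"
proof -
  define E where "E = inner_edges d (cube d origin n)"
  define A where "A = (\<lambda>\<omega>. reaches_boundary d n \<omega> origin)"
  define g where "g r = (1 - bern E r A) * exp r" for r
  have finE: "finite E" unfolding E_def using assms(1) finite_inner_edges finite_cube by blast
  have mono: "A \<eta>" if "A \<omega>" "\<omega> \<subseteq> \<eta>" for \<omega> \<eta>
    using that joined_mono unfolding A_def reaches_boundary_def by blast
  have "g q \<le> g p"
  proof (rule DERIV_nonpos_imp_decreasing_open[OF assms(4)])
    fix r assume r: "p < r" "r < q"
    obtain D where D: "((\<lambda>p. bern E p A) has_real_derivative D) (at r)"
      "(1 - r) * D = (\<Sum>e\<in>E. bern E r (\<lambda>\<omega>. e \<notin> \<omega> \<and> \<not> A \<omega> \<and> A (insert e \<omega>)))"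
      by (rule russo_formula[OF finE, of A r]) (auto intro: mono)
    have phi_r: "1 \<le> dct_phi d r S" if "finite S" "S \<subseteq> lattice d" "origin \<in> S" for S
      using phi[OF that] dct_phi_mono[OF that(1) assms(1,3), of r] r assms by linarith
    have r01: "0 \<le> r" "r \<le> 1" using r assms by auto
    have ineq: "1 - bern E r A \<le> (1 - r) * D"
      unfolding D(2) by (rule sharpness_inequality[OF assms(1,2) r01 phi_r E_def A_def])
    have "0 \<le> (1 - r) * D" unfolding D(2) using r01 by (intro sum_nonneg bern_nonneg) auto
    then have "0 \<le> D" using r assms by (simp add: zero_le_mult_iff)
    then have "0 \<le> r * D" using r01 by simp
    then have "1 - bern E r A - D \<le> 0" using ineq by (simp add: algebra_simps)
    then have "(1 - bern E r A - D) * exp r \<le> 0" by (simp add: mult_le_0_iff)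
    moreover have "(g has_real_derivative (1 - bern E r A - D) * exp r) (at r)"
      unfolding g_def by (auto intro!: derivative_eq_intros D(1) simp: algebra_simps)
    ultimately show "\<exists>y. (g has_real_derivative y) (at r) \<and> y \<le> 0" by blast
  next
    show "continuous_on {p..q} g" unfolding g_def bern_def by (intro continuous_intros)
  qed
  also have "g p \<le> exp p" using bern_nonneg[of p E A] assms by (simp add: g_def)
  finally have "1 - bern E q A \<le> exp p / exp q" by (simp add: g_def field_simps)
  then show ?thesis by (simp add: E_def A_def exp_diff)
qed

section \<open>Subcriticality in finite terms\<close>

text \<open>
  Both the percolation measure and the set of edges of weight zero are reduced by this lemma to the
  finite sums above.
\<close>

lemma (in prob_space) prob_configuration:
  assumes "finite E" and ind: "indep_vars (\<lambda>_. count_space UNIV) X E"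
    and p: "\<And>e. e \<in> E \<Longrightarrow> prob {\<omega> \<in> space M. X e \<omega>} = p"
  shows "{\<omega> \<in> space M. A {e \<in> E. X e \<omega>}} \<in> events"
    and "prob {\<omega> \<in> space M. A {e \<in> E. X e \<omega>}} = bern E p A"
proof -
  define V where "V W = {\<omega> \<in> space M. {e \<in> E. X e \<omega>} = W}" for W
  have rv: "random_variable (count_space UNIV) (X e)" if "e \<in> E" for e
    using ind that by (auto simp: indep_vars_def)
  have prob_V: "V W \<in> events \<and> prob (V W) = p ^ card W * (1 - p) ^ card (E - W)" if W: "W \<subseteq> E" for W
  proof (cases "E = {}")
    case True
    then have "V W = space M" using W by (auto simp: V_def)
    then show ?thesis using True W by (simp add: prob_space)
  next
    case False
    have eq: "V W = (\<Inter>e\<in>E. X e -` {e \<in> W} \<inter> space M)"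
      using W False by (auto simp: V_def)
    have "prob (V W) = (\<Prod>e\<in>E. prob (X e -` {e \<in> W} \<inter> space M))"
      unfolding eq by (rule indep_varsD_finite[OF ind False assms(1)]) simp
    also have "\<dots> = (\<Prod>e\<in>E. if e \<in> W then p else 1 - p)"
    proof (intro prod.cong refl)
      fix e assume e: "e \<in> E"
      have *: "{\<omega> \<in> space M. X e \<omega>} = X e -` {True} \<inter> space M" by auto
      have ev: "{\<omega> \<in> space M. X e \<omega>} \<in> events"
        unfolding * using rv[OF e] by (rule measurable_sets) simp
      have "X e -` {False} \<inter> space M = space M - {\<omega> \<in> space M. X e \<omega>}" by auto
      then show "prob (X e -` {e \<in> W} \<inter> space M) = (if e \<in> W then p else 1 - p)"
        using p[OF e] prob_compl[OF ev] * by simp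
    qed
    also have "\<dots> = (\<Prod>e\<in>W. p) * (\<Prod>e\<in>E-W. 1 - p)"
      using W assms(1) by (subst prod.If_cases) (auto simp: Int_absorb1 Diff_eq)
    finally have "prob (V W) = p ^ card W * (1 - p) ^ card (E - W)" by simp
    moreover have "V W \<in> events"
      unfolding eq using False assms(1) by (intro sets.finite_INT measurable_sets[OF rv]) auto
    ultimately show ?thesis by blast
  qed
  have eq: "{\<omega> \<in> space M. A {e \<in> E. X e \<omega>}} = (\<Union>W\<in>{W. W \<subseteq> E \<and> A W}. V W)"
    by (auto simp: V_def)
  have fin: "finite {W. W \<subseteq> E \<and> A W}" using assms(1) by auto
  show "{\<omega> \<in> space M. A {e \<in> E. X e \<omega>}} \<in> events"
    unfolding eq using fin prob_V by (intro sets.finite_UN) auto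
  have "prob (\<Union>W\<in>{W. W \<subseteq> E \<and> A W}. V W) = (\<Sum>W\<in>{W. W \<subseteq> E \<and> A W}. prob (V W))"
    using prob_V by (intro finite_measure_finite_Union[OF fin]) (auto simp: disjoint_family_on_def V_def)
  then show "prob {\<omega> \<in> space M. A {e \<in> E. X e \<omega>}} = bern E p A"
    unfolding eq bern_def using prob_V by simp
qed

lemma indep_vars_coordinates_PiM:
  assumes "\<And>i. i \<in> I \<Longrightarrow> prob_space (N i)"
  shows "prob_space.indep_vars (PiM I N) N (\<lambda>i \<omega>. \<omega> i) I"
proof (cases "I = {}")
  case False
  interpret P: prob_space "PiM I N" using assms by (rule prob_space_PiM)
  have eq: "distr (PiM I N) (N i) (\<lambda>\<omega>. \<omega> i) = N i" if "i \<in> I" for i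
    using distr_PiM_component[of I N i] assms that by simp
  show ?thesis
  proof (subst P.indep_vars_iff_distr_eq_PiM'[OF False])
    have "distr (PiM I N) (PiM I N) (\<lambda>x. \<lambda>i\<in>I. x i) = distr (PiM I N) (PiM I N) (\<lambda>x. x)"
      by (rule distr_cong) (auto simp: space_PiM restrict_PiE_iff extensional_restrict PiE_def)
    also have "\<dots> = PiM I N" by (rule distr_id)
    also have "\<dots> = PiM I (\<lambda>i. distr (PiM I N) (N i) (\<lambda>\<omega>. \<omega> i))"
      by (rule PiM_cong) (simp_all add: eq)
    finally show "distr (PiM I N) (PiM I N) (\<lambda>x. \<lambda>i\<in>I. x i)
        = PiM I (\<lambda>i. distr (PiM I N) (N i) (\<lambda>\<omega>. \<omega> i))" .
  qed auto
next
  case True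
  interpret P: prob_space "PiM I N" using assms by (rule prob_space_PiM)
  show ?thesis unfolding P.indep_vars_def P.indep_sets_def using True by auto
qed

text \<open>
  Cutting a path at its first visit of the sphere leaves a cheaper path inside the cube.
\<close>

lemma path_reaches_shell:
  assumes "d > 0" "is_path d v z \<gamma>" "0 \<le> k" "k \<le> supdist d v z"
  obtains \<delta> u where "is_path d v u \<delta>" "supdist d v u = k" "set \<delta> \<subseteq> cube d v k"
    "\<And>t. (\<And>e. e \<in> edges d \<Longrightarrow> 0 \<le> t e) \<Longrightarrow> path_time t \<delta> \<le> path_time t \<gamma>"
    "set (path_edges \<delta>) \<subseteq> set (path_edges \<gamma>)"
proof -
  have succ: "successively (adjacent d) \<gamma>" "\<gamma> \<noteq> []" "hd \<gamma> = v" "last \<gamma> = z" "set \<gamma> \<subseteq> lattice d"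
    using assms(2) by (auto simp: is_path_def)
  obtain \<alpha> u \<beta> where split: "\<gamma> = \<alpha> @ u # \<beta>" "supdist d v u = k" "\<And>a. a \<in> set \<alpha> \<Longrightarrow> supdist d v a < k"
  proof (rule path_hits_level[of d "supdist d v" \<gamma> k])
    show "\<bar>supdist d v b - supdist d v a\<bar> \<le> 1" if "adjacent d a b" for a b
      using supdist_step[OF that assms(1)] .
  qed (use assms succ in \<open>auto simp: supdist_self\<close>)
  have path: "is_path d v u (\<alpha> @ [u])"
    using succ unfolding split is_path_def
    by (auto simp: successively_append_iff successively_Cons hd_append split: if_splits)
  show thesis
  proof (rule that[OF path split(2)])
    show "set (\<alpha> @ [u]) \<subseteq> cube d v k"
      using split succ(5) by (force simp: cube_def)
    show "path_time t (\<alpha> @ [u]) \<le> path_time t \<gamma>" if "\<And>e. e \<in> edges d \<Longrightarrow> 0 \<le> t e" for t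
    proof -
      have "successively (adjacent d) (u # \<beta>)"
        using succ(1) unfolding split by (simp add: successively_append_iff)
      then have "0 \<le> path_time t (u # \<beta>)" using path_time_nonneg that by blast
      then show ?thesis unfolding split path_time_join[of t \<alpha> u \<beta>] by simp
    qed
    show "set (path_edges (\<alpha> @ [u])) \<subseteq> set (path_edges \<gamma>)"
      unfolding split path_edges_join[of \<alpha> u \<beta>] by simp
  qed
qed

lemma path_edges_in_inner_edges:
  "is_path d v w \<gamma> \<Longrightarrow> set \<gamma> \<subseteq> S \<Longrightarrow> set (path_edges \<gamma>) \<subseteq> inner_edges d S"
  using path_edges_in_edges path_edges_subset unfolding inner_edges_def is_path_def by blast

lemma reaches_boundary_if_infinite:
  assumes "d > 0" and inf: "infinite (open_cluster d \<omega>)"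
  shows "reaches_boundary d (int m) {e \<in> inner_edges d (cube d origin (int m)). \<omega> e} origin"
proof -
    have "\<not> open_cluster d \<omega> \<subseteq> cube d origin (int m)"
      using inf finite_cube[OF assms(1)] finite_subset by blast
    then obtain z where z: "z \<in> open_cluster d \<omega>" "z \<notin> cube d origin (int m)" by blast
    then obtain \<gamma> where \<gamma>: "is_path d origin z \<gamma>" "\<forall>e\<in>set (path_edges \<gamma>). \<omega> e"
      by (auto simp: open_cluster_def)
    have "z \<in> lattice d" using \<gamma>(1) unfolding is_path_def by (metis last_in_set subsetD)
    then have "int m \<le> supdist d origin z" using z(2) by (simp add: cube_def)
    then obtain \<delta> u where \<delta>: "is_path d origin u \<delta>" "supdist d origin u = int m"
      "set \<delta> \<subseteq> cube d origin (int m)" "set (path_edges \<delta>) \<subseteq> set (path_edges \<gamma>)"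
      using path_reaches_shell[OF assms(1) \<gamma>(1), of "int m"] by (metis of_nat_0_le_iff)
    have "joined {e \<in> inner_edges d (cube d origin (int m)). \<omega> e} (hd \<delta>) (last \<delta>)"
      using \<delta> \<gamma>(2) path_edges_in_inner_edges[OF \<delta>(1,3)]
      by (intro joined_if_path) (auto simp: is_path_def)
    moreover have "u \<in> shell d origin (int m)"
      using \<delta>(1,2) unfolding is_path_def shell_def by (metis (mono_tags, lifting) last_in_set mem_Collect_eq subsetD)
    ultimately show ?thesis using \<delta>(1) by (auto simp: reaches_boundary_def is_path_def)
qed

text \<open>
  The right hand side says that infinitely many of the events \<open>box_crossing\<close> occur. In this form the
  event is a decreasing limit of unions, each at least as likely as a single crossing.
\<close>

lemma infinite_cluster_iff:
  assumes "d > 0"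
  shows "infinite (open_cluster d \<omega>) \<longleftrightarrow>
    (\<forall>n. \<exists>m\<ge>n. reaches_boundary d (int m) {e \<in> inner_edges d (cube d origin (int m)). \<omega> e} origin)"
proof
  assume "infinite (open_cluster d \<omega>)"
  from reaches_boundary_if_infinite[OF assms this]
  show "\<forall>n. \<exists>m\<ge>n. reaches_boundary d (int m) {e \<in> inner_edges d (cube d origin (int m)). \<omega> e} origin"
    by blast
next
  assume *: "\<forall>n. \<exists>m\<ge>n. reaches_boundary d (int m) {e \<in> inner_edges d (cube d origin (int m)). \<omega> e} origin"
  show "infinite (open_cluster d \<omega>)"
  proof
    assume fin: "finite (open_cluster d \<omega>)"
    define B where "B = Max (insert 0 (supdist d origin ` open_cluster d \<omega>))"
    obtain m where m: "nat B + 1 \<le> m"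
      "reaches_boundary d (int m) {e \<in> inner_edges d (cube d origin (int m)). \<omega> e} origin"
      using * by blast
    then obtain z where z: "supdist d origin z = int m"
      "joined {e \<in> inner_edges d (cube d origin (int m)). \<omega> e} origin z"
      by (auto simp: reaches_boundary_def shell_def)
    obtain \<gamma> where "is_path d origin z \<gamma>" "set (path_edges \<gamma>) \<subseteq> {e \<in> inner_edges d (cube d origin (int m)). \<omega> e}"
      using path_if_joined[OF z(2) origin_in_lattice] inner_edges_subset by (metis (no_types, lifting) mem_Collect_eq subset_iff)
    then have "z \<in> open_cluster d \<omega>" by (auto simp: open_cluster_def)
    then have "supdist d origin z \<le> B" unfolding B_def using fin by (intro Max_ge) auto
    then show False using z(1) m(1) by linarith
  qed
qed

definition box_crossing :: "nat \<Rightarrow> real \<Rightarrow> nat \<Rightarrow> (edge \<Rightarrow> bool) set" where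
  "box_crossing d p n = {\<omega> \<in> space (percolation_measure d p). reaches_boundary d (int n)
      {e \<in> inner_edges d (cube d origin (int n)). \<omega> e} origin}"

lemma prob_space_percolation_measure: "prob_space (percolation_measure d p)"
  unfolding percolation_measure_def by (intro prob_space_PiM measure_pmf.prob_space_axioms)

lemma prob_box_crossing:
  assumes "d > 0" "0 \<le> p" "p \<le> 1"
  shows "box_crossing d p n \<in> sets (percolation_measure d p)"
    and "measure (percolation_measure d p) (box_crossing d p n)
      = bern (inner_edges d (cube d origin (int n))) p (\<lambda>\<omega>. reaches_boundary d (int n) \<omega> origin)"
proof -
  define P where "P = percolation_measure d p"
  interpret P: prob_space P unfolding P_def by (rule prob_space_percolation_measure)
  have ind: "P.indep_vars (\<lambda>_. measure_pmf (bernoulli_pmf p)) (\<lambda>e \<omega>. \<omega> e) (edges d)"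
    unfolding P_def percolation_measure_def
    by (rule indep_vars_coordinates_PiM) (rule measure_pmf.prob_space_axioms)
  have ind': "P.indep_vars (\<lambda>_. count_space UNIV) (\<lambda>e \<omega>. \<omega> e) (edges d)"
    using P.indep_vars_compose2[OF ind, of "\<lambda>_ x. x" "\<lambda>_. count_space UNIV"] by simp
  have pe: "P.prob {\<omega> \<in> space P. \<omega> e} = p" if e: "e \<in> edges d" for e
  proof -
    have "distr P (measure_pmf (bernoulli_pmf p)) (\<lambda>\<omega>. \<omega> e) = measure_pmf (bernoulli_pmf p)"
      unfolding P_def percolation_measure_def
      using e by (intro distr_PiM_component measure_pmf.prob_space_axioms)
    moreover have "measure (distr P (measure_pmf (bernoulli_pmf p)) (\<lambda>\<omega>. \<omega> e)) {True}
        = P.prob ((\<lambda>\<omega>. \<omega> e) -` {True} \<inter> space P)"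
      using ind e by (intro measure_distr) (auto simp: P.indep_vars_def)
    moreover have "(\<lambda>\<omega>. \<omega> e) -` {True} \<inter> space P = {\<omega> \<in> space P. \<omega> e}" by auto
    moreover have "measure (measure_pmf (bernoulli_pmf p)) {True} = p"
      using assms by (simp add: measure_pmf_single)
    ultimately show ?thesis by simp
  qed
  let ?E = "inner_edges d (cube d origin (int n))"
  have fin: "finite ?E" by (rule finite_inner_edges[OF finite_cube[OF assms(1)]])
  have ind_E: "P.indep_vars (\<lambda>_. count_space UNIV) (\<lambda>e \<omega>. \<omega> e) ?E"
    by (rule P.indep_vars_subset[OF ind' inner_edges_subset])
  have pe_E: "P.prob {\<omega> \<in> space P. \<omega> e} = p" if "e \<in> ?E" for e
    using pe inner_edges_subset that by (simp add: subset_iff)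
  note conf = P.prob_configuration[OF fin ind_E pe_E, where A = "\<lambda>\<omega>. reaches_boundary d (int n) \<omega> origin"]
  show "box_crossing d p n \<in> sets (percolation_measure d p)"
    unfolding box_crossing_def P_def[symmetric] by (rule conf(1))
  show "measure (percolation_measure d p) (box_crossing d p n)
      = bern ?E p (\<lambda>\<omega>. reaches_boundary d (int n) \<omega> origin)"
    unfolding box_crossing_def P_def[symmetric] by (rule conf(2))
qed

lemma percolation_prob_ge:
  assumes "d > 0" "0 \<le> p" "p \<le> 1"
    and c: "\<And>n::nat. 0 < n \<Longrightarrow> c \<le> bern (inner_edges d (cube d origin (int n))) p
      (\<lambda>\<omega>. reaches_boundary d (int n) \<omega> origin)"
  shows "c \<le> percolation_prob d p"
proof -
  define P where "P = percolation_measure d p"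
  interpret P: prob_space P unfolding P_def by (rule prob_space_percolation_measure)
  define C where "C n = (\<Union>m\<in>{n..}. box_crossing d p m)" for n
  note A = prob_box_crossing[OF assms(1-3), folded P_def]
  have C_events: "C n \<in> P.events" for n unfolding C_def using A(1) by auto
  have "decseq C" unfolding C_def decseq_def by force
  then have lim: "(\<lambda>n. P.prob (C n)) \<longlonglongrightarrow> P.prob (\<Inter>n. C n)"
    using C_events by (intro P.finite_Lim_measure_decseq) auto
  have "c \<le> P.prob (C n)" for n
  proof -
    have "c \<le> P.prob (box_crossing d p (Suc n))" unfolding A(2) by (rule c) simp
    also have "\<dots> \<le> P.prob (C n)" using C_events
      by (intro P.finite_measure_mono) (auto simp: C_def intro!: bexI[of _ "Suc n"])
    finally show ?thesis .
  qed
  then have "c \<le> P.prob (\<Inter>n. C n)" using LIMSEQ_le_const[OF lim] by blast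
  moreover have "(\<Inter>n. C n) = {\<omega> \<in> space P. infinite (open_cluster d \<omega>)}"
    unfolding infinite_cluster_iff[OF assms(1)] C_def box_crossing_def P_def by auto
  ultimately show ?thesis by (simp add: percolation_prob_def P_def)
qed

text \<open>
  It ensures that the set in the definition of \<open>critical_prob\<close> is not empty.
\<close>

lemma percolation_prob_0:
  assumes "d > 0" shows "percolation_prob d 0 = 0"
proof -
  interpret P: prob_space "percolation_measure d 0" by (rule prob_space_percolation_measure)
  have "percolation_prob d 0 \<le> P.prob (box_crossing d 0 1)"
    unfolding percolation_prob_def box_crossing_def
    using prob_box_crossing(1)[OF assms, of 0 1] reaches_boundary_if_infinite[OF assms, of _ 1]
    by (intro P.finite_measure_mono) (auto simp: box_crossing_def)
  also have "\<dots> = 0"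
  proof -
    have "\<not> reaches_boundary d 1 {} origin"
      using supdist_self[OF assms, of origin]
      by (auto simp: reaches_boundary_def joined_def shell_def)
    then have pos: "card \<omega> \<noteq> 0" if "finite E" "\<omega> \<subseteq> E" "reaches_boundary d 1 \<omega> origin" for E \<omega>
      using that finite_subset[OF that(2,1)] by (auto simp: card_eq_0_iff)
    have "bern (inner_edges d (cube d origin 1)) 0 (\<lambda>\<omega>. reaches_boundary d 1 \<omega> origin) = 0"
      unfolding bern_def
    proof (intro sum.neutral ballI)
      fix \<omega> assume "\<omega> \<in> {\<omega>. \<omega> \<subseteq> inner_edges d (cube d origin 1) \<and> reaches_boundary d 1 \<omega> origin}"
      then have "card \<omega> \<noteq> 0" using pos[OF finite_inner_edges[OF finite_cube[OF assms]]] by blast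
      then show "(0::real) ^ card \<omega> * (1 - 0) ^ card (inner_edges d (cube d origin 1) - \<omega>) = 0" by simp
    qed
    then show ?thesis using prob_box_crossing(2)[OF assms, of 0 1] by simp
  qed
  finally show ?thesis by (simp add: percolation_prob_def measure_le_0_iff)
qed

lemma dct_phi_less_1_if_subcritical:
  assumes "d > 0" "0 \<le> p" "p < critical_prob d"
  obtains S where "finite S" "S \<subseteq> lattice d" "origin \<in> S" "dct_phi d p S < 1"
proof -
  have "percolation_prob d 0 = 0" by (rule percolation_prob_0[OF assms(1)])
  then have "{p \<in> {0..1}. percolation_prob d p = 0} \<noteq> {}" by force
  then obtain q where q: "0 \<le> q" "q \<le> 1" "percolation_prob d q = 0" "p < q"
    using less_cSupE[of p "{p \<in> {0..1}. percolation_prob d p = 0}"] assms(3)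
    unfolding critical_prob_def by auto
  have "\<exists>S. finite S \<and> S \<subseteq> lattice d \<and> origin \<in> S \<and> dct_phi d p S < 1"
  proof (rule ccontr)
    assume no: "\<nexists>S. finite S \<and> S \<subseteq> lattice d \<and> origin \<in> S \<and> dct_phi d p S < 1"
    have "1 - exp (p - q) \<le> percolation_prob d q"
    proof (rule percolation_prob_ge[OF assms(1) q(1,2)])
      fix n :: nat assume "0 < n"
      then show "1 - exp (p - q) \<le> bern (inner_edges d (cube d origin (int n))) q
          (\<lambda>\<omega>. reaches_boundary d (int n) \<omega> origin)"
        using no q assms by (intro boundary_probability_lower_bound) (auto simp: not_less)
    qed
    then show False using q by simp
  qed
  then show thesis using that by blast
qed

section \<open>The van den Berg--Kesten inequality for suprema of products\<close>

text \<open>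
  In each term the variable \<open>y\<close> occurs at most once, in the role of \<open>P\<close> or of \<open>Q\<close>. If the largest
  coefficient with the role \<open>P\<close> is at least the one with the role \<open>Q\<close>, nothing is lost when the terms
  with the role \<open>Q\<close> are given another variable; in the opposite case the two variables, which are
  independent with the same law, exchange their parts.
\<close>

lemma nn_integral_SUP_decouple:
  fixes \<mu> :: "real measure" and h :: "real \<Rightarrow> ennreal"
  assumes "prob_space \<mu>" and disj: "\<And>i. i \<in> I \<Longrightarrow> \<not> (P i \<and> Q i)"
  shows "(\<integral>\<^sup>+y. (SUP i\<in>I. c i * (if P i \<or> Q i then h y else 1)) \<partial>\<mu>)
    \<le> (\<integral>\<^sup>+y. \<integral>\<^sup>+z. (SUP i\<in>I. c i * ((if P i then h y else 1) * (if Q i then h z else 1))) \<partial>\<mu> \<partial>\<mu>)"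
proof -
  interpret prob_space \<mu> by fact
  define L where "L y = (SUP i\<in>I. c i * (if P i \<or> Q i then h y else 1))" for y
  define K where "K y z = (SUP i\<in>I. c i * ((if P i then h y else 1) * (if Q i then h z else 1)))" for y z
  have swap: "L y \<le> k"
    if less: "(SUP i\<in>{i\<in>I. Q' i}. c i) \<le> (SUP i\<in>{i\<in>I. P' i}. c i)"
      and or: "\<And>i. P' i \<or> Q' i \<longleftrightarrow> P i \<or> Q i" and dj: "\<And>i. i \<in> I \<Longrightarrow> \<not> (P' i \<and> Q' i)"
      and k: "k = (SUP i\<in>I. c i * ((if P' i then h y else 1) * (if Q' i then h z else 1)))"
    for P' Q' k y z
    unfolding L_def
  proof (rule SUP_least)
    fix i assume i: "i \<in> I"
    show "c i * (if P i \<or> Q i then h y else 1) \<le> k"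
    proof (cases "Q' i")
      case False
      then show ?thesis unfolding k or[symmetric] by (intro SUP_upper2[OF i]) simp
    next
      case True
      have "c i * h y \<le> (SUP i\<in>{i\<in>I. P' i}. c i) * h y"
        using True i by (intro mult_right_mono order_trans[OF _ less] SUP_upper) auto
      also have "\<dots> = (SUP i\<in>{i\<in>I. P' i}. c i * h y)" by (simp add: SUP_mult_right_ennreal)
      also have "\<dots> \<le> k" unfolding k
      proof (rule SUP_mono)
        fix j assume j: "j \<in> {i \<in> I. P' i}"
        then show "\<exists>m\<in>I. c j * h y \<le> c m * ((if P' m then h y else 1) * (if Q' m then h z else 1))"
          using dj by (intro bexI[of _ j]) auto
      qed
      finally show ?thesis using True or[of i] by simp
    qed
  qed
  show ?thesis
  proof (cases "(SUP i\<in>{i\<in>I. Q i}. c i) \<le> (SUP i\<in>{i\<in>I. P i}. c i)")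
    case True
    have "L y \<le> (\<integral>\<^sup>+z. K y z \<partial>\<mu>)" for y
    proof -
      have "L y = (\<integral>\<^sup>+z. L y \<partial>\<mu>)" by (simp add: emeasure_space_1)
      also have "\<dots> \<le> (\<integral>\<^sup>+z. K y z \<partial>\<mu>)"
        by (intro nn_integral_mono swap[OF True refl disj]) (simp_all add: K_def)
      finally show ?thesis .
    qed
    then show ?thesis unfolding L_def[symmetric] K_def[symmetric] by (intro nn_integral_mono)
  next
    case False
    then have less: "(SUP i\<in>{i\<in>I. P i}. c i) \<le> (SUP i\<in>{i\<in>I. Q i}. c i)" by simp
    have LK: "L z \<le> K y z" for y z
    proof -
      have K: "K y z = (SUP i\<in>I. c i * ((if Q i then h z else 1) * (if P i then h y else 1)))"
        by (simp add: K_def mult.commute)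
      show ?thesis using swap[OF less _ _ K] disj by blast
    qed
    have "(\<integral>\<^sup>+y. \<integral>\<^sup>+z. L z \<partial>\<mu> \<partial>\<mu>) \<le> (\<integral>\<^sup>+y. \<integral>\<^sup>+z. K y z \<partial>\<mu> \<partial>\<mu>)"
      by (intro nn_integral_mono LK)
    then show ?thesis unfolding L_def[symmetric] K_def[symmetric] by (simp add: emeasure_space_1)
  qed
qed

text \<open>
  Induction over the edges: the preceding lemma gives the second factor an independent copy of the
  new edge. The coefficients \<open>c\<close> are general because they absorb the factor of an edge that is
  held fixed while the induction hypothesis is applied to the others.
\<close>

lemma BK_inequality_sup:
  fixes \<mu> :: "real measure" and h :: "real \<Rightarrow> ennreal"
  assumes \<mu>: "prob_space \<mu>" and h [measurable]: "h \<in> borel_measurable \<mu>" and I: "finite I"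
    and F: "finite F" and "\<And>i. i \<in> I \<Longrightarrow> A i \<subseteq> F" "\<And>i. i \<in> I \<Longrightarrow> B i \<subseteq> F" "\<And>i. i \<in> I \<Longrightarrow> A i \<inter> B i = {}"
  shows "(\<integral>\<^sup>+t. (SUP i\<in>I. c i * ((\<Prod>a\<in>A i. h (t a)) * (\<Prod>b\<in>B i. h (t b)))) \<partial>PiM F (\<lambda>_. \<mu>))
    \<le> (\<integral>\<^sup>+t. \<integral>\<^sup>+s. (SUP i\<in>I. c i * ((\<Prod>a\<in>A i. h (t a)) * (\<Prod>b\<in>B i. h (s b)))) \<partial>PiM F (\<lambda>_. \<mu>) \<partial>PiM F (\<lambda>_. \<mu>))"
  using F assms(5-)
proof (induction F arbitrary: A B c rule: finite_induct)
  case empty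
  interpret P: prob_space "PiM {} (\<lambda>_. \<mu>)" by (intro prob_space_PiM \<mu>)
  have "A i = {}" "B i = {}" if "i \<in> I" for i using empty that by auto
  then have "(SUP i\<in>I. c i * ((\<Prod>a\<in>A i. h (t a)) * (\<Prod>b\<in>B i. h (s b)))) = (SUP i\<in>I. c i)" for t s
    by (intro SUP_cong) auto
  then show ?case by (simp add: P.emeasure_space_1)
next
  case (insert e F)
  interpret prob_space \<mu> by fact
  interpret product_sigma_finite "\<lambda>_. \<mu>" by standard
  interpret Q: finite_product_sigma_finite "\<lambda>_. \<mu>" F by standard (use insert in auto)
  interpret pair_sigma_finite "PiM F (\<lambda>_. \<mu>)" \<mu> by standard
  let ?N = "PiM F (\<lambda>_. \<mu>)" and ?N' = "PiM (insert e F) (\<lambda>_. \<mu>)"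
  define A' B' where "A' i = A i - {e}" and "B' i = B i - {e}" for i
  define w where "w P y = (if P then h y else 1)" for P y
  have finAB: "finite (A i)" "finite (B i)" if "i \<in> I" for i
    using that insert.prems(1,2)[OF that] insert.hyps(1) finite_subset[of _ "insert e F"] by blast+
  have sub: "A' i \<subseteq> F" "B' i \<subseteq> F" "A' i \<inter> B' i = {}" "\<not> (e \<in> A i \<and> e \<in> B i)" if "i \<in> I" for i
    using that insert.prems unfolding A'_def B'_def by blast+
  have upd: "(\<Prod>a\<in>A i. h ((x(e := y)) a)) = w (e \<in> A i) y * (\<Prod>a\<in>A' i. h (x a))"
    "(\<Prod>a\<in>B i. h ((x(e := y)) a)) = w (e \<in> B i) y * (\<Prod>a\<in>B' i. h (x a))" if "i \<in> I" for i x y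
  proof -
    have "(\<Prod>a\<in>C. h ((x(e := y)) a)) = w (e \<in> C) y * (\<Prod>a\<in>C - {e}. h (x a))" if "finite C" for C
    proof -
      have "(\<Prod>a\<in>C. h ((x(e := y)) a)) = w (e \<in> C) y * (\<Prod>a\<in>C - {e}. h ((x(e := y)) a))"
        using that by (cases "e \<in> C") (auto simp: prod.remove[of C e] w_def)
      also have "(\<Prod>a\<in>C - {e}. h ((x(e := y)) a)) = (\<Prod>a\<in>C - {e}. h (x a))"
        by (intro prod.cong) auto
      finally show ?thesis .
    qed
    then show "(\<Prod>a\<in>A i. h ((x(e := y)) a)) = w (e \<in> A i) y * (\<Prod>a\<in>A' i. h (x a))"
      "(\<Prod>a\<in>B i. h ((x(e := y)) a)) = w (e \<in> B i) y * (\<Prod>a\<in>B' i. h (x a))"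
      using finAB[OF that] unfolding A'_def B'_def by blast+
  qed
  have w_meas [measurable]: "w P \<in> borel_measurable \<mu>" for P unfolding w_def by measurable
  have prod_meas: "(\<lambda>t. \<Prod>a\<in>C. h (t a)) \<in> borel_measurable (PiM G (\<lambda>_. \<mu>))" if "C \<subseteq> G" for C G
    using that by (intro borel_measurable_prod_ennreal measurable_compose[OF _ h] measurable_component_singleton) auto
  have [measurable]: "i \<in> I \<Longrightarrow> (\<lambda>t. \<Prod>a\<in>A i. h (t a)) \<in> borel_measurable ?N'"
    "i \<in> I \<Longrightarrow> (\<lambda>t. \<Prod>a\<in>B i. h (t a)) \<in> borel_measurable ?N'"
    "i \<in> I \<Longrightarrow> (\<lambda>t. \<Prod>a\<in>A' i. h (t a)) \<in> borel_measurable ?N"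
    "i \<in> I \<Longrightarrow> (\<lambda>t. \<Prod>a\<in>B' i. h (t a)) \<in> borel_measurable ?N" for i
    by (rule prod_meas; use sub insert.prems in blast)+
  have cI [measurable]: "countable I" using I by (rule countable_finite)
  define \<phi> where "\<phi> i x = (\<Prod>a\<in>A' i. h (x a))" for i x
  define \<psi> where "\<psi> i x = (\<Prod>a\<in>B' i. h (x a))" for i x
  have [measurable]: "i \<in> I \<Longrightarrow> \<phi> i \<in> borel_measurable ?N" "i \<in> I \<Longrightarrow> \<psi> i \<in> borel_measurable ?N" for i
    unfolding \<phi>_def \<psi>_def by measurable
  define K where "K y z x s = (SUP i\<in>I. (c i * (\<phi> i x * \<psi> i s)) * (w (e \<in> A i) y * w (e \<in> B i) z))" for y z x s
  define L where "L y x s = (SUP i\<in>I. (c i * (\<phi> i x * \<psi> i s)) * w (e \<in> A i \<or> e \<in> B i) y)" for y x s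
  have "(\<integral>\<^sup>+t. (SUP i\<in>I. c i * ((\<Prod>a\<in>A i. h (t a)) * (\<Prod>b\<in>B i. h (t b)))) \<partial>?N')
      = (\<integral>\<^sup>+y. \<integral>\<^sup>+x. (SUP i\<in>I. c i * ((\<Prod>a\<in>A i. h ((x(e := y)) a)) * (\<Prod>b\<in>B i. h ((x(e := y)) b)))) \<partial>?N \<partial>\<mu>)"
    using insert.hyps by (intro product_nn_integral_insert_rev) measurable
  also have "\<dots> = (\<integral>\<^sup>+y. \<integral>\<^sup>+x. (SUP i\<in>I. (c i * w (e \<in> A i \<or> e \<in> B i) y) * (\<phi> i x * \<psi> i x)) \<partial>?N \<partial>\<mu>)"
    using sub(4) by (intro nn_integral_cong SUP_cong refl) (auto simp: upd \<phi>_def \<psi>_def w_def mult_ac simp del: fun_upd_apply)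
  also have "\<dots> \<le> (\<integral>\<^sup>+y. \<integral>\<^sup>+x. \<integral>\<^sup>+s. (SUP i\<in>I. (c i * w (e \<in> A i \<or> e \<in> B i) y) * (\<phi> i x * \<psi> i s)) \<partial>?N \<partial>?N \<partial>\<mu>)"
    unfolding \<phi>_def \<psi>_def using sub by (intro nn_integral_mono insert.IH) auto
  also have "\<dots> = (\<integral>\<^sup>+y. \<integral>\<^sup>+x. \<integral>\<^sup>+s. L y x s \<partial>?N \<partial>?N \<partial>\<mu>)"
    by (simp add: L_def mult_ac)
  also have "\<dots> = (\<integral>\<^sup>+x. \<integral>\<^sup>+y. \<integral>\<^sup>+s. L y x s \<partial>?N \<partial>\<mu> \<partial>?N)"
    unfolding L_def by (rule Fubini') measurable
  also have "\<dots> = (\<integral>\<^sup>+x. \<integral>\<^sup>+s. \<integral>\<^sup>+y. L y x s \<partial>\<mu> \<partial>?N \<partial>?N)"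
    unfolding L_def by (intro nn_integral_cong Fubini') measurable
  also have "\<dots> \<le> (\<integral>\<^sup>+x. \<integral>\<^sup>+s. \<integral>\<^sup>+y. \<integral>\<^sup>+z. K y z x s \<partial>\<mu> \<partial>\<mu> \<partial>?N \<partial>?N)"
    unfolding L_def K_def w_def using sub(4) by (intro nn_integral_mono nn_integral_SUP_decouple \<mu>) auto
  also have "\<dots> = (\<integral>\<^sup>+x. \<integral>\<^sup>+y. \<integral>\<^sup>+s. \<integral>\<^sup>+z. K y z x s \<partial>\<mu> \<partial>?N \<partial>\<mu> \<partial>?N)"
    unfolding K_def by (intro nn_integral_cong Fubini'[symmetric]) measurable
  also have "\<dots> = (\<integral>\<^sup>+x. \<integral>\<^sup>+y. \<integral>\<^sup>+s. \<integral>\<^sup>+z. (SUP i\<in>I. c i * ((\<Prod>a\<in>A i. h ((x(e := y)) a)) * (\<Prod>b\<in>B i. h ((s(e := z)) b)))) \<partial>\<mu> \<partial>?N \<partial>\<mu> \<partial>?N)"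
    unfolding K_def by (intro nn_integral_cong SUP_cong refl) (auto simp: upd \<phi>_def \<psi>_def mult_ac simp del: fun_upd_apply)
  also have "\<dots> = (\<integral>\<^sup>+x. \<integral>\<^sup>+y. \<integral>\<^sup>+s. (SUP i\<in>I. c i * ((\<Prod>a\<in>A i. h ((x(e := y)) a)) * (\<Prod>b\<in>B i. h (s b)))) \<partial>?N' \<partial>\<mu> \<partial>?N)"
    using insert.hyps by (intro nn_integral_cong product_nn_integral_insert[symmetric]) measurable
  also have "\<dots> = (\<integral>\<^sup>+t. \<integral>\<^sup>+s. (SUP i\<in>I. c i * ((\<Prod>a\<in>A i. h (t a)) * (\<Prod>b\<in>B i. h (s b)))) \<partial>?N' \<partial>?N')"
  proof -
    interpret Q': finite_product_sigma_finite "\<lambda>_. \<mu>" "insert e F" by standard (use insert in auto)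
    show ?thesis using insert.hyps by (intro product_nn_integral_insert[symmetric]) measurable
  qed
  finally show ?case .
qed

section \<open>Translations and first exits\<close>

definition translate :: "vertex \<Rightarrow> vertex \<Rightarrow> vertex" where
  "translate v x = (\<lambda>i. v i + x i)"

lemma translate_lattice [simp]: "v \<in> lattice d \<Longrightarrow> translate v x \<in> lattice d \<longleftrightarrow> x \<in> lattice d"
  by (auto simp: translate_def lattice_def)

lemma inj_translate: "inj (translate v)"
  by (auto simp: inj_def translate_def fun_eq_iff)

lemma translate_origin [simp]: "translate v origin = v"
  by (simp add: translate_def origin_def)

lemma adjacent_translate: "v \<in> lattice d \<Longrightarrow> adjacent d (translate v x) (translate v y) \<longleftrightarrow> adjacent d x y"
  unfolding adjacent_def by (simp add: translate_def[of v])
    (simp add: translate_def[symmetric])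

lemma supdist_translate: "supdist d (translate v x) (translate v y) = supdist d x y"
  by (simp add: supdist_def translate_def)

definition translate_edge :: "vertex \<Rightarrow> edge \<Rightarrow> edge" where
  "translate_edge v e = translate v ` e"

lemma inj_translate_edge: "inj (translate_edge v)"
  unfolding translate_edge_def using inj_translate[of v] by (simp add: inj_image_eq_iff inj_def)

lemma translate_edge_pair [simp]: "translate_edge v {x, y} = {translate v x, translate v y}"
  by (simp add: translate_edge_def)

lemma translate_edge_in_edges:
  assumes "v \<in> lattice d" "e \<in> edges d" shows "translate_edge v e \<in> edges d"
proof -
  obtain x y where "e = {x, y}" "adjacent d x y" using assms(2) by (auto simp: edges_def)
  then show ?thesis using adjacent_translate[OF assms(1)] by simp
qed

lemma joined_translate: "joined A x y \<Longrightarrow> joined (translate_edge v ` A) (translate v x) (translate v y)"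
proof (induction rule: joined_induct)
  case (step a b)
  then have "{translate v a, translate v b} \<in> translate_edge v ` A"
    using translate_edge_pair by (metis imageI)
  then show ?case using step joined_edge joined_trans by metis
qed simp

text \<open>
  Edge sets that lead from the origin inside \<open>S\<close> to \<open>fst p\<close> and then out of \<open>S\<close> along \<open>p\<close>. All sets
  containing such a path are included, since damped products only decrease when a set grows.
\<close>

definition link_sets :: "nat \<Rightarrow> vertex set \<Rightarrow> vertex \<times> vertex \<Rightarrow> edge set set" where
  "link_sets d S p = insert {fst p, snd p} ` {A. A \<subseteq> inner_edges d S \<and> joined A origin (fst p)}"

definition far_sets :: "nat \<Rightarrow> edge set \<Rightarrow> vertex \<Rightarrow> int \<Rightarrow> edge set set" where
  "far_sets d F a k = {A. A \<subseteq> F \<and> (\<exists>z. joined A a z \<and> k \<le> supdist d a z)}"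

text \<open>
  A path without repetitions is split at the first edge that leaves the translate of \<open>S\<close>. The
  rest of the path may come back to that translate, but it uses other edges.
\<close>

lemma first_exit_decomposition:
  assumes "F \<subseteq> edges d" "A \<subseteq> F" "joined A a z" "a \<in> lattice d"
    and S: "S \<subseteq> lattice d" "origin \<in> S" and z: "z \<notin> translate a ` S"
  obtains p A1 A2 where "p \<in> exits d S" "A1 \<in> link_sets d S p" "translate_edge a ` A1 \<subseteq> A"
    "A2 \<subseteq> A" "translate_edge a ` A1 \<inter> A2 = {}" "joined A2 (translate a (snd p)) z"
proof -
  define b where "b = (\<lambda>i. - a i)"
  have b: "b \<in> lattice d" using assms(4) by (simp add: b_def lattice_def)
  have inv: "translate a (translate b x) = x" for x by (simp add: translate_def b_def)
  have inv': "translate b (translate a x) = x" for x by (simp add: translate_def b_def)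
  have inv_edge: "translate_edge a (translate_edge b e) = e" for e
    by (simp add: translate_edge_def image_image inv)
  obtain \<gamma> where \<gamma>: "is_path d a z \<gamma>" "set (path_edges \<gamma>) \<subseteq> A" "distinct \<gamma>"
    using distinct_path_if_joined[OF assms(3,4)] assms(1,2) by blast
  have ne: "\<gamma> \<noteq> []" and ends: "hd \<gamma> = a" "last \<gamma> = z" and succ: "successively (adjacent d) \<gamma>"
    using \<gamma>(1) by (auto simp: is_path_def)
  define \<gamma>1 \<gamma>2 where "\<gamma>1 = takeWhile (\<lambda>v. v \<in> translate a ` S) \<gamma>"
    and "\<gamma>2 = dropWhile (\<lambda>v. v \<in> translate a ` S) \<gamma>"
  have split: "\<gamma> = \<gamma>1 @ \<gamma>2" by (simp add: \<gamma>1_def \<gamma>2_def)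
  have "a \<in> translate a ` S" using S(2) by (metis imageI translate_origin)
  then have ne1: "\<gamma>1 \<noteq> []" and hd1: "hd \<gamma>1 = a" using ne ends by (cases \<gamma>; simp add: \<gamma>1_def)+
  have ne2: "\<gamma>2 \<noteq> []"
  proof
    assume "\<gamma>2 = []"
    then have "\<forall>v\<in>set \<gamma>. v \<in> translate a ` S" by (simp add: \<gamma>2_def dropWhile_eq_Nil_conv)
    then show False using z ends ne last_in_set by metis
  qed
  then have last2: "last \<gamma>2 = z" using ends split by simp
  have in1: "set \<gamma>1 \<subseteq> translate a ` S" unfolding \<gamma>1_def using set_takeWhileD by fastforce
  have y_out: "hd \<gamma>2 \<notin> translate a ` S" using hd_dropWhile ne2 unfolding \<gamma>2_def by blast
  define x y where "x = translate b (last \<gamma>1)" and "y = translate b (hd \<gamma>2)"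
  have tx: "translate a x = last \<gamma>1" and ty: "translate a y = hd \<gamma>2" by (simp_all add: x_def y_def inv)
  have "adjacent d (last \<gamma>1) (hd \<gamma>2)" using succ ne1 ne2 unfolding split by (simp add: successively_append_iff)
  then have adj: "adjacent d x y" unfolding x_def y_def using adjacent_translate[OF b] by simp
  have xS: "x \<in> S"
  proof -
    have "last \<gamma>1 \<in> translate a ` S" using in1 ne1 last_in_set by blast
    then show ?thesis unfolding x_def using inv' by auto
  qed
  have yS: "y \<notin> S" using y_out ty by (metis imageI)
  have edges: "path_edges \<gamma> = path_edges \<gamma>1 @ {last \<gamma>1, hd \<gamma>2} # path_edges \<gamma>2"
    unfolding split by (rule path_edges_append[OF ne1 ne2])
  have dist: "distinct (path_edges \<gamma>)" by (rule distinct_path_edges[OF \<gamma>(3)])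
  define A0 where "A0 = translate_edge b ` set (path_edges \<gamma>1)"
  have A0: "translate_edge a ` A0 = set (path_edges \<gamma>1)"
    by (simp add: A0_def image_image inv_edge)
  have "A0 \<subseteq> inner_edges d S"
  proof
    fix e assume "e \<in> A0"
    then obtain f where f: "f \<in> set (path_edges \<gamma>1)" "e = translate_edge b f" by (auto simp: A0_def)
    have "f \<in> edges d" using f(1) edges \<gamma>(2) assms(1,2) by auto
    then have "e \<in> edges d" unfolding f(2) by (rule translate_edge_in_edges[OF b])
    moreover have "f \<subseteq> translate a ` S" using path_edges_subset[OF f(1)] in1 by blast
    then have "e \<subseteq> S" unfolding f(2) translate_edge_def using inv' by auto
    ultimately show "e \<in> inner_edges d S" by (simp add: inner_edges_def)
  qed
  moreover have "joined A0 origin x"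
  proof -
    have "joined (set (path_edges \<gamma>1)) (hd \<gamma>1) (last \<gamma>1)" using ne1 by (intro joined_if_path) auto
    from joined_translate[OF this, of b] have "joined A0 (translate b a) x"
      by (simp add: A0_def x_def hd1)
    then show ?thesis using inv'[of origin] by simp
  qed
  ultimately have link: "insert {x, y} A0 \<in> link_sets d S (x, y)" by (auto simp: link_sets_def)
  have image: "translate_edge a ` insert {x, y} A0 = insert {last \<gamma>1, hd \<gamma>2} (set (path_edges \<gamma>1))"
    by (simp add: A0 tx ty)
  show thesis
  proof (rule that[of "(x, y)" "insert {x, y} A0" "set (path_edges \<gamma>2)"])
    show "(x, y) \<in> exits d S" using adj xS yS by (simp add: exits_def)
    show "translate_edge a ` insert {x, y} A0 \<subseteq> A" unfolding image using \<gamma>(2) edges by auto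
    show "set (path_edges \<gamma>2) \<subseteq> A" using \<gamma>(2) edges by auto
    show "translate_edge a ` insert {x, y} A0 \<inter> set (path_edges \<gamma>2) = {}"
      unfolding image using dist unfolding edges by auto
    show "joined (set (path_edges \<gamma>2)) (translate a (snd (x, y))) z"
      using joined_if_path[OF order_refl ne2] last2 ty by simp
  qed (rule link)
qed

section \<open>Damped passage times\<close>

locale first_passage = prob_space M for M :: "'a measure" +
  fixes d :: nat and \<tau> :: "edge \<Rightarrow> 'a \<Rightarrow> real"
  assumes dim: "d \<ge> 2"
    and indep: "indep_vars (\<lambda>_. borel) \<tau> (edges d)"
    and ident: "\<And>e e'. e \<in> edges d \<Longrightarrow> e' \<in> edges d \<Longrightarrow> distr M borel (\<tau> e) = distr M borel (\<tau> e')"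
    and weight_nonneg: "\<And>e \<omega>. e \<in> edges d \<Longrightarrow> \<omega> \<in> space M \<Longrightarrow> 0 \<le> \<tau> e \<omega>"
    and square_integrable: "\<And>e. e \<in> edges d \<Longrightarrow> integrable M (\<lambda>\<omega>. (\<tau> e \<omega>)\<^sup>2)"
begin

lemma d_pos: "d > 0" using dim by simp

lemma weight_measurable: "e \<in> edges d \<Longrightarrow> \<tau> e \<in> borel_measurable M"
  using indep by (simp add: indep_vars_def)

text \<open>
  A reference edge, whose weight represents the common law.
\<close>

definition e0 :: edge where "e0 = {origin, e1}"

lemma e0_in_edges: "e0 \<in> edges d"
proof -
  have "(\<Sum>i<d. \<bar>origin i - e1 i\<bar>) = (\<Sum>i<d. if i = 0 then 1 else 0)"
    by (intro sum.cong) (auto simp: origin_def e1_def)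
  also have "\<dots> = 1" using d_pos by simp
  finally show ?thesis using d_pos
    by (simp add: e0_def adjacent_def) (simp add: e1_def lattice_def)
qed

definition \<mu> :: "real measure" where "\<mu> = distr M borel (\<tau> e0)"

lemma prob_space_\<mu>: "prob_space \<mu>"
  unfolding \<mu>_def by (rule prob_space_distr) (rule weight_measurable[OF e0_in_edges])

lemma sets_\<mu> [simp, measurable_cong]: "sets \<mu> = sets borel"
  by (simp add: \<mu>_def)

lemma distr_weights:
  assumes "F \<subseteq> edges d" "F \<noteq> {}"
  shows "distr M (PiM F (\<lambda>_. borel)) (\<lambda>\<omega>. \<lambda>e\<in>F. \<tau> e \<omega>) = PiM F (\<lambda>_. \<mu>)"
proof -
  have "distr M (PiM F (\<lambda>_. borel)) (\<lambda>\<omega>. \<lambda>e\<in>F. \<tau> e \<omega>) = PiM F (\<lambda>e. distr M borel (\<tau> e))"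
    by (rule iffD1[OF indep_vars_iff_distr_eq_PiM'[OF assms(2)] indep_vars_subset[OF indep assms(1)]])
      (use weight_measurable assms(1) in auto)
  also have "\<dots> = PiM F (\<lambda>_. \<mu>)"
    unfolding \<mu>_def using assms(1) by (intro PiM_cong refl ident e0_in_edges) (rule subsetD)
  finally show ?thesis .
qed

lemma nn_integral_weights:
  assumes "F \<subseteq> edges d" "F \<noteq> {}" "G \<in> borel_measurable (PiM F (\<lambda>_. \<mu>))"
  shows "(\<integral>\<^sup>+\<omega>. G (\<lambda>e\<in>F. \<tau> e \<omega>) \<partial>M) = (\<integral>\<^sup>+t. G t \<partial>PiM F (\<lambda>_. \<mu>))"
proof -
  have "(\<lambda>\<omega>. \<lambda>e\<in>F. \<tau> e \<omega>) \<in> measurable M (PiM F (\<lambda>_. borel))"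
    using weight_measurable assms(1) by (intro measurable_restrict) auto
  moreover have "G \<in> borel_measurable (PiM F (\<lambda>_. borel))"
    using assms(3) by (simp cong: measurable_cong_sets sets_PiM_cong)
  ultimately show ?thesis unfolding distr_weights[OF assms(1,2), symmetric]
    by (subst nn_integral_distr) auto
qed

definition damp :: "real \<Rightarrow> real \<Rightarrow> ennreal" where
  "damp l x = ennreal (exp (- l * x))"

lemma damp_measurable [measurable]: "damp l \<in> borel_measurable borel"
  unfolding damp_def by measurable

text \<open>
  The expectation of \<open>exp (- l T)\<close>, where \<open>T\<close> is the least total weight of a set in the family, and
  of \<open>0\<close> if the family is empty.
\<close>

definition esup :: "real \<Rightarrow> edge set set \<Rightarrow> ennreal" where
  "esup l \<A> = (\<integral>\<^sup>+\<omega>. (SUP A\<in>\<A>. \<Prod>a\<in>A. damp l (\<tau> a \<omega>)) \<partial>M)"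

lemma damp_prod_measurable:
  "A \<subseteq> F \<Longrightarrow> (\<lambda>t. \<Prod>a\<in>A. damp l (t a)) \<in> borel_measurable (PiM F (\<lambda>_. \<mu>))"
  by (intro borel_measurable_prod_ennreal measurable_compose[OF _ damp_measurable]
      measurable_compose[OF measurable_component_singleton]) (auto simp: measurable_ident_sets)

lemma esup_eq_PiM:
  assumes "F \<subseteq> edges d" "F \<noteq> {}" "finite \<A>" "\<And>A. A \<in> \<A> \<Longrightarrow> A \<subseteq> F"
  shows "esup l \<A> = (\<integral>\<^sup>+t. (SUP A\<in>\<A>. \<Prod>a\<in>A. damp l (t a)) \<partial>PiM F (\<lambda>_. \<mu>))"
proof -
  have "esup l \<A> = (\<integral>\<^sup>+\<omega>. (SUP A\<in>\<A>. \<Prod>a\<in>A. damp l ((\<lambda>e\<in>F. \<tau> e \<omega>) a)) \<partial>M)"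
    unfolding esup_def using assms(4)
    by (intro nn_integral_cong SUP_cong prod.cong refl) (auto simp: subset_iff)
  also have "\<dots> = (\<integral>\<^sup>+t. (SUP A\<in>\<A>. \<Prod>a\<in>A. damp l (t a)) \<partial>PiM F (\<lambda>_. \<mu>))"
    using assms by (intro nn_integral_weights borel_measurable_SUP countable_finite damp_prod_measurable) auto
  finally show ?thesis .
qed

lemma esup_translate:
  assumes "v \<in> lattice d" "finite \<A>" "\<And>A. A \<in> \<A> \<Longrightarrow> A \<subseteq> F" "F \<subseteq> edges d"
  shows "esup l ((`) (translate_edge v) ` \<A>) = esup l \<A>"
proof -
  define G where "G = insert e0 F"
  define H where "H = translate_edge v ` G"
  have G: "G \<subseteq> edges d" "G \<noteq> {}" "\<And>A. A \<in> \<A> \<Longrightarrow> A \<subseteq> G"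
    using assms(3,4) e0_in_edges by (auto simp: G_def)
  have inj: "inj_on (translate_edge v) X" for X using inj_translate_edge inj_on_subset by blast
  have meas: "(\<lambda>t. SUP A\<in>\<A>. \<Prod>a\<in>A. damp l (t a)) \<in> borel_measurable (PiM G (\<lambda>_. \<mu>))"
    using assms(2) G by (intro borel_measurable_SUP countable_finite damp_prod_measurable) auto
  have "esup l \<A> = (\<integral>\<^sup>+t. (SUP A\<in>\<A>. \<Prod>a\<in>A. damp l (t a)) \<partial>PiM G (\<lambda>_. \<mu>))"
    by (rule esup_eq_PiM[OF G(1,2) assms(2) G(3)])
  also have "PiM G (\<lambda>_. \<mu>) = distr (PiM H (\<lambda>_. \<mu>)) (PiM G (\<lambda>_. \<mu>)) (\<lambda>t. \<lambda>n\<in>G. t (translate_edge v n))"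
    by (rule distr_PiM_reindex[symmetric]) (auto simp: prob_space_\<mu> inj H_def)
  also have "(\<integral>\<^sup>+t. (SUP A\<in>\<A>. \<Prod>a\<in>A. damp l (t a)) \<partial>\<dots>)
      = (\<integral>\<^sup>+t. (SUP A\<in>\<A>. \<Prod>a\<in>A. damp l ((\<lambda>n\<in>G. t (translate_edge v n)) a)) \<partial>PiM H (\<lambda>_. \<mu>))"
    using meas by (subst nn_integral_distr)
      (auto simp: H_def intro!: measurable_restrict measurable_component_singleton)
  also have "\<dots> = (\<integral>\<^sup>+t. (SUP A\<in>(`) (translate_edge v) ` \<A>. \<Prod>a\<in>A. damp l (t a)) \<partial>PiM H (\<lambda>_. \<mu>))"
  proof (rule nn_integral_cong)
    fix t
    have "(\<Prod>a\<in>A. damp l ((\<lambda>n\<in>G. t (translate_edge v n)) a)) = (\<Prod>a\<in>translate_edge v ` A. damp l (t a))"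
      if "A \<in> \<A>" for A
      using G(3)[OF that] by (subst prod.reindex[OF inj]) (auto intro!: prod.cong)
    then show "(SUP A\<in>\<A>. \<Prod>a\<in>A. damp l ((\<lambda>n\<in>G. t (translate_edge v n)) a))
        = (SUP A\<in>(`) (translate_edge v) ` \<A>. \<Prod>a\<in>A. damp l (t a))"
      by (simp add: image_image)
  qed
  also have "\<dots> = esup l ((`) (translate_edge v) ` \<A>)"
    using assms(1,2) G by (intro esup_eq_PiM[symmetric]) (auto simp: H_def translate_edge_in_edges)
  finally show ?thesis by simp
qed

lemma esup_mono: "\<A> \<subseteq> \<B> \<Longrightarrow> esup l \<A> \<le> esup l \<B>"
  unfolding esup_def by (intro nn_integral_mono SUP_subset_mono) auto

text \<open>
  Since the law of the weights on a finite set of edges is a product, the supremum over disjoint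
  pairs is bounded by decoupling the two members of the pair.
\<close>

lemma esup_BK:
  assumes F: "F \<subseteq> edges d" "finite F" and J: "finite J"
    "\<And>A B. (A, B) \<in> J \<Longrightarrow> A \<subseteq> F \<and> B \<subseteq> F \<and> A \<inter> B = {}"
  shows "(\<integral>\<^sup>+\<omega>. (SUP (A, B)\<in>J. (\<Prod>a\<in>A. damp l (\<tau> a \<omega>)) * (\<Prod>b\<in>B. damp l (\<tau> b \<omega>))) \<partial>M)
    \<le> esup l (fst ` J) * esup l (snd ` J)"
proof -
  define G where "G = insert e0 F"
  have G: "G \<subseteq> edges d" "G \<noteq> {}" "finite G" using F e0_in_edges by (auto simp: G_def)
  have sub: "fst i \<subseteq> G" "snd i \<subseteq> G" "fst i \<inter> snd i = {}" if "i \<in> J" for i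
    using J(2)[of "fst i" "snd i"] that by (auto simp: G_def)
  let ?N = "PiM G (\<lambda>_. \<mu>)"
  have damp_\<mu>: "damp l \<in> borel_measurable \<mu>" by measurable
  have meas: "(\<lambda>t. \<Prod>a\<in>fst i. damp l (t a)) \<in> borel_measurable ?N"
    "(\<lambda>t. \<Prod>a\<in>snd i. damp l (t a)) \<in> borel_measurable ?N" if "i \<in> J" for i
    using damp_prod_measurable sub[OF that] by blast+
  have cJ: "countable J" using J(1) by (rule countable_finite)
  have "(\<integral>\<^sup>+\<omega>. (SUP (A, B)\<in>J. (\<Prod>a\<in>A. damp l (\<tau> a \<omega>)) * (\<Prod>b\<in>B. damp l (\<tau> b \<omega>))) \<partial>M)
      = (\<integral>\<^sup>+\<omega>. (SUP i\<in>J. (\<Prod>a\<in>fst i. damp l ((\<lambda>e\<in>G. \<tau> e \<omega>) a)) * (\<Prod>b\<in>snd i. damp l ((\<lambda>e\<in>G. \<tau> e \<omega>) b))) \<partial>M)"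
    unfolding case_prod_unfold using sub
    by (intro nn_integral_cong SUP_cong refl arg_cong2[where f = "(*)"] prod.cong) (auto simp: subset_iff)
  also have "\<dots> = (\<integral>\<^sup>+t. (SUP i\<in>J. (\<Prod>a\<in>fst i. damp l (t a)) * (\<Prod>b\<in>snd i. damp l (t b))) \<partial>?N)"
    using G meas cJ by (intro nn_integral_weights borel_measurable_SUP borel_measurable_times_ennreal) auto
  also have "\<dots> \<le> (\<integral>\<^sup>+t. \<integral>\<^sup>+s. (SUP i\<in>J. (\<Prod>a\<in>fst i. damp l (t a)) * (\<Prod>b\<in>snd i. damp l (s b))) \<partial>?N \<partial>?N)"
    using BK_inequality_sup[OF prob_space_\<mu> damp_\<mu> J(1) G(3) sub(1) sub(2) sub(3), where c = "\<lambda>_. 1"] by simp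
  also have "\<dots> \<le> (\<integral>\<^sup>+t. \<integral>\<^sup>+s. (SUP A\<in>fst ` J. \<Prod>a\<in>A. damp l (t a)) * (SUP B\<in>snd ` J. \<Prod>b\<in>B. damp l (s b)) \<partial>?N \<partial>?N)"
    by (intro nn_integral_mono SUP_least mult_mono) (auto intro!: SUP_upper2)
  also have "\<dots> = (\<integral>\<^sup>+t. (SUP A\<in>fst ` J. \<Prod>a\<in>A. damp l (t a)) * (\<integral>\<^sup>+s. (SUP B\<in>snd ` J. \<Prod>b\<in>B. damp l (s b)) \<partial>?N) \<partial>?N)"
    using meas cJ by (intro nn_integral_cong nn_integral_cmult borel_measurable_SUP) auto
  also have "\<dots> = esup l (fst ` J) * esup l (snd ` J)"
  proof -
    have "esup l (fst ` J) = (\<integral>\<^sup>+t. (SUP A\<in>fst ` J. \<Prod>a\<in>A. damp l (t a)) \<partial>?N)"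
      "esup l (snd ` J) = (\<integral>\<^sup>+t. (SUP A\<in>snd ` J. \<Prod>a\<in>A. damp l (t a)) \<partial>?N)"
      using J(1) sub by (intro esup_eq_PiM[OF G(1,2)]; fastforce)+
    then show ?thesis using meas cJ by (simp only:) (intro nn_integral_multc borel_measurable_SUP; auto)
  qed
  finally show ?thesis .
qed

definition link_weight :: "real \<Rightarrow> vertex set \<Rightarrow> ennreal" where
  "link_weight l S = (\<Sum>p\<in>exits d S. esup l (link_sets d S p))"

lemma link_sets_subset:
  "p \<in> exits d S \<Longrightarrow> A \<in> link_sets d S p \<Longrightarrow> A \<subseteq> insert {fst p, snd p} (inner_edges d S)"
  "p \<in> exits d S \<Longrightarrow> insert {fst p, snd p} (inner_edges d S) \<subseteq> edges d"
  using inner_edges_subset by (auto simp: link_sets_def exits_def)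

lemma finite_link_sets: "finite S \<Longrightarrow> finite (link_sets d S p)"
  unfolding link_sets_def by (intro finite_imageI finite_subset[OF _ finite_Pow_iff[THEN iffD2, OF finite_inner_edges]]) auto

lemma prod_damp:
  assumes "\<omega> \<in> space M" "A \<subseteq> edges d"
  shows "(\<Prod>a\<in>A. damp l (\<tau> a \<omega>)) = ennreal (exp (- l * (\<Sum>a\<in>A. \<tau> a \<omega>)))"
proof (cases "finite A")
  case True
  then show ?thesis unfolding damp_def by (simp add: prod_ennreal exp_sum[symmetric] sum_distrib_left sum_negf)
qed simp

text \<open>
  A path to distance \<open>(m + 1) L\<close> first leaves the translate of \<open>S\<close> through some exit and then, from
  the exit, covers a distance of at least \<open>m L\<close> along disjoint edges.
\<close>

lemma esup_far_sets:
  assumes S: "finite S" "S \<subseteq> lattice d" "origin \<in> S" and L: "S \<subseteq> cube d origin (int L - 1)"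
    and l: "0 \<le> l" and F: "finite F" "F \<subseteq> edges d"
  shows "a \<in> lattice d \<Longrightarrow> esup l (far_sets d F a (int (m * L))) \<le> link_weight l S ^ m"
proof (induction m arbitrary: a)
  case 0
  have "(SUP A\<in>far_sets d F a 0. \<Prod>a\<in>A. damp l (\<tau> a \<omega>)) \<le> 1" if "\<omega> \<in> space M" for \<omega>
  proof (rule SUP_least)
    fix A assume "A \<in> far_sets d F a 0"
    then have A: "A \<subseteq> edges d" using F by (auto simp: far_sets_def)
    have "0 \<le> l * (\<Sum>a\<in>A. \<tau> a \<omega>)" using A l weight_nonneg[OF _ that] by (intro mult_nonneg_nonneg sum_nonneg) auto
    then show "(\<Prod>a\<in>A. damp l (\<tau> a \<omega>)) \<le> 1" unfolding prod_damp[OF that A] by simp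
  qed
  then have "esup l (far_sets d F a 0) \<le> (\<integral>\<^sup>+\<omega>. 1 \<partial>M)" unfolding esup_def by (intro nn_integral_mono)
  then show ?case by (simp add: emeasure_space_1)
next
  case (Suc m)
  let ?g = "\<lambda>\<omega> A. \<Prod>a\<in>A. damp l (\<tau> a \<omega>)"
  define J where "J p = {(A, B). A \<in> (`) (translate_edge a) ` link_sets d S p \<and> A \<subseteq> F
      \<and> B \<in> far_sets d F (translate a (snd p)) (int (m * L)) \<and> A \<inter> B = {}}" for p
  have fin_exits: "finite (exits d S)" by (rule finite_exits[OF S(1) d_pos])
  have J_sub: "A \<subseteq> F \<and> B \<subseteq> F \<and> A \<inter> B = {}" if "(A, B) \<in> J p" for A B p
    using that by (auto simp: J_def far_sets_def)
  have finJ: "finite (J p)" for p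
  proof (rule finite_subset)
    show "J p \<subseteq> Pow F \<times> Pow F" using J_sub[of _ _ p] by fast
  qed (use F in simp)
  have exit_dist: "supdist d origin (snd p) \<le> int L" if "p \<in> exits d S" for p
  proof -
    have "supdist d origin (fst p) \<le> int L - 1" "adjacent d (fst p) (snd p)"
      using that L by (auto simp: exits_def cube_def)
    then show ?thesis using supdist_step[OF _ d_pos, of "fst p" "snd p" origin] by linarith
  qed
  have pointwise: "(SUP A\<in>far_sets d F a (int (Suc m * L)). ?g \<omega> A) \<le> (\<Sum>p\<in>exits d S. SUP (A, B)\<in>J p. ?g \<omega> A * ?g \<omega> B)"
    if \<omega>: "\<omega> \<in> space M" for \<omega>
  proof (rule SUP_least)
    fix A assume "A \<in> far_sets d F a (int (Suc m * L))"
    then obtain z where A: "A \<subseteq> F" "joined A a z" "int (Suc m * L) \<le> supdist d a z" by (auto simp: far_sets_def)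
    have "z \<notin> translate a ` S"
    proof
      assume "z \<in> translate a ` S"
      then obtain s where "s \<in> S" "z = translate a s" by auto
      then have "supdist d a z \<le> int L - 1"
        using L supdist_translate[of d a origin s] by (auto simp: cube_def)
      moreover have "int (Suc m * L) = int L + int (m * L)" "0 \<le> int (m * L)" by simp_all
      ultimately show False using A(3) by linarith
    qed
    then obtain p A1 A2 where p: "p \<in> exits d S" "A1 \<in> link_sets d S p" "translate_edge a ` A1 \<subseteq> A"
      "A2 \<subseteq> A" "translate_edge a ` A1 \<inter> A2 = {}" "joined A2 (translate a (snd p)) z"
      using first_exit_decomposition[OF F(2) A(1,2) Suc.prems S(2,3)] by metis
    have "supdist d a z \<le> int L + supdist d (translate a (snd p)) z"
      using supdist_triangle[OF d_pos, of a z "translate a (snd p)"] exit_dist[OF p(1)]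
        supdist_translate[of d a origin "snd p"] by simp
    then have "int (m * L) \<le> supdist d (translate a (snd p)) z"
      using A(3) by (simp add: algebra_simps)
    then have in_J: "(translate_edge a ` A1, A2) \<in> J p"
      using p A(1) by (auto simp: J_def far_sets_def)
    have finA: "finite A" "A \<subseteq> edges d" using A(1) F finite_subset by auto
    have fin12: "finite (translate_edge a ` A1)" "finite A2" using p(3,4) finA(1) finite_subset by auto
    have "(\<Sum>a\<in>translate_edge a ` A1. \<tau> a \<omega>) + (\<Sum>a\<in>A2. \<tau> a \<omega>) = (\<Sum>a\<in>translate_edge a ` A1 \<union> A2. \<tau> a \<omega>)"
      using fin12 p(5) by (intro sum.union_disjoint[symmetric]) auto
    also have "\<dots> \<le> (\<Sum>a\<in>A. \<tau> a \<omega>)"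
      using p(3,4) finA weight_nonneg[OF _ \<omega>] by (intro sum_mono2) auto
    finally have sums: "l * ((\<Sum>a\<in>translate_edge a ` A1. \<tau> a \<omega>) + (\<Sum>a\<in>A2. \<tau> a \<omega>)) \<le> l * (\<Sum>a\<in>A. \<tau> a \<omega>)"
      using l by (rule mult_left_mono)
    have sub12: "translate_edge a ` A1 \<subseteq> edges d" "A2 \<subseteq> edges d" using p(3,4) finA(2) by auto
    have "?g \<omega> A \<le> ?g \<omega> (translate_edge a ` A1) * ?g \<omega> A2"
      unfolding prod_damp[OF \<omega> finA(2)] prod_damp[OF \<omega> sub12(1)] prod_damp[OF \<omega> sub12(2)]
      using sums by (simp add: ennreal_mult[symmetric] exp_add[symmetric] algebra_simps)
    also have "\<dots> \<le> (SUP (A, B)\<in>J p. ?g \<omega> A * ?g \<omega> B)"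
      by (rule SUP_upper2[OF in_J]) simp
    also have "\<dots> \<le> (\<Sum>p\<in>exits d S. SUP (A, B)\<in>J p. ?g \<omega> A * ?g \<omega> B)"
      using fin_exits p(1) by (intro member_le_sum) auto
    finally show "?g \<omega> A \<le> (\<Sum>p\<in>exits d S. SUP (A, B)\<in>J p. ?g \<omega> A * ?g \<omega> B)" .
  qed
  have "esup l (far_sets d F a (int (Suc m * L)))
      \<le> (\<integral>\<^sup>+\<omega>. (\<Sum>p\<in>exits d S. SUP (A, B)\<in>J p. ?g \<omega> A * ?g \<omega> B) \<partial>M)"
    unfolding esup_def by (intro nn_integral_mono pointwise)
  also have "\<dots> = (\<Sum>p\<in>exits d S. \<integral>\<^sup>+\<omega>. (SUP (A, B)\<in>J p. ?g \<omega> A * ?g \<omega> B) \<partial>M)"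
  proof (rule nn_integral_sum)
    fix p
    have g_meas: "(\<lambda>\<omega>. ?g \<omega> A) \<in> borel_measurable M" if "A \<subseteq> F" for A
      using that F weight_measurable
      by (intro borel_measurable_prod_ennreal measurable_compose[OF _ damp_measurable]) auto
    have J_F: "fst q \<subseteq> F" "snd q \<subseteq> F" if "q \<in> J p" for q
      using J_sub[of "fst q" "snd q" p] that by simp_all
    show "(\<lambda>\<omega>. SUP (A, B)\<in>J p. ?g \<omega> A * ?g \<omega> B) \<in> borel_measurable M"
      unfolding case_prod_unfold
      by (intro borel_measurable_SUP countable_finite[OF finJ] borel_measurable_times_ennreal g_meas J_F)
  qed
  also have "\<dots> \<le> (\<Sum>p\<in>exits d S. esup l (link_sets d S p) * link_weight l S ^ m)"
  proof (rule sum_mono)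
    fix p assume p: "p \<in> exits d S"
    have "(\<integral>\<^sup>+\<omega>. (SUP (A, B)\<in>J p. ?g \<omega> A * ?g \<omega> B) \<partial>M) \<le> esup l (fst ` J p) * esup l (snd ` J p)"
      by (rule esup_BK[OF F(2,1) finJ J_sub])
    also have "\<dots> \<le> esup l ((`) (translate_edge a) ` link_sets d S p)
        * esup l (far_sets d F (translate a (snd p)) (int (m * L)))"
      by (intro mult_mono esup_mono) (auto simp: J_def)
    also have "\<dots> \<le> esup l (link_sets d S p) * link_weight l S ^ m"
    proof (intro mult_mono)
      show "esup l ((`) (translate_edge a) ` link_sets d S p) \<le> esup l (link_sets d S p)"
        using esup_translate[OF Suc.prems finite_link_sets[OF S(1)] link_sets_subset[OF p]] by simp
      have "snd p \<in> lattice d" using p by (auto simp: exits_def adjacent_def)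
      then show "esup l (far_sets d F (translate a (snd p)) (int (m * L))) \<le> link_weight l S ^ m"
        using Suc.prems by (intro Suc.IH) simp
    qed auto
    finally show "(\<integral>\<^sup>+\<omega>. (SUP (A, B)\<in>J p. ?g \<omega> A * ?g \<omega> B) \<partial>M) \<le> esup l (link_sets d S p) * link_weight l S ^ m" .
  qed
  also have "\<dots> = link_weight l S ^ Suc m" by (simp add: link_weight_def sum_distrib_right)
  finally show ?case .
qed

definition zero_prob :: real where "zero_prob = prob {\<omega> \<in> space M. \<tau> e0 \<omega> = 0}"

lemma prob_weight_eq:
  assumes "e \<in> edges d" "e' \<in> edges d" "B \<in> sets borel"
  shows "prob {\<omega> \<in> space M. \<tau> e \<omega> \<in> B} = prob {\<omega> \<in> space M. \<tau> e' \<omega> \<in> B}"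
proof -
  have "prob {\<omega> \<in> space M. \<tau> f \<omega> \<in> B} = measure (distr M borel (\<tau> f)) B" if "f \<in> edges d" for f
    using weight_measurable[OF that] assms(3)
    by (subst measure_distr) (auto intro!: arg_cong[where f = prob])
  then show ?thesis using ident[OF assms(1,2)] assms by simp
qed

lemma prob_weight_zero:
  assumes "e \<in> edges d" shows "prob {\<omega> \<in> space M. \<tau> e \<omega> = 0} = zero_prob"
  using prob_weight_eq[OF assms e0_in_edges, of "{0}"] by (simp add: zero_prob_def)

text \<open>
  As \<open>l\<close> tends to infinity, only sets of total weight zero contribute. The bound \<open>u\<close> adds up the
  contributions of all other sets, each of which vanishes by dominated convergence.
\<close>

lemma esup_limit:
  assumes "finite \<A>" "\<And>A. A \<in> \<A> \<Longrightarrow> A \<subseteq> edges d \<and> finite A"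
  obtains u where "\<And>n::nat. esup (real n) \<A> \<le> u n"
    "u \<longlonglongrightarrow> ennreal (prob {\<omega> \<in> space M. \<exists>A\<in>\<A>. \<forall>a\<in>A. \<tau> a \<omega> = 0})"
proof -
  define Z where "Z = {\<omega> \<in> space M. \<exists>A\<in>\<A>. \<forall>a\<in>A. \<tau> a \<omega> = 0}"
  define T where "T A \<omega> = (\<Sum>a\<in>A. \<tau> a \<omega>)" for A \<omega>
  define r where "r A n \<omega> = (if T A \<omega> = 0 then 0 else ennreal (exp (- real n * T A \<omega>)))" for A and n :: nat and \<omega>
  have T_meas [measurable]: "A \<in> \<A> \<Longrightarrow> T A \<in> borel_measurable M" for A
    unfolding T_def using assms(2) weight_measurable by (intro borel_measurable_sum) auto
  have r_meas [measurable]: "A \<in> \<A> \<Longrightarrow> r A n \<in> borel_measurable M" for A n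
    unfolding r_def by measurable
  have T_nonneg: "0 \<le> T A \<omega>" if "A \<in> \<A>" "\<omega> \<in> space M" for A \<omega>
    unfolding T_def using assms(2)[OF that(1)] weight_nonneg[OF _ that(2)] by (intro sum_nonneg) auto
  have Z_iff: "\<omega> \<in> Z \<longleftrightarrow> (\<exists>A\<in>\<A>. T A \<omega> = 0)" if "\<omega> \<in> space M" for \<omega>
    unfolding Z_def T_def using that assms(2) weight_nonneg[OF _ that]
    by (auto simp: sum_nonneg_eq_0_iff subset_iff intro!: bexI)
  have Z_eq: "Z = {\<omega> \<in> space M. \<exists>A\<in>\<A>. T A \<omega> = 0}"
    using Z_iff Z_def by blast
  have Z_events: "Z \<in> events" unfolding Z_eq
    using assms(1) by (intro sets.sets_Collect_finite_Ex) measurable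
  have bound: "(SUP A\<in>\<A>. \<Prod>a\<in>A. damp (real n) (\<tau> a \<omega>)) \<le> indicator Z \<omega> + (\<Sum>A\<in>\<A>. r A n \<omega>)"
    if \<omega>: "\<omega> \<in> space M" for n \<omega>
  proof (rule SUP_least)
    fix A assume A: "A \<in> \<A>"
    have eq: "(\<Prod>a\<in>A. damp (real n) (\<tau> a \<omega>)) = ennreal (exp (- real n * T A \<omega>))"
      unfolding T_def using assms(2)[OF A] by (intro prod_damp[OF \<omega>]) simp
    show "(\<Prod>a\<in>A. damp (real n) (\<tau> a \<omega>)) \<le> indicator Z \<omega> + (\<Sum>A\<in>\<A>. r A n \<omega>)"
    proof (cases "T A \<omega> = 0")
      case True
      then have "\<omega> \<in> Z" using Z_iff[OF \<omega>] A by blast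
      then show ?thesis unfolding eq using True by (simp add: add_increasing2)
    next
      case False
      then have "(\<Prod>a\<in>A. damp (real n) (\<tau> a \<omega>)) = r A n \<omega>" unfolding eq r_def by simp
      also have "\<dots> \<le> (\<Sum>A\<in>\<A>. r A n \<omega>)" using A assms(1) by (intro member_le_sum) auto
      finally show ?thesis by (simp add: add_increasing)
    qed
  qed
  define u where "u n = ennreal (prob Z) + (\<Sum>A\<in>\<A>. \<integral>\<^sup>+\<omega>. r A n \<omega> \<partial>M)" for n
  have "esup (real n) \<A> \<le> u n" for n
  proof -
    have "esup (real n) \<A> \<le> (\<integral>\<^sup>+\<omega>. indicator Z \<omega> + (\<Sum>A\<in>\<A>. r A n \<omega>) \<partial>M)"
      unfolding esup_def by (intro nn_integral_mono bound)
    also have "\<dots> = (\<integral>\<^sup>+\<omega>. indicator Z \<omega> \<partial>M) + (\<integral>\<^sup>+\<omega>. (\<Sum>A\<in>\<A>. r A n \<omega>) \<partial>M)"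
      using Z_events by (intro nn_integral_add borel_measurable_sum) auto
    also have "(\<integral>\<^sup>+\<omega>. (\<Sum>A\<in>\<A>. r A n \<omega>) \<partial>M) = (\<Sum>A\<in>\<A>. \<integral>\<^sup>+\<omega>. r A n \<omega> \<partial>M)"
      by (rule nn_integral_sum) measurable
    finally show ?thesis using Z_events by (simp add: u_def emeasure_eq_measure)
  qed
  moreover have "u \<longlonglongrightarrow> ennreal (prob Z) + (\<Sum>A\<in>\<A>. 0)"
    unfolding u_def
  proof (intro tendsto_add tendsto_const tendsto_sum)
    fix A assume A: "A \<in> \<A>"
    have "(\<lambda>n. \<integral>\<^sup>+\<omega>. r A n \<omega> \<partial>M) \<longlonglongrightarrow> (\<integral>\<^sup>+\<omega>. 0 \<partial>M)"
    proof (rule nn_integral_dominated_convergence[where w = "\<lambda>_. 1"])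
      show "AE \<omega> in M. r A n \<omega> \<le> 1" for n
        using T_nonneg[OF A] by (intro AE_I2) (auto simp: r_def)
      show "AE \<omega> in M. (\<lambda>n. r A n \<omega>) \<longlonglongrightarrow> 0"
      proof (rule AE_I2)
        fix \<omega> assume \<omega>: "\<omega> \<in> space M"
        show "(\<lambda>n. r A n \<omega>) \<longlonglongrightarrow> 0"
        proof (cases "T A \<omega> = 0")
          case False
          then have pos: "0 < T A \<omega>" using T_nonneg[OF A \<omega>] by simp
          then have "(\<lambda>n::nat. exp (- real n * T A \<omega>)) \<longlonglongrightarrow> 0" by real_asymp
          then have "(\<lambda>n::nat. ennreal (exp (- real n * T A \<omega>))) \<longlonglongrightarrow> ennreal 0" by (rule tendsto_ennrealI)
          then show ?thesis using False by (simp add: r_def)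
        qed (simp add: r_def)
      qed
    qed (use A in \<open>auto simp: emeasure_space_1\<close>)
    then show "(\<lambda>n. \<integral>\<^sup>+\<omega>. r A n \<omega> \<partial>M) \<longlonglongrightarrow> 0" by simp
  qed
  ultimately show thesis using that[of u] by (simp add: Z_def)
qed

lemma prob_zero_link:
  assumes S: "finite S" and p: "p \<in> exits d S"
  shows "prob {\<omega> \<in> space M. \<exists>A\<in>link_sets d S p. \<forall>a\<in>A. \<tau> a \<omega> = 0}
    = zero_prob * bern (inner_edges d S) zero_prob (\<lambda>\<omega>. joined \<omega> origin (fst p))"
proof -
  let ?I = "inner_edges d S" and ?f = "{fst p, snd p}"
  define A where "A W \<longleftrightarrow> ?f \<in> W \<and> joined (W \<inter> ?I) origin (fst p)" for W
  have finI: "finite ?I" using S by (rule finite_inner_edges)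
  have f: "?f \<notin> ?I" "?f \<in> edges d" using p by (auto simp: exits_def inner_edges_def)
  have sub: "insert ?f ?I \<subseteq> edges d" using f inner_edges_subset by blast
  have ind: "indep_vars (\<lambda>_. count_space UNIV) (\<lambda>e \<omega>. \<tau> e \<omega> = 0) (insert ?f ?I)"
    using indep_vars_compose2[OF indep_vars_subset[OF indep sub], of "\<lambda>_ x. x = 0" "\<lambda>_. count_space UNIV"] by simp
  have "{\<omega> \<in> space M. \<exists>A\<in>link_sets d S p. \<forall>a\<in>A. \<tau> a \<omega> = 0}
      = {\<omega> \<in> space M. A {e \<in> insert ?f ?I. \<tau> e \<omega> = 0}}"
  proof (intro Collect_cong conj_cong refl iffI)
    fix \<omega> assume "\<exists>A\<in>link_sets d S p. \<forall>a\<in>A. \<tau> a \<omega> = 0"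
    then obtain B where B: "B \<subseteq> ?I" "joined B origin (fst p)" "\<forall>a\<in>insert ?f B. \<tau> a \<omega> = 0"
      by (auto simp: link_sets_def)
    have "B \<subseteq> {e \<in> insert ?f ?I. \<tau> e \<omega> = 0} \<inter> ?I" using B by auto
    then show "A {e \<in> insert ?f ?I. \<tau> e \<omega> = 0}"
      unfolding A_def using joined_mono[OF B(2)] B(3) by auto
  next
    fix \<omega> assume A: "A {e \<in> insert ?f ?I. \<tau> e \<omega> = 0}"
    let ?B = "{e \<in> insert ?f ?I. \<tau> e \<omega> = 0} \<inter> ?I"
    have "insert ?f ?B \<in> link_sets d S p" using A by (auto simp: A_def link_sets_def)
    moreover have "\<forall>a\<in>insert ?f ?B. \<tau> a \<omega> = 0" using A by (auto simp: A_def)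
    ultimately show "\<exists>A\<in>link_sets d S p. \<forall>a\<in>A. \<tau> a \<omega> = 0" by blast
  qed
  also have "prob \<dots> = bern (insert ?f ?I) zero_prob A"
    using finI sub by (intro prob_configuration(2)[OF _ ind]) (auto intro!: prob_weight_zero)
  also have "\<dots> = bern ({?f} \<union> ?I) zero_prob (\<lambda>W. ?f \<in> W \<inter> {?f} \<and> joined (W \<inter> ?I) origin (fst p))"
    by (intro arg_cong2[where f = "\<lambda>E. bern E zero_prob"]) (auto simp: A_def fun_eq_iff)
  also have "\<dots> = bern {?f} zero_prob (\<lambda>W. ?f \<in> W) * bern ?I zero_prob (\<lambda>\<omega>. joined \<omega> origin (fst p))"
    using finI f(1) by (intro bern_product) auto
  also have "bern {?f} zero_prob (\<lambda>W. ?f \<in> W) = zero_prob"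
  proof -
    have "{\<omega>. \<omega> \<subseteq> {?f} \<and> ?f \<in> \<omega>} = {{?f}}" by auto
    then show ?thesis by (simp add: bern_def)
  qed
  finally show ?thesis .
qed

lemma link_weight_less_1:
  assumes S: "finite S" and phi: "dct_phi d zero_prob S < 1"
  obtains l where "0 \<le> l" "link_weight l S < 1"
proof -
  have fin: "finite (exits d S)" by (rule finite_exits[OF S d_pos])
  have "\<exists>u. (\<forall>n::nat. esup (real n) (link_sets d S p) \<le> u n) \<and>
      u \<longlonglongrightarrow> ennreal (zero_prob * bern (inner_edges d S) zero_prob (\<lambda>\<omega>. joined \<omega> origin (fst p)))"
    if p: "p \<in> exits d S" for p
  proof -
    have fin_p: "finite (insert {fst p, snd p} (inner_edges d S))" using finite_inner_edges[OF S] by simp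
    have "A \<subseteq> edges d \<and> finite A" if "A \<in> link_sets d S p" for A
      using order_trans[OF link_sets_subset(1)[OF p that] link_sets_subset(2)[OF p]]
        finite_subset[OF link_sets_subset(1)[OF p that] fin_p] by simp
    then obtain u where "\<And>n::nat. esup (real n) (link_sets d S p) \<le> u n"
      and "u \<longlonglongrightarrow> ennreal (prob {\<omega> \<in> space M. \<exists>A\<in>link_sets d S p. \<forall>a\<in>A. \<tau> a \<omega> = 0})"
      using esup_limit[OF finite_link_sets[OF S], of p] by (metis (no_types, lifting))
    then show ?thesis unfolding prob_zero_link[OF S p] by (intro exI[of _ u] conjI allI)
  qed
  then obtain u where u: "\<And>p n. p \<in> exits d S \<Longrightarrow> esup (real n) (link_sets d S p) \<le> u p n"
    "\<And>p. p \<in> exits d S \<Longrightarrow> u p \<longlonglongrightarrow>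
      ennreal (zero_prob * bern (inner_edges d S) zero_prob (\<lambda>\<omega>. joined \<omega> origin (fst p)))"
    by metis
  have z01: "0 \<le> zero_prob" "zero_prob \<le> 1" by (simp_all add: zero_prob_def)
  have "(\<lambda>n. \<Sum>p\<in>exits d S. u p n) \<longlonglongrightarrow>
      (\<Sum>p\<in>exits d S. ennreal (zero_prob * bern (inner_edges d S) zero_prob (\<lambda>\<omega>. joined \<omega> origin (fst p))))"
    by (intro tendsto_sum u(2))
  also have "(\<Sum>p\<in>exits d S. ennreal (zero_prob * bern (inner_edges d S) zero_prob (\<lambda>\<omega>. joined \<omega> origin (fst p))))
      = ennreal (dct_phi d zero_prob S)"
    using z01 by (subst sum_ennreal) (auto simp: dct_phi_def sum_distrib_left case_prod_unfold intro!: mult_nonneg_nonneg bern_nonneg)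
  finally have "\<forall>\<^sub>F n in sequentially. (\<Sum>p\<in>exits d S. u p n) < 1"
    by (rule order_tendstoD) (use phi in \<open>simp add: ennreal_less_one_iff\<close>)
  then obtain n where n: "(\<Sum>p\<in>exits d S. u p n) < 1" by (auto simp: eventually_sequentially)
  have "link_weight (real n) S \<le> (\<Sum>p\<in>exits d S. u p n)"
    unfolding link_weight_def by (intro sum_mono u(1))
  then show thesis using n that[of "real n"] by simp
qed

text \<open>
  Markov's inequality for \<open>exp (- l T)\<close>. The measurable event \<open>V\<close> says that some
  set of edges reaching far has damped weight at least \<open>exp (- l s)\<close>.
\<close>

theorem linear_growth:
  assumes "zero_prob < critical_prob d"
  shows "\<exists>l L \<rho>. 0 \<le> l \<and> 0 < L \<and> 0 \<le> \<rho> \<and> \<rho> < 1 \<and>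
    (\<forall>m s. \<exists>V\<in>events. prob V \<le> exp (l * s) * \<rho> ^ m \<and>
      {\<omega> \<in> space M. \<exists>z \<gamma>. is_path d origin z \<gamma> \<and> int (m * L) \<le> supdist d origin z
        \<and> path_time (\<lambda>e. \<tau> e \<omega>) \<gamma> \<le> s} \<subseteq> V)"
proof -
  have "0 \<le> zero_prob" by (simp add: zero_prob_def)
  then obtain S where S: "finite S" "S \<subseteq> lattice d" "origin \<in> S" "dct_phi d zero_prob S < 1"
    using dct_phi_less_1_if_subcritical[OF d_pos _ assms] by metis
  obtain l where l: "0 \<le> l" "link_weight l S < 1" by (rule link_weight_less_1[OF S(1,4)])
  define \<rho> where "\<rho> = enn2real (link_weight l S)"
  have \<rho>: "link_weight l S = ennreal \<rho>" "0 \<le> \<rho>" "\<rho> < 1"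
  proof -
    show "link_weight l S = ennreal \<rho>" unfolding \<rho>_def
      by (rule ennreal_enn2real[symmetric]) (rule order_less_trans[OF l(2)], simp)
    then have "ennreal \<rho> < 1" using l(2) by simp
    then show "\<rho> < 1" by (simp only: ennreal_less_one_iff)
  qed (simp add: \<rho>_def)
  define L where "L = nat (Max (supdist d origin ` S)) + 1"
  have L: "S \<subseteq> cube d origin (int L - 1)"
  proof
    fix x assume x: "x \<in> S"
    then have "supdist d origin x \<le> Max (supdist d origin ` S)" using S(1) by (intro Max_ge) auto
    then show "x \<in> cube d origin (int L - 1)" using x S(2) by (auto simp: cube_def L_def)
  qed
  have main: "\<exists>V\<in>events. prob V \<le> exp (l * s) * \<rho> ^ m \<and>
      {\<omega> \<in> space M. \<exists>z \<gamma>. is_path d origin z \<gamma> \<and> int (m * L) \<le> supdist d origin z \<and> path_time (\<lambda>e. \<tau> e \<omega>) \<gamma> \<le> s} \<subseteq> V"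
    for m s
  proof -
    define F where "F = inner_edges d (cube d origin (int (m * L)))"
    define \<A> where "\<A> = far_sets d F origin (int (m * L))"
    define X where "X \<omega> = (SUP A\<in>\<A>. \<Prod>a\<in>A. damp l (\<tau> a \<omega>))" for \<omega>
    define V where "V = {\<omega> \<in> space M. 1 \<le> ennreal (exp (l * s)) * X \<omega>}"
    have F: "finite F" "F \<subseteq> edges d"
      unfolding F_def using finite_inner_edges[OF finite_cube[OF d_pos]] inner_edges_subset by auto
    have \<A>_sub: "A \<subseteq> F" if "A \<in> \<A>" for A using that by (simp add: \<A>_def far_sets_def)
    have "finite \<A>" by (rule finite_subset[of _ "Pow F"]) (use \<A>_sub F in auto)
    then have X_meas [measurable]: "X \<in> borel_measurable M" unfolding X_def
      using \<A>_sub F weight_measurable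
      by (intro borel_measurable_SUP countable_finite borel_measurable_prod_ennreal
          measurable_compose[OF _ damp_measurable]) auto
    have "emeasure M V \<le> ennreal (exp (l * s)) * (\<integral>\<^sup>+\<omega>. X \<omega> * indicator (space M) \<omega> \<partial>M)"
      unfolding V_def by (rule nn_integral_Markov_inequality) auto
    also have "(\<integral>\<^sup>+\<omega>. X \<omega> * indicator (space M) \<omega> \<partial>M) = esup l \<A>"
      unfolding esup_def X_def by (intro nn_integral_cong) simp
    also have "esup l \<A> \<le> link_weight l S ^ m"
      unfolding \<A>_def by (rule esup_far_sets[OF S(1-3) L l(1) F]) simp
    also have "ennreal (exp (l * s)) * link_weight l S ^ m = ennreal (exp (l * s) * \<rho> ^ m)"
      using \<rho> by (simp add: ennreal_power ennreal_mult)
    finally have "ennreal (prob V) \<le> ennreal (exp (l * s) * \<rho> ^ m)"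
      by (simp add: emeasure_eq_measure mult_left_mono)
    then have "prob V \<le> exp (l * s) * \<rho> ^ m" using \<rho>(2) by (simp add: ennreal_le_iff)
    moreover have "V \<in> events" unfolding V_def by measurable
    moreover have "{\<omega> \<in> space M. \<exists>z \<gamma>. is_path d origin z \<gamma> \<and> int (m * L) \<le> supdist d origin z
        \<and> path_time (\<lambda>e. \<tau> e \<omega>) \<gamma> \<le> s} \<subseteq> V"
    proof safe
      fix \<omega> z \<gamma> assume \<omega>: "\<omega> \<in> space M" and \<gamma>: "is_path d origin z \<gamma>" "int (m * L) \<le> supdist d origin z"
        "path_time (\<lambda>e. \<tau> e \<omega>) \<gamma> \<le> s"
      have nonneg: "0 \<le> \<tau> e \<omega>" if "e \<in> edges d" for e using weight_nonneg[OF that \<omega>] .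
      obtain \<delta> u where \<delta>: "is_path d origin u \<delta>" "supdist d origin u = int (m * L)" "set \<delta> \<subseteq> cube d origin (int (m * L))"
        "path_time (\<lambda>e. \<tau> e \<omega>) \<delta> \<le> path_time (\<lambda>e. \<tau> e \<omega>) \<gamma>"
        using path_reaches_shell[OF d_pos \<gamma>(1) _ \<gamma>(2)] nonneg by (metis of_nat_0_le_iff)
      let ?A = "set (path_edges \<delta>)"
      have "?A \<subseteq> F" unfolding F_def by (rule path_edges_in_inner_edges[OF \<delta>(1,3)])
      moreover have "joined ?A origin u" using joined_if_path[of \<delta> ?A] \<delta>(1) by (auto simp: is_path_def)
      ultimately have A: "?A \<in> \<A>" using \<delta>(2) by (auto simp: \<A>_def far_sets_def)
      have "(\<Sum>a\<in>?A. \<tau> a \<omega>) \<le> s"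
        using sum_set_le_path_time[of d "\<lambda>e. \<tau> e \<omega>" \<delta>] nonneg \<delta>(1,4) \<gamma>(3) by (auto simp: is_path_def)
      then have "l * (\<Sum>a\<in>?A. \<tau> a \<omega>) \<le> l * s" using l(1) by (rule mult_left_mono)
      then have "1 \<le> ennreal (exp (l * s)) * (\<Prod>a\<in>?A. damp l (\<tau> a \<omega>))"
        using \<open>?A \<subseteq> F\<close> F(2) by (subst prod_damp[OF \<omega>]) (auto simp: ennreal_mult[symmetric] exp_add[symmetric])
      also have "\<dots> \<le> ennreal (exp (l * s)) * X \<omega>"
        unfolding X_def by (intro mult_left_mono SUP_upper A) simp
      finally show "\<omega> \<in> V" using \<omega> by (simp add: V_def)
    qed
    ultimately show ?thesis by blast
  qed
  have "0 < L" by (simp add: L_def)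
  then show ?thesis
    by (intro exI[of _ l] exI[of _ L] exI[of _ \<rho>] conjI allI l(1) \<rho>(2,3) main)
qed

end

section \<open>Detours inside spheres\<close>

definition raise :: "nat \<Rightarrow> int \<Rightarrow> vertex \<Rightarrow> vertex" where
  "raise l c u = u(l := u l + c)"

lemma raise_lattice [simp]: "l < d \<Longrightarrow> raise l c u \<in> lattice d \<longleftrightarrow> u \<in> lattice d"
  by (auto simp: raise_def lattice_def)

lemma adjacent_raise:
  assumes "l < d" "u \<in> lattice d" "\<bar>c\<bar> = 1"
  shows "adjacent d u (raise l c u)"
proof -
  have "(\<Sum>i<d. \<bar>u i - raise l c u i\<bar>) = (\<Sum>i<d. if i = l then 1 else 0)"
    using assms(3) by (intro sum.cong) (auto simp: raise_def)
  also have "\<dots> = 1" using assms(1) by simp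
  finally show ?thesis using assms by (simp add: adjacent_def)
qed

lemma raise_eq_iff [simp]: "raise l c u = raise l' c' u \<longleftrightarrow> (c = 0 \<and> c' = 0) \<or> (l = l' \<and> c = c')"
  by (auto simp: raise_def fun_eq_iff split: if_splits)

text \<open>
  The direction in which coordinate \<open>l\<close> can change without leaving the cube about \<open>x\<close>.
\<close>

definition inward :: "vertex \<Rightarrow> vertex \<Rightarrow> nat \<Rightarrow> int" where
  "inward x u l = (if u l > x l then -1 else 1)"

text \<open>
  For \<open>l = j\<close> the step from \<open>u\<close> in direction \<open>j\<close> itself, and otherwise the way around it through the
  neighbouring line in direction \<open>l\<close>.
\<close>

definition detour :: "vertex \<Rightarrow> nat \<Rightarrow> vertex \<Rightarrow> nat \<Rightarrow> edge set" where
  "detour x j u l = (if l = j then {{u, raise j 1 u}}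
    else {{u, raise l (inward x u l) u},
      {raise l (inward x u l) u, raise l (inward x u l) (raise j 1 u)},
      {raise l (inward x u l) (raise j 1 u), raise j 1 u}})"

text \<open>
  A triple \<open>(i, j, u)\<close> is a step from \<open>u\<close> in direction \<open>j\<close> along a face on which coordinate \<open>i\<close> is
  extremal. The detours in all directions other than \<open>i\<close> then stay on this face.
\<close>

definition face_steps :: "nat \<Rightarrow> vertex \<Rightarrow> nat \<Rightarrow> (nat \<times> nat \<times> vertex) set" where
  "face_steps d x k = {(i, j, u). i < d \<and> j < d \<and> i \<noteq> j \<and> u \<in> shell d x (int k)
      \<and> raise j 1 u \<in> shell d x (int k) \<and> \<bar>u i - x i\<bar> = int k}"

lemma finite_face_steps:
  assumes "d > 0"
  shows "finite (face_steps d x k)" "card (face_steps d x k) \<le> d * d * card (shell d x (int k))"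
proof -
  have sub: "face_steps d x k \<subseteq> {..<d} \<times> {..<d} \<times> shell d x (int k)" by (auto simp: face_steps_def)
  moreover have fin: "finite ({..<d} \<times> {..<d} \<times> shell d x (int k))"
    using finite_shell[OF assms] by simp
  ultimately show "finite (face_steps d x k)" by (rule finite_subset)
  show "card (face_steps d x k) \<le> d * d * card (shell d x (int k))"
    using card_mono[OF fin sub] by (simp add: card_cartesian_product)
qed

lemma in_shell_if:
  assumes "d > 0" "z \<in> lattice d" "i < d" "\<bar>z i - x i\<bar> = k" "\<And>j. j < d \<Longrightarrow> \<bar>z j - x j\<bar> \<le> k"
  shows "z \<in> shell d x k"
proof -
  have "supdist d x z \<le> k" using assms by (simp add: supdist_le_iff)
  moreover have "k \<le> supdist d x z" using coordinate_le_supdist[OF assms(3), of z x] assms(4) by simp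
  ultimately show ?thesis using assms(2) by (simp add: shell_def)
qed

lemma shell_coordinate: "z \<in> shell d x k \<Longrightarrow> i < d \<Longrightarrow> \<bar>z i - x i\<bar> \<le> k"
  using coordinate_le_supdist[of i d z x] by (simp add: shell_def)

lemma card_detour: "finite (detour x j u l) \<and> card (detour x j u l) \<le> 3"
  by (auto simp: detour_def card_insert_if)

lemma joined_detour: "joined (detour x j u l) u (raise j 1 u)"
proof (cases "l = j")
  case False
  let ?v = "raise l (inward x u l) u" and ?w = "raise l (inward x u l) (raise j 1 u)"
  have "joined (detour x j u l) u ?v" "joined (detour x j u l) ?v ?w" "joined (detour x j u l) ?w (raise j 1 u)"
    using False by (intro joined_edge; simp add: detour_def)+
  then show ?thesis using joined_trans by blast
qed (simp add: detour_def joined_edge)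

lemma raise_commute: "l \<noteq> j \<Longrightarrow> raise l c (raise j c' u) = raise j c' (raise l c u)"
  by (auto simp: raise_def fun_eq_iff)

lemma detour_disjoint:
  assumes "l \<noteq> l'"
  shows "detour x j u l \<inter> detour x j u l' = {}"
proof -
  have sep: "e \<notin> detour x j u l'" if e: "e \<in> detour x j u l" and "l \<noteq> l'" "l \<noteq> j" for e l l'
  proof -
    let ?c = "inward x u l" and ?c' = "inward x u l'"
    have "?c \<noteq> 0" "?c' \<noteq> 0" by (auto simp: inward_def)
    \<comment> \<open>Every edge of a detour in direction \<open>l\<close> has an endpoint whose coordinate \<open>l\<close> was changed.\<close>
    have "\<exists>v\<in>e. v l \<noteq> u l" using e \<open>l \<noteq> j\<close> \<open>?c \<noteq> 0\<close> by (auto simp: detour_def raise_def)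
    moreover have "v l = u l" if "f \<in> detour x j u l'" "v \<in> f" for f v
      using that \<open>l \<noteq> l'\<close> \<open>l \<noteq> j\<close> by (auto simp: detour_def raise_def split: if_splits)
    ultimately show ?thesis by blast
  qed
  show ?thesis
  proof (cases "l = j")
    case True
    then have "l' \<noteq> l" "l' \<noteq> j" using assms by simp_all
    then show ?thesis using sep[of _ l' l] unfolding disjoint_iff by metis
  next
    case False
    then show ?thesis using sep[of _ l l'] assms unfolding disjoint_iff by metis
  qed
qed

lemma detour_in_shell:
  assumes "(i, j, u) \<in> face_steps d x k" "k \<ge> 1" "l < d" "l \<noteq> i"
  shows "detour x j u l \<subseteq> inner_edges d (shell d x (int k))"
proof -
  have s: "i < d" "j < d" "i \<noteq> j" "u \<in> shell d x (int k)" "raise j 1 u \<in> shell d x (int k)" "\<bar>u i - x i\<bar> = int k"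
    using assms(1) by (auto simp: face_steps_def)
  have lat: "u \<in> lattice d" "raise j 1 u \<in> lattice d" using s by (auto simp: shell_def)
  show ?thesis
  proof (cases "l = j")
    case True
    then show ?thesis using s adjacent_raise[OF s(2) lat(1), of 1]
      by (simp add: detour_def edge_in_inner_edges_iff)
  next
    case False
    let ?c = "inward x u l"
    have c: "\<bar>?c\<bar> = 1" by (simp add: inward_def)
    have "\<bar>u l + ?c - x l\<bar> \<le> int k"
      using shell_coordinate[OF s(4) assms(3)] assms(2) by (auto simp: inward_def)
    then have in_shell: "raise l ?c v \<in> shell d x (int k)"
      if "v \<in> shell d x (int k)" "v l = u l" "v i = u i" for v
    proof -
      have d: "d > 0" using s(1) by simp
      have vl: "v \<in> lattice d" using that(1) by (simp add: shell_def)
      show ?thesis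
      proof (rule in_shell_if[OF d _ s(1)])
        show "raise l ?c v \<in> lattice d" using vl assms(3) by simp
        show "\<bar>raise l ?c v i - x i\<bar> = int k" using assms(4) s(6) that(3) by (simp add: raise_def)
        show "\<bar>raise l ?c v a - x a\<bar> \<le> int k" if "a < d" for a
          using shell_coordinate[OF \<open>v \<in> shell d x (int k)\<close> that] \<open>\<bar>u l + ?c - x l\<bar> \<le> int k\<close> \<open>v l = u l\<close>
          by (simp add: raise_def)
      qed
    qed
    have in1: "raise l ?c u \<in> shell d x (int k)" by (rule in_shell) (use s in auto)
    have in2: "raise l ?c (raise j 1 u) \<in> shell d x (int k)"
      by (rule in_shell) (use s False in \<open>auto simp: raise_def\<close>)
    have "adjacent d u (raise l ?c u)" by (rule adjacent_raise[OF assms(3) lat(1) c])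
    moreover have "adjacent d (raise l ?c (raise j 1 u)) (raise j 1 u)"
      using adjacent_raise[OF assms(3) lat(2) c] adjacent_sym by blast
    moreover have "adjacent d (raise l ?c u) (raise l ?c (raise j 1 u))"
      unfolding raise_commute[OF False]
      by (rule adjacent_raise[OF s(2)]) (use lat assms(3) in simp_all)
    ultimately show ?thesis using False s in1 in2
      by (simp add: detour_def edge_in_inner_edges_iff)
  qed
qed

definition hub :: "nat \<Rightarrow> vertex \<Rightarrow> nat \<Rightarrow> vertex" where
  "hub d x k = (\<lambda>i. if i < d then x i + int k else 0)"

text \<open>
  Some step of the sphere has a weight above \<open>s\<close> on each of its \<open>d - 1\<close> local realizations.
\<close>

definition blocked :: "nat \<Rightarrow> vertex \<Rightarrow> nat \<Rightarrow> real \<Rightarrow> (edge \<Rightarrow> real) \<Rightarrow> bool" where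
  "blocked d x k s t \<longleftrightarrow> (\<exists>(i, j, u)\<in>face_steps d x k. \<forall>l\<in>{..<d} - {i}. \<exists>e\<in>detour x j u l. s < t e)"

text \<open>
  If some coordinate has reached its maximum, it stays fixed and another one is raised; otherwise
  some coordinate is at its minimum, and any other one may be raised.
\<close>

lemma face_step_towards_hub:
  assumes "d \<ge> 2" "u \<in> shell d x (int k)" "u \<noteq> hub d x k"
  obtains i j where "(i, j, u) \<in> face_steps d x k"
proof -
  have d: "d > 0" using assms(1) by simp
  have lat: "u \<in> lattice d" using assms(2) by (simp add: shell_def)
  have le: "\<bar>u j - x j\<bar> \<le> int k" if "j < d" for j using shell_coordinate[OF assms(2) that] .
  have raise_in: "(i, j, u) \<in> face_steps d x k"
    if "i < d" "j < d" "i \<noteq> j" "\<bar>u i - x i\<bar> = int k" "u j - x j < int k" for i j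
  proof -
    have "\<bar>raise j 1 u a - x a\<bar> \<le> int k" if "a < d" for a
      using le[OF that] \<open>u j - x j < int k\<close> by (auto simp: raise_def)
    then have "raise j 1 u \<in> shell d x (int k)"
      using that lat raise_lattice[of j d 1 u]
      by (intro in_shell_if[OF d _ that(1)]) (simp_all add: raise_def)
    then show ?thesis using that assms(2) by (simp add: face_steps_def)
  qed
  show thesis
  proof (cases "\<exists>i<d. u i - x i = int k")
    case True
    then obtain i where i: "i < d" "u i - x i = int k" by blast
    obtain j where j: "u j \<noteq> hub d x k j" using assms(3) by (auto simp: fun_eq_iff)
    have "j < d" using j lat by (cases "j < d") (auto simp: hub_def lattice_def)
    then have "u j - x j < int k" using j le[of j] by (auto simp: hub_def)
    then show ?thesis using that raise_in[of i j] i \<open>j < d\<close> by force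
  next
    case False
    obtain i where i: "i < d" "\<bar>u i - x i\<bar> = int k"
      using supdist_attained[OF d, of u x] assms(2) by (auto simp: shell_def)
    define j where "j = (if i = 0 then 1 else 0 :: nat)"
    have "j < d" "i \<noteq> j" using assms(1) by (auto simp: j_def)
    moreover have "u j - x j < int k" using False le[OF \<open>j < d\<close>] \<open>j < d\<close> by force
    ultimately show ?thesis using that raise_in i by blast
  qed
qed

text \<open>
  The set \<open>F\<close> consists of all local realizations of the steps of one monotone path to the hub. It is
  chosen before the weights are known, and its size is linear in \<open>k\<close>; only the path inside it
  depends on the weights.
\<close>

lemma route_exists:
  assumes "d \<ge> 2" "k \<ge> 1" "u \<in> shell d x (int k)"
  shows "\<exists>F \<subseteq> inner_edges d (shell d x (int k)). finite F \<and> card F \<le> 6 * d * d * k \<and>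
    (\<forall>s t. \<not> blocked d x k s t \<longrightarrow> joined {e \<in> F. t e \<le> s} u (hub d x k))"
proof -
  let ?I = "inner_edges d (shell d x (int k))"
  define height where "height v = (\<Sum>i<d. nat (int k - (v i - x i)))" for v
  have "\<exists>F \<subseteq> ?I. finite F \<and> card F \<le> 3 * d * height u \<and>
    (\<forall>s t. \<not> blocked d x k s t \<longrightarrow> joined {e \<in> F. t e \<le> s} u (hub d x k))"
    using assms(3)
  proof (induction "height u" arbitrary: u rule: less_induct)
    case less
    show ?case
    proof (cases "u = hub d x k")
      case True
      then show ?thesis by (intro exI[of _ "{}"]) simp
    next
      case False
      obtain i j where step: "(i, j, u) \<in> face_steps d x k"
        by (rule face_step_towards_hub[OF assms(1) less.prems False])
      let ?v = "raise j 1 u"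
      have s: "i < d" "j < d" "i \<noteq> j" "?v \<in> shell d x (int k)" using step by (auto simp: face_steps_def)
      have "u j - x j < int k" using shell_coordinate[OF s(4,2)] by (simp add: raise_def)
      then have "nat (int k - (u j - x j)) = Suc (nat (int k - (?v j - x j)))" by (simp add: raise_def)
      moreover have "(\<Sum>a\<in>{..<d} - {j}. nat (int k - (u a - x a))) = (\<Sum>a\<in>{..<d} - {j}. nat (int k - (?v a - x a)))"
        by (intro sum.cong) (auto simp: raise_def)
      ultimately have height: "height u = Suc (height ?v)"
        unfolding height_def using s(2) by (simp add: sum.remove[of "{..<d}" j])
      then obtain F where F: "F \<subseteq> ?I" "finite F" "card F \<le> 3 * d * height ?v"
        "\<And>s t. \<not> blocked d x k s t \<Longrightarrow> joined {e \<in> F. t e \<le> s} ?v (hub d x k)"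
        using less.hyps[of ?v] s(4) by auto
      define D where "D = (\<Union>l\<in>{..<d} - {i}. detour x j u l)"
      have D: "D \<subseteq> ?I" "finite D" "card D \<le> 3 * d"
      proof -
        show "D \<subseteq> ?I" using detour_in_shell[OF step assms(2)] by (auto simp: D_def)
        show "finite D" using card_detour by (auto simp: D_def)
        have "card D \<le> (\<Sum>l\<in>{..<d} - {i}. card (detour x j u l))"
          unfolding D_def by (rule card_UN_le) simp
        also have "\<dots> \<le> (\<Sum>l\<in>{..<d} - {i}. 3)" using card_detour by (intro sum_mono) auto
        also have "\<dots> \<le> 3 * d" using s(1) by (simp add: card_Diff_singleton)
        finally show "card D \<le> 3 * d" .
      qed
      show ?thesis
      proof (intro exI[of _ "D \<union> F"] conjI allI impI)
        show "card (D \<union> F) \<le> 3 * d * height u"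
          using card_Un_le[of D F] D(3) F(3) height by simp
        fix s t assume nb: "\<not> blocked d x k s t"
        then obtain l where l: "l \<in> {..<d} - {i}" "\<forall>e\<in>detour x j u l. t e \<le> s"
          using step unfolding blocked_def by (force simp: not_less)
        have "detour x j u l \<subseteq> {e \<in> D \<union> F. t e \<le> s}" using l by (auto simp: D_def)
        then have "joined {e \<in> D \<union> F. t e \<le> s} u ?v" by (rule joined_mono[OF joined_detour])
        moreover have "joined {e \<in> D \<union> F. t e \<le> s} ?v (hub d x k)"
          by (rule joined_mono[OF F(4)[OF nb]]) auto
        ultimately show "joined {e \<in> D \<union> F. t e \<le> s} u (hub d x k)" by (rule joined_trans)
      qed (use D F in auto)
    qed
  qed
  moreover have "3 * d * height u \<le> 6 * d * d * k"
  proof -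
    have "nat (int k - (u i - x i)) \<le> 2 * k" if "i < d" for i
      using shell_coordinate[OF assms(3) that] by linarith
    then have "height u \<le> (\<Sum>i<d. 2 * k)" unfolding height_def by (intro sum_mono) auto
    then have "height u \<le> 2 * d * k" by simp
    then have "3 * d * height u \<le> 3 * d * (2 * d * k)" by (rule mult_le_mono2)
    then show ?thesis by simp
  qed
  ultimately show ?thesis by (meson order_trans)
qed

definition route :: "nat \<Rightarrow> vertex \<Rightarrow> nat \<Rightarrow> vertex \<Rightarrow> edge set" where
  "route d x k u = (SOME F. F \<subseteq> inner_edges d (shell d x (int k)) \<and> finite F \<and> card F \<le> 6 * d * d * k \<and>
    (\<forall>s t. \<not> blocked d x k s t \<longrightarrow> joined {e \<in> F. t e \<le> s} u (hub d x k)))"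

lemma route:
  assumes "d \<ge> 2" "k \<ge> 1" "u \<in> shell d x (int k)"
  shows "route d x k u \<subseteq> inner_edges d (shell d x (int k))" "finite (route d x k u)"
    "card (route d x k u) \<le> 6 * d * d * k"
    "\<not> blocked d x k s t \<Longrightarrow> joined {e \<in> route d x k u. t e \<le> s} u (hub d x k)"
  using someI_ex[OF route_exists[OF assms]] unfolding route_def by blast+

text \<open>
  A condition on the edges of the sphere alone that holds whenever some point of the sphere cannot
  be joined to the hub within time \<open>m\<close> (\<open>fast_path_to_hub\<close>). It consists of two events whose
  probabilities can be estimated.
\<close>

definition slow_shell :: "nat \<Rightarrow> vertex \<Rightarrow> nat \<Rightarrow> real \<Rightarrow> real \<Rightarrow> (edge \<Rightarrow> real) \<Rightarrow> bool" where
  "slow_shell d x k s m t \<longleftrightarrow> blocked d x k s t \<or>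
    (\<exists>u\<in>shell d x (int k). m < (\<Sum>e\<in>route d x k u. if t e \<le> s then t e else 0))"

lemma fast_path_to_hub:
  assumes "d \<ge> 2" "k \<ge> 1" "u \<in> shell d x (int k)" "\<not> slow_shell d x k s m t"
    and nonneg: "\<And>e. e \<in> edges d \<Longrightarrow> 0 \<le> t e"
  obtains \<pi> where "is_path d u (hub d x k) \<pi>" "path_time t \<pi> \<le> m"
proof -
  let ?F = "route d x k u"
  note r = route[OF assms(1-3)]
  have nb: "\<not> blocked d x k s t" and le: "(\<Sum>e\<in>?F. if t e \<le> s then t e else 0) \<le> m"
    using assms(3,4) by (auto simp: slow_shell_def not_less)
  have "u \<in> lattice d" using assms(3) by (simp add: shell_def)
  moreover have F: "?F \<subseteq> edges d" using r(1) inner_edges_subset by blast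
  ultimately obtain \<pi> where \<pi>: "is_path d u (hub d x k) \<pi>" "set (path_edges \<pi>) \<subseteq> {e \<in> ?F. t e \<le> s}" "distinct \<pi>"
    using distinct_path_if_joined[OF r(4)[OF nb], where d = d] by blast
  have "path_time t \<pi> = (\<Sum>e\<in>set (path_edges \<pi>). t e)" by (rule path_time_distinct[OF \<pi>(3)])
  also have "\<dots> = (\<Sum>e\<in>set (path_edges \<pi>). if t e \<le> s then t e else 0)" using \<pi>(2) by (intro sum.cong) auto
  also have "\<dots> \<le> (\<Sum>e\<in>?F. if t e \<le> s then t e else 0)"
    using r(2) \<pi>(2) F nonneg by (intro sum_mono2) auto
  finally show thesis using that[OF \<pi>(1)] le by simp
qed

lemma passage_time_le:
  assumes "\<And>e. e \<in> edges d \<Longrightarrow> 0 \<le> t e" "is_path d v w \<gamma>"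
  shows "passage_time d t v w \<le> path_time t \<gamma>"
  unfolding passage_time_def
proof (rule cINF_lower)
  show "bdd_below (path_time t ` {\<gamma>. is_path d v w \<gamma>})"
    using path_time_nonneg[of d t] assms(1) by (intro bdd_belowI2[of _ 0]) (auto simp: is_path_def)
qed (use assms in simp)

text \<open>
  Two visits \<open>u\<close> and \<open>z\<close> of the sphere, before and after the edge, would otherwise be joined through
  the hub in time \<open>2 m\<close>, which is less than the weight of the edge.
\<close>

lemma shells_slow_around_heavy_edge:
  assumes "d \<ge> 2" and nonneg: "\<And>e. e \<in> edges d \<Longrightarrow> 0 \<le> t e"
    and \<gamma>: "\<gamma> \<in> optimal_paths d t v w" "\<gamma> = \<alpha> @ x # y # \<beta>" and heavy: "2 * m < t {x, y}"
    and k: "1 \<le> k" "int k \<le> supdist d x v" "int k \<le> supdist d x w"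
  shows "slow_shell d x k s m t"
proof (rule ccontr)
  assume fast: "\<not> slow_shell d x k s m t"
  have d: "d > 0" using assms(1) by simp
  have path: "is_path d v w \<gamma>" and opt: "path_time t \<gamma> = passage_time d t v w"
    using \<gamma>(1) by (auto simp: optimal_paths_def)
  have succ: "successively (adjacent d) (\<alpha> @ x # y # \<beta>)" "hd (\<alpha> @ [x]) = v" "last (y # \<beta>) = w"
    "set \<gamma> \<subseteq> lattice d"
    using path \<gamma>(2) by (auto simp: is_path_def hd_append split: if_splits)
  have step: "\<bar>supdist d x b - supdist d x a\<bar> \<le> 1" if "adjacent d a b" for a b
    using supdist_step[OF that d] .
  have succ1: "successively (adjacent d) (\<alpha> @ [x])" "successively (adjacent d) (y # \<beta>)" "adjacent d x y"
    using succ(1) by (auto simp: successively_append_iff successively_Cons)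
  obtain \<alpha>' u \<beta>' where u: "rev (\<alpha> @ [x]) = \<alpha>' @ u # \<beta>'" "supdist d x u = int k"
  proof (rule path_hits_level[of d "supdist d x" "rev (\<alpha> @ [x])" "int k", OF step])
    show "successively (adjacent d) (rev (\<alpha> @ [x]))"
      using succ1(1) unfolding successively_rev by (simp add: adjacent_sym)
    show "supdist d x (hd (rev (\<alpha> @ [x]))) \<le> int k" using supdist_self[OF d, of x] by simp
    show "int k \<le> supdist d x (last (rev (\<alpha> @ [x])))" using k(2) succ(2) by (metis last_rev)
  qed auto
  obtain \<eta> z \<zeta> where z: "y # \<beta> = \<eta> @ z # \<zeta>" "supdist d x z = int k"
  proof (rule path_hits_level[of d "supdist d x" "y # \<beta>" "int k", OF step])
    show "supdist d x (hd (y # \<beta>)) \<le> int k" using supdist_adjacent[OF succ1(3) d] k(1) by simp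
    show "int k \<le> supdist d x (last (y # \<beta>))" using k(3) succ(3) by simp
  qed (use succ1 in auto)
  define \<sigma> where "\<sigma> = rev \<alpha>'"
  have \<alpha>x: "\<alpha> @ [x] = rev \<beta>' @ u # \<sigma>" using arg_cong[OF u(1), of rev] by (simp add: \<sigma>_def)
  have eq: "\<gamma> = rev \<beta>' @ u # (\<sigma> @ \<eta> @ z # \<zeta>)"
    using \<gamma>(2) \<alpha>x z(1) by (metis append_Cons append_Nil append_assoc)
  have lat: "u \<in> lattice d" "z \<in> lattice d" using succ(4) unfolding eq by auto
  have shell: "u \<in> shell d x (int k)" "z \<in> shell d x (int k)" using u(2) z(2) lat by (auto simp: shell_def)
  \<comment> \<open>Replace the part of the path between the two visits of the shell.\<close>
  obtain \<pi>1 where \<pi>1: "is_path d u (hub d x k) \<pi>1" "path_time t \<pi>1 \<le> m"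
    by (rule fast_path_to_hub[OF assms(1) k(1) shell(1) fast nonneg])
  obtain \<pi>2 where \<pi>2: "is_path d z (hub d x k) \<pi>2" "path_time t \<pi>2 \<le> m"
    by (rule fast_path_to_hub[OF assms(1) k(1) shell(2) fast nonneg])
  have start: "is_path d v u (rev \<beta>' @ [u])"
    using path unfolding eq is_path_def
    by (auto simp: successively_append_iff successively_Cons hd_append split: if_splits)
  have stop: "is_path d z w (z # \<zeta>)"
    using path unfolding eq is_path_def
    by (auto simp: successively_append_iff successively_Cons hd_append split: if_splits)
  define \<pi> where "\<pi> = \<pi>1 @ tl (rev \<pi>2)"
  have \<pi>: "is_path d u z \<pi>" "path_time t \<pi> \<le> 2 * m"
    using is_path_join(1)[OF \<pi>1(1) is_path_rev[OF \<pi>2(1)]] is_path_join(3)[OF \<pi>1(1) is_path_rev[OF \<pi>2(1)], where t = t] \<pi>1(2) \<pi>2(2)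
    by (auto simp: \<pi>_def path_time_rev)
  define \<pi>' where "\<pi>' = (rev \<beta>' @ [u]) @ tl \<pi>"
  have \<pi>': "is_path d v z \<pi>'" "path_time t \<pi>' \<le> path_time t (rev \<beta>' @ [u]) + 2 * m"
    using is_path_join(1)[OF start \<pi>(1)] is_path_join(3)[OF start \<pi>(1), where t = t] \<pi>(2) by (auto simp: \<pi>'_def)
  have new: "is_path d v w (\<pi>' @ tl (z # \<zeta>))" by (rule is_path_join(1)[OF \<pi>'(1) stop])
  have new_time: "path_time t (\<pi>' @ tl (z # \<zeta>)) \<le> path_time t (rev \<beta>' @ [u]) + 2 * m + path_time t (z # \<zeta>)"
    using is_path_join(3)[OF \<pi>'(1) stop, where t = t] \<pi>'(2) by linarith
  have "path_time t \<gamma> = path_time t (rev \<beta>' @ [u]) + path_time t (u # (\<sigma> @ \<eta> @ z # \<zeta>))"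
    unfolding eq by (rule path_time_join)
  moreover have "path_time t ((u # \<sigma> @ \<eta>) @ z # \<zeta>) = path_time t ((u # \<sigma> @ \<eta>) @ [z]) + path_time t (z # \<zeta>)"
    by (rule path_time_join)
  ultimately have "path_time t \<gamma> = path_time t (rev \<beta>' @ [u]) + path_time t ((u # \<sigma>) @ (\<eta> @ [z])) + path_time t (z # \<zeta>)"
    by simp
  moreover have "t {x, y} \<le> path_time t ((u # \<sigma>) @ (\<eta> @ [z]))"
  proof -
    have "last (u # \<sigma>) = x" using \<alpha>x by (metis last_appendR last_snoc list.discI)
    have "hd (\<eta> @ [z]) = y" using z(1) by (cases \<eta>) auto
    have middle: "successively (adjacent d) q" if "successively (adjacent d) (p @ q @ r)" for p q r
      using that by (simp add: successively_append_iff)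
    have "\<gamma> = rev \<beta>' @ ((u # \<sigma>) @ (\<eta> @ [z])) @ \<zeta>" by (simp add: eq)
    then have "successively (adjacent d) ((u # \<sigma>) @ (\<eta> @ [z]))"
      using path middle unfolding is_path_def by metis
    then have parts: "successively (adjacent d) (u # \<sigma>)" "successively (adjacent d) (\<eta> @ [z])"
      unfolding successively_append_iff[of _ "u # \<sigma>"] by simp_all
    have "0 \<le> path_time t (u # \<sigma>)" "0 \<le> path_time t (\<eta> @ [z])"
      by (rule path_time_nonneg[OF nonneg parts(1)], simp) (rule path_time_nonneg[OF nonneg parts(2)], simp)
    with \<open>last (u # \<sigma>) = x\<close> \<open>hd (\<eta> @ [z]) = y\<close> show ?thesis
      unfolding path_time_def using path_edges_append[of "u # \<sigma>" "\<eta> @ [z]"] by simp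
  qed
  ultimately show False
    using new_time passage_time_le[of d t, OF nonneg new] opt heavy by linarith
qed

section \<open>The probability of a slow sphere\<close>

lemma exp_le_quadratic:
  fixes z :: real assumes "0 \<le> z"
  shows "exp z \<le> 1 + z + z\<^sup>2 * exp z"
proof -
  have "1 - z \<le> exp (- z)" using exp_ge_add_one_self[of "- z"] by simp
  then have "(1 - z) * exp z \<le> exp (- z) * exp z" by (rule mult_right_mono) simp
  also have "exp (- z) * exp z = 1" by (simp add: exp_minus)
  finally have le: "exp z - 1 \<le> z * exp z" by (simp add: algebra_simps)
  then have "z * (exp z - 1) \<le> z * (z * exp z)" using assms by (rule mult_left_mono)
  then show ?thesis using le by (simp add: algebra_simps power2_eq_square)
qed

context first_passage
begin

lemma prob_independent_groups:
  assumes L: "finite L" and K: "\<And>j. j \<in> L \<Longrightarrow> K j \<subseteq> edges d" "disjoint_family_on K L"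
    and Q: "\<And>j. j \<in> L \<Longrightarrow> Measurable.pred (PiM (K j) (\<lambda>_. borel)) (Q j)"
  shows "prob {\<omega> \<in> space M. \<forall>j\<in>L. Q j (\<lambda>e\<in>K j. \<tau> e \<omega>)}
    = (\<Prod>j\<in>L. prob {\<omega> \<in> space M. Q j (\<lambda>e\<in>K j. \<tau> e \<omega>)})"
proof (cases "L = {}")
  case False
  have "indep_vars (\<lambda>j. PiM (K j) (\<lambda>_. borel)) (\<lambda>j \<omega>. \<lambda>e\<in>K j. \<tau> e \<omega>) L"
    by (rule indep_vars_restrict[OF indep K])
  then have ind: "indep_vars (\<lambda>_. count_space UNIV) (\<lambda>j \<omega>. Q j (\<lambda>e\<in>K j. \<tau> e \<omega>)) L"
    by (rule indep_vars_compose2) (rule Q)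
  let ?X = "\<lambda>j \<omega>. Q j (\<lambda>e\<in>K j. \<tau> e \<omega>)"
  have "prob (\<Inter>j\<in>L. ?X j -` {True} \<inter> space M) = (\<Prod>j\<in>L. prob (?X j -` {True} \<inter> space M))"
    by (rule indep_varsD_finite[OF ind False L]) simp
  moreover have "(\<Inter>j\<in>L. ?X j -` {True} \<inter> space M) = {\<omega> \<in> space M. \<forall>j\<in>L. ?X j \<omega>}"
    using False by auto
  moreover have "?X j -` {True} \<inter> space M = {\<omega> \<in> space M. ?X j \<omega>}" for j by auto
  ultimately show ?thesis by simp
qed (simp add: prob_space)

definition mean :: real where "mean = expectation (\<tau> e0)"

definition second_moment :: real where "second_moment = expectation (\<lambda>\<omega>. (\<tau> e0 \<omega>)\<^sup>2)"

lemma weight_integrable: "e \<in> edges d \<Longrightarrow> integrable M (\<tau> e)"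
  using weight_measurable square_integrable by (rule square_integrable_imp_integrable)

lemma expectation_weight:
  assumes "e \<in> edges d"
  shows "expectation (\<tau> e) = mean" "expectation (\<lambda>\<omega>. (\<tau> e \<omega>)\<^sup>2) = second_moment"
proof -
  have "expectation (\<lambda>\<omega>. f (\<tau> e' \<omega>)) = (\<integral>x. f x \<partial>distr M borel (\<tau> e'))"
    if "f \<in> borel_measurable borel" "e' \<in> edges d" for e' and f :: "real \<Rightarrow> real"
    using weight_measurable[OF that(2)] that(1) by (subst integral_distr) auto
  from this[of _ e] this[of _ e0]
  have eq: "expectation (\<lambda>\<omega>. f (\<tau> e \<omega>)) = expectation (\<lambda>\<omega>. f (\<tau> e0 \<omega>))"
    if "f \<in> borel_measurable borel" for f :: "real \<Rightarrow> real"
    using assms e0_in_edges ident[OF assms e0_in_edges] that by simp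
  show "expectation (\<tau> e) = mean" using eq[of "\<lambda>x. x"] by (simp add: mean_def)
  show "expectation (\<lambda>\<omega>. (\<tau> e \<omega>)\<^sup>2) = second_moment" using eq[of "\<lambda>x. x\<^sup>2"] by (simp add: second_moment_def)
qed

lemma mean_nonneg: "0 \<le> mean"
  unfolding mean_def by (intro integral_nonneg_AE AE_I2 weight_nonneg[OF e0_in_edges])

lemma second_moment_nonneg: "0 \<le> second_moment"
  unfolding second_moment_def by (intro integral_nonneg_AE AE_I2) simp

lemma prob_heavy_weight:
  assumes "e \<in> edges d" "0 < s"
  shows "prob {\<omega> \<in> space M. s < \<tau> e \<omega>} \<le> second_moment / s\<^sup>2"
proof -
  note [measurable] = weight_measurable[OF assms(1)]
  have "prob {\<omega> \<in> space M. s < \<tau> e \<omega>} \<le> prob {\<omega> \<in> space M. (\<tau> e \<omega>)\<^sup>2 \<ge> s\<^sup>2}"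
    using assms(2) by (intro finite_measure_mono) (auto intro!: power_mono)
  also have "\<dots> \<le> second_moment / s\<^sup>2"
    using integral_Markov_inequality_measure[OF square_integrable[OF assms(1)], of "{}" "s\<^sup>2"]
      assms expectation_weight(2)[OF assms(1)] by simp
  finally show ?thesis .
qed

lemma truncated_mgf:
  assumes "e \<in> edges d" "0 \<le> l" "0 \<le> s"
  shows "(\<integral>\<^sup>+\<omega>. ennreal (exp (l * (if \<tau> e \<omega> \<le> s then \<tau> e \<omega> else 0))) \<partial>M)
    \<le> ennreal (exp (l * mean + l\<^sup>2 * second_moment * exp (l * s)))"
proof -
  let ?f = "\<lambda>\<omega>. 1 + l * \<tau> e \<omega> + l\<^sup>2 * (\<tau> e \<omega>)\<^sup>2 * exp (l * s)"
  have int: "integrable M ?f"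
    using weight_integrable[OF assms(1)] square_integrable[OF assms(1)] by simp
  have pointwise: "exp (l * (if \<tau> e \<omega> \<le> s then \<tau> e \<omega> else 0)) \<le> ?f \<omega>" if \<omega>: "\<omega> \<in> space M" for \<omega>
  proof (cases "\<tau> e \<omega> \<le> s")
    case True
    have nonneg: "0 \<le> l * \<tau> e \<omega>" using assms weight_nonneg[OF assms(1) \<omega>] by simp
    have "exp (l * \<tau> e \<omega>) \<le> exp (l * s)" using True assms(2) by (simp add: mult_left_mono)
    then have "(l * \<tau> e \<omega>)\<^sup>2 * exp (l * \<tau> e \<omega>) \<le> (l * \<tau> e \<omega>)\<^sup>2 * exp (l * s)"
      by (rule mult_left_mono) simp
    then show ?thesis using exp_le_quadratic[OF nonneg] True by (simp add: power_mult_distrib)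
  qed (use assms weight_nonneg[OF assms(1) \<omega>] in simp)
  have "(\<integral>\<^sup>+\<omega>. ennreal (exp (l * (if \<tau> e \<omega> \<le> s then \<tau> e \<omega> else 0))) \<partial>M) \<le> (\<integral>\<^sup>+\<omega>. ennreal (?f \<omega>) \<partial>M)"
    using pointwise by (intro nn_integral_mono ennreal_leI)
  also have "\<dots> = ennreal (expectation ?f)"
    using int assms weight_nonneg[OF assms(1)] by (intro nn_integral_eq_integral) auto
  also have "expectation ?f = 1 + (l * mean + l\<^sup>2 * second_moment * exp (l * s))"
    using weight_integrable[OF assms(1)] square_integrable[OF assms(1)] expectation_weight[OF assms(1)]
    by (simp add: prob_space)
  also have "ennreal \<dots> \<le> ennreal (exp (l * mean + l\<^sup>2 * second_moment * exp (l * s)))"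
    by (intro ennreal_leI exp_ge_add_one_self)
  finally show ?thesis .
qed

text \<open>
  The exponential Markov inequality. Truncation at \<open>s\<close> bounds the second-order term of the moment
  generating function by the second moment times \<open>exp (l * s)\<close>.
\<close>

lemma truncated_sum_tail:
  assumes F: "finite F" "F \<subseteq> edges d" and "0 \<le> l" "0 \<le> s"
  shows "prob {\<omega> \<in> space M. m < (\<Sum>e\<in>F. if \<tau> e \<omega> \<le> s then \<tau> e \<omega> else 0)}
    \<le> exp (real (card F) * (l * mean + l\<^sup>2 * second_moment * exp (l * s)) - l * m)"
proof -
  define X where "X e \<omega> = (if \<tau> e \<omega> \<le> s then \<tau> e \<omega> else 0)" for e \<omega>
  define B where "B = l * mean + l\<^sup>2 * second_moment * exp (l * s)"
  have meas [measurable]: "X e \<in> borel_measurable M" if "e \<in> F" for e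
  proof -
    have "e \<in> edges d" using that F(2) by blast
    note [measurable] = weight_measurable[OF this]
    show ?thesis unfolding X_def by measurable
  qed
  have ind: "indep_vars (\<lambda>_. borel) (\<lambda>e \<omega>. ennreal (exp (l * X e \<omega>))) F"
    using indep_vars_compose2[OF indep_vars_subset[OF indep F(2)],
        of "\<lambda>_ x. ennreal (exp (l * (if x \<le> s then x else 0)))" "\<lambda>_. borel"]
    by (simp add: X_def)
  have "emeasure M {\<omega> \<in> space M. m < (\<Sum>e\<in>F. X e \<omega>)}
      \<le> emeasure M {\<omega> \<in> space M. 1 \<le> ennreal (exp (- l * m)) * (\<Prod>e\<in>F. ennreal (exp (l * X e \<omega>)))}"
  proof (intro emeasure_mono subsetI)
    fix \<omega> assume \<omega>: "\<omega> \<in> {\<omega> \<in> space M. m < (\<Sum>e\<in>F. X e \<omega>)}"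
    then have "0 \<le> l * ((\<Sum>e\<in>F. X e \<omega>) - m)" using assms(3) by simp
    also have "\<dots> = - l * m + (\<Sum>e\<in>F. l * X e \<omega>)" by (simp add: algebra_simps sum_distrib_left)
    finally have "1 \<le> exp (- l * m + (\<Sum>e\<in>F. l * X e \<omega>))" by simp
    also have "\<dots> = exp (- l * m) * (\<Prod>e\<in>F. exp (l * X e \<omega>))" by (simp only: exp_add exp_sum[OF F(1)])
    finally have "ennreal 1 \<le> ennreal (exp (- l * m) * (\<Prod>e\<in>F. exp (l * X e \<omega>)))" by (rule ennreal_leI)
    then have "1 \<le> ennreal (exp (- l * m)) * (\<Prod>e\<in>F. ennreal (exp (l * X e \<omega>)))"
      by (simp add: ennreal_mult prod_nonneg prod_ennreal)
    then show "\<omega> \<in> {\<omega> \<in> space M. 1 \<le> ennreal (exp (- l * m)) * (\<Prod>e\<in>F. ennreal (exp (l * X e \<omega>)))}"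
      using \<omega> by simp
  qed measurable
  also have "\<dots> \<le> ennreal (exp (- l * m)) * (\<integral>\<^sup>+\<omega>. (\<Prod>e\<in>F. ennreal (exp (l * X e \<omega>))) * indicator (space M) \<omega> \<partial>M)"
    by (rule nn_integral_Markov_inequality) measurable
  also have "(\<integral>\<^sup>+\<omega>. (\<Prod>e\<in>F. ennreal (exp (l * X e \<omega>))) * indicator (space M) \<omega> \<partial>M)
      = (\<integral>\<^sup>+\<omega>. (\<Prod>e\<in>F. ennreal (exp (l * X e \<omega>))) \<partial>M)" by (intro nn_integral_cong) simp
  also have "\<dots> = (\<Prod>e\<in>F. \<integral>\<^sup>+\<omega>. ennreal (exp (l * X e \<omega>)) \<partial>M)"
    by (rule indep_vars_nn_integral[OF F(1) ind]) simp
  also have "\<dots> \<le> (\<Prod>e\<in>F. ennreal (exp B))"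
    unfolding X_def B_def using F(2) assms(3,4) by (intro prod_mono_ennreal truncated_mgf) auto
  also have "ennreal (exp (- l * m)) * (\<Prod>e\<in>F. ennreal (exp B)) = ennreal (exp (real (card F) * B - l * m))"
    by (simp add: ennreal_power ennreal_mult[symmetric] exp_of_nat_mult[symmetric] exp_add[symmetric])
  finally show ?thesis unfolding B_def X_def
    by (simp add: emeasure_eq_measure mult_left_mono ennreal_le_iff)
qed

lemma slow_shell_measurable:
  assumes "1 \<le> k"
  shows "Measurable.pred (PiM (inner_edges d (shell d x (int k))) (\<lambda>_. borel)) (slow_shell d x k s m)"
proof -
  let ?E = "inner_edges d (shell d x (int k))"
  have [measurable]: "(\<lambda>t. t e) \<in> borel_measurable (PiM ?E (\<lambda>_. borel))" if "e \<in> ?E" for e :: edge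
    using that by (rule measurable_component_singleton)
  have "Measurable.pred (PiM ?E (\<lambda>_. borel)) (blocked d x k s)"
    unfolding blocked_def case_prod_unfold
  proof (intro pred_intros_finite finite_face_steps(1)[OF d_pos] finite_Diff finite_lessThan)
    fix q l assume q: "q \<in> face_steps d x k" "l \<in> {..<d} - {fst q}"
    show "finite (detour x (fst (snd q)) (snd (snd q)) l)" using card_detour by blast
    fix e assume "e \<in> detour x (fst (snd q)) (snd (snd q)) l"
    then have "e \<in> ?E" using detour_in_shell[of "fst q" "fst (snd q)" "snd (snd q)" d x k l] q assms by auto
    then show "Measurable.pred (PiM ?E (\<lambda>_. borel)) (\<lambda>t. s < t e)" by measurable
  qed
  moreover have "Measurable.pred (PiM ?E (\<lambda>_. borel))
      (\<lambda>t. \<exists>u\<in>shell d x (int k). m < (\<Sum>e\<in>route d x k u. if t e \<le> s then t e else 0))"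
  proof (intro pred_intros_finite finite_shell[OF d_pos])
    fix u assume "u \<in> shell d x (int k)"
    then have sub: "route d x k u \<subseteq> ?E" using route(1)[OF dim assms] by blast
    have "(\<lambda>t. \<Sum>e\<in>route d x k u. if t e \<le> s then t e else 0) \<in> borel_measurable (PiM ?E (\<lambda>_. borel))"
    proof (rule borel_measurable_sum)
      fix e assume "e \<in> route d x k u"
      then have "e \<in> ?E" using sub by blast
      then show "(\<lambda>t. if t e \<le> s then t e else 0) \<in> borel_measurable (PiM ?E (\<lambda>_. borel))" by measurable
    qed
    then show "Measurable.pred (PiM ?E (\<lambda>_. borel)) (\<lambda>t. m < (\<Sum>e\<in>route d x k u. if t e \<le> s then t e else 0))"
      by measurable
  qed
  ultimately show ?thesis unfolding slow_shell_def by measurable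
qed

lemma slow_shell_cong:
  assumes "1 \<le> k" and eq: "\<And>e. e \<in> inner_edges d (shell d x (int k)) \<Longrightarrow> t e = t' e"
  shows "slow_shell d x k s m t \<longleftrightarrow> slow_shell d x k s m t'"
proof -
  have ex: "(\<exists>e\<in>detour x (fst (snd q)) (snd (snd q)) l. s < t e) \<longleftrightarrow> (\<exists>e\<in>detour x (fst (snd q)) (snd (snd q)) l. s < t' e)"
    if "q \<in> face_steps d x k" "l \<in> {..<d} - {fst q}" for q l
  proof (intro bex_cong refl)
    fix e assume "e \<in> detour x (fst (snd q)) (snd (snd q)) l"
    then have "e \<in> inner_edges d (shell d x (int k))"
      using detour_in_shell[of "fst q" "fst (snd q)" "snd (snd q)" d x k l] that assms(1) by auto
    then show "s < t e \<longleftrightarrow> s < t' e" by (simp add: eq)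
  qed
  have "blocked d x k s t \<longleftrightarrow> blocked d x k s t'"
    unfolding blocked_def case_prod_unfold by (rule bex_cong[OF refl], rule ball_cong[OF refl], rule ex)
  moreover have "(\<Sum>e\<in>route d x k u. if t e \<le> s then t e else 0) = (\<Sum>e\<in>route d x k u. if t' e \<le> s then t' e else 0)"
    if "u \<in> shell d x (int k)" for u
    using route(1)[OF dim assms(1) that] eq by (intro sum.cong) auto
  ultimately show ?thesis unfolding slow_shell_def by auto
qed

lemma slow_shell_restrict:
  assumes "1 \<le> k"
  shows "slow_shell d x k s m (\<lambda>e\<in>inner_edges d (shell d x (int k)). t e) \<longleftrightarrow> slow_shell d x k s m t"
  by (rule slow_shell_cong[OF assms]) simp

lemma slow_shell_event:
  assumes "1 \<le> k"
  shows "{\<omega> \<in> space M. slow_shell d x k s m (\<lambda>e. \<tau> e \<omega>)} \<in> events"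
proof -
  let ?E = "inner_edges d (shell d x (int k))"
  have [measurable]: "(\<lambda>\<omega>. \<lambda>e\<in>?E. \<tau> e \<omega>) \<in> measurable M (PiM ?E (\<lambda>_. borel))"
    using weight_measurable inner_edges_subset by (intro measurable_restrict) blast
  note [measurable] = slow_shell_measurable[OF assms, of x s m]
  have "{\<omega> \<in> space M. slow_shell d x k s m (\<lambda>e\<in>?E. \<tau> e \<omega>)} \<in> events" by measurable
  then show ?thesis by (simp add: slow_shell_restrict[OF assms])
qed

lemma prob_all_shells_slow:
  assumes "\<And>k. 1 \<le> k \<Longrightarrow> k \<le> J \<Longrightarrow> prob {\<omega> \<in> space M. slow_shell d x k s m (\<lambda>e. \<tau> e \<omega>)} \<le> q"
  shows "prob {\<omega> \<in> space M. \<forall>k\<in>{1..J}. slow_shell d x k s m (\<lambda>e. \<tau> e \<omega>)} \<le> q ^ J"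
proof -
  let ?E = "\<lambda>k. inner_edges d (shell d x (int k))"
  have "disjoint_family_on ?E {1..J}"
    unfolding disjoint_family_on_def
  proof (intro ballI impI)
    fix a b :: nat assume "a \<noteq> b"
    have False if "e \<in> ?E a" "e \<in> ?E b" for e
    proof -
      obtain v w where "e = {v, w}" using \<open>e \<in> ?E a\<close> by (auto simp: inner_edges_def edges_def)
      then have "v \<in> shell d x (int a)" "v \<in> shell d x (int b)" using that by (auto simp: inner_edges_def)
      then show False using \<open>a \<noteq> b\<close> by (simp add: shell_def)
    qed
    then show "?E a \<inter> ?E b = {}" by blast
  qed
  then have "prob {\<omega> \<in> space M. \<forall>k\<in>{1..J}. slow_shell d x k s m (\<lambda>e\<in>?E k. \<tau> e \<omega>)}
      = (\<Prod>k\<in>{1..J}. prob {\<omega> \<in> space M. slow_shell d x k s m (\<lambda>e\<in>?E k. \<tau> e \<omega>)})"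
    by (intro prob_independent_groups slow_shell_measurable inner_edges_subset) auto
  also have "\<dots> \<le> (\<Prod>k\<in>{1..J}. q)"
    using assms by (intro prod_mono) (auto simp: slow_shell_restrict)
  finally have le: "prob {\<omega> \<in> space M. \<forall>k\<in>{1..J}. slow_shell d x k s m (\<lambda>e\<in>?E k. \<tau> e \<omega>)} \<le> q ^ J" by simp
  have "(\<forall>k\<in>{1..J}. slow_shell d x k s m (\<lambda>e\<in>?E k. \<tau> e \<omega>))
      \<longleftrightarrow> (\<forall>k\<in>{1..J}. slow_shell d x k s m (\<lambda>e. \<tau> e \<omega>))" for \<omega>
    by (intro ball_cong refl slow_shell_restrict) simp
  then show ?thesis using le by (simp only:)
qed

text \<open>
  The realizations of a step are edge-disjoint, hence independent, and each has at most three edges.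
\<close>

lemma prob_blocked:
  assumes "1 \<le> k" "0 < s"
  shows "{\<omega> \<in> space M. blocked d x k s (\<lambda>e. \<tau> e \<omega>)} \<in> events"
    and "prob {\<omega> \<in> space M. blocked d x k s (\<lambda>e. \<tau> e \<omega>)}
      \<le> real (card (face_steps d x k)) * (3 * (second_moment / s\<^sup>2)) ^ (d - 1)"
proof -
  define B where "B q = {\<omega> \<in> space M. \<forall>l\<in>{..<d} - {fst q}.
      \<exists>e\<in>detour x (fst (snd q)) (snd (snd q)) l. s < \<tau> e \<omega>}" for q
  have eq: "{\<omega> \<in> space M. blocked d x k s (\<lambda>e. \<tau> e \<omega>)} = (\<Union>q\<in>face_steps d x k. B q)"
    unfolding blocked_def B_def case_prod_unfold by blast
  have fin: "finite (face_steps d x k)" by (rule finite_face_steps(1)[OF d_pos])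
  have B: "B q \<in> events \<and> prob (B q) \<le> (3 * (second_moment / s\<^sup>2)) ^ (d - 1)" if q: "q \<in> face_steps d x k" for q
  proof -
    obtain i j u where ij: "q = (i, j, u)" by (cases q) auto
    have i: "i < d" using q ij by (auto simp: face_steps_def)
    let ?D = "detour x j u"
    have D: "?D l \<subseteq> edges d" "finite (?D l)" if "l \<in> {..<d} - {i}" for l
      using detour_in_shell[of i j u d x k l] q ij assms(1) that inner_edges_subset card_detour[of x j u l] by auto
    have heavy: "{\<omega> \<in> space M. s < \<tau> e \<omega>} \<in> events" if "e \<in> edges d" for e
    proof -
      note [measurable] = weight_measurable[OF that]
      show ?thesis by measurable
    qed
    have one: "{\<omega> \<in> space M. \<exists>e\<in>?D l. s < \<tau> e \<omega>} \<in> events"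
      "prob {\<omega> \<in> space M. \<exists>e\<in>?D l. s < \<tau> e \<omega>} \<le> 3 * (second_moment / s\<^sup>2)" if l: "l \<in> {..<d} - {i}" for l
    proof -
      have eq: "{\<omega> \<in> space M. \<exists>e\<in>?D l. s < \<tau> e \<omega>} = (\<Union>e\<in>?D l. {\<omega> \<in> space M. s < \<tau> e \<omega>})" by auto
      show "{\<omega> \<in> space M. \<exists>e\<in>?D l. s < \<tau> e \<omega>} \<in> events"
        unfolding eq using D[OF l] heavy by (intro sets.finite_UN) auto
      have "prob (\<Union>e\<in>?D l. {\<omega> \<in> space M. s < \<tau> e \<omega>}) \<le> (\<Sum>e\<in>?D l. prob {\<omega> \<in> space M. s < \<tau> e \<omega>})"
        using D[OF l] heavy by (intro finite_measure_subadditive_finite) auto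
      also have "\<dots> \<le> (\<Sum>e\<in>?D l. second_moment / s\<^sup>2)"
        using D[OF l] assms(2) by (intro sum_mono prob_heavy_weight) auto
      also have "\<dots> \<le> 3 * (second_moment / s\<^sup>2)"
        unfolding sum_constant using card_detour[of x j u l] second_moment_nonneg
        by (intro mult_right_mono) auto
      finally show "prob {\<omega> \<in> space M. \<exists>e\<in>?D l. s < \<tau> e \<omega>} \<le> 3 * (second_moment / s\<^sup>2)" unfolding eq .
    qed
    have restr: "(\<exists>e\<in>?D l. s < (\<lambda>e\<in>?D l. \<tau> e \<omega>) e) \<longleftrightarrow> (\<exists>e\<in>?D l. s < \<tau> e \<omega>)" for l \<omega> by auto
    have Bq: "B q = {\<omega> \<in> space M. \<forall>l\<in>{..<d} - {i}. \<exists>e\<in>?D l. s < \<tau> e \<omega>}" by (simp add: B_def ij)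
    have ev: "B q \<in> events"
      unfolding Bq using one(1) by (intro sets.sets_Collect_finite_All) auto
    have "prob (B q) = prob {\<omega> \<in> space M. \<forall>l\<in>{..<d} - {i}. \<exists>e\<in>?D l. s < (\<lambda>e\<in>?D l. \<tau> e \<omega>) e}"
      unfolding Bq restr ..
    also have "\<dots> = (\<Prod>l\<in>{..<d} - {i}. prob {\<omega> \<in> space M. \<exists>e\<in>?D l. s < (\<lambda>e\<in>?D l. \<tau> e \<omega>) e})"
    proof (rule prob_independent_groups)
      show "disjoint_family_on ?D ({..<d} - {i})"
        using detour_disjoint by (auto simp: disjoint_family_on_def)
      show "Measurable.pred (PiM (?D l) (\<lambda>_. borel)) (\<lambda>t. \<exists>e\<in>?D l. s < t e)" if "l \<in> {..<d} - {i}" for l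
      proof (rule pred_intros_finite(4)[OF D(2)[OF that]])
        fix e assume "e \<in> ?D l"
        then have [measurable]: "(\<lambda>t. t e) \<in> borel_measurable (PiM (?D l) (\<lambda>_. borel))"
          by (rule measurable_component_singleton)
        show "Measurable.pred (PiM (?D l) (\<lambda>_. borel)) (\<lambda>t. s < t e)" by measurable
      qed
    qed (use D in auto)
    also have "\<dots> \<le> (\<Prod>l\<in>{..<d} - {i}. 3 * (second_moment / s\<^sup>2))"
      unfolding restr using one(2) by (intro prod_mono) auto
    also have "\<dots> = (3 * (second_moment / s\<^sup>2)) ^ (d - 1)" using i by (simp add: card_Diff_singleton)
    finally show ?thesis using ev by blast
  qed
  show "{\<omega> \<in> space M. blocked d x k s (\<lambda>e. \<tau> e \<omega>)} \<in> events"
    unfolding eq using B fin by (intro sets.finite_UN) auto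
  have "prob (\<Union>q\<in>face_steps d x k. B q) \<le> (\<Sum>q\<in>face_steps d x k. prob (B q))"
    using fin B by (intro finite_measure_subadditive_finite) auto
  also have "\<dots> \<le> (\<Sum>q\<in>face_steps d x k. (3 * (second_moment / s\<^sup>2)) ^ (d - 1))"
    using B by (intro sum_mono) auto
  finally show "prob {\<omega> \<in> space M. blocked d x k s (\<lambda>e. \<tau> e \<omega>)}
      \<le> real (card (face_steps d x k)) * (3 * (second_moment / s\<^sup>2)) ^ (d - 1)"
    unfolding eq by simp
qed

lemma prob_slow_shell_le:
  assumes k: "1 \<le> k" and s: "0 < s" and l: "0 \<le> l"
  shows "prob {\<omega> \<in> space M. slow_shell d x k s m (\<lambda>e. \<tau> e \<omega>)}
    \<le> real (card (face_steps d x k)) * (3 * (second_moment / s\<^sup>2)) ^ (d - 1)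
      + real (card (shell d x (int k)))
        * exp (real (6 * d * d * k) * (l * mean + l\<^sup>2 * second_moment * exp (l * s)) - l * m)"
proof -
  let ?S = "shell d x (int k)"
  let ?T = "\<lambda>u. {\<omega> \<in> space M. m < (\<Sum>e\<in>route d x k u. if \<tau> e \<omega> \<le> s then \<tau> e \<omega> else 0)}"
  let ?b = "l * mean + l\<^sup>2 * second_moment * exp (l * s)"
  have b: "0 \<le> ?b" using l mean_nonneg second_moment_nonneg by simp
  have r: "route d x k u \<subseteq> edges d" "finite (route d x k u)" "card (route d x k u) \<le> 6 * d * d * k" if "u \<in> ?S" for u
    using route[OF dim k that] inner_edges_subset by blast+
  have T: "?T u \<in> events" "prob (?T u) \<le> exp (real (6 * d * d * k) * ?b - l * m)" if u: "u \<in> ?S" for u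
  proof -
    have "(\<lambda>\<omega>. \<Sum>e\<in>route d x k u. if \<tau> e \<omega> \<le> s then \<tau> e \<omega> else 0) \<in> borel_measurable M"
    proof (rule borel_measurable_sum)
      fix e assume "e \<in> route d x k u"
      then have "e \<in> edges d" using r(1)[OF u] by blast
      note [measurable] = weight_measurable[OF this]
      show "(\<lambda>\<omega>. if \<tau> e \<omega> \<le> s then \<tau> e \<omega> else 0) \<in> borel_measurable M" by measurable
    qed
    then show "?T u \<in> events" by measurable
    have "prob (?T u) \<le> exp (real (card (route d x k u)) * ?b - l * m)"
      using truncated_sum_tail[OF r(2,1)[OF u] l] s by simp
    also have "\<dots> \<le> exp (real (6 * d * d * k) * ?b - l * m)"
      using r(3)[OF u] b by (simp add: mult_right_mono del: of_nat_mult)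
    finally show "prob (?T u) \<le> exp (real (6 * d * d * k) * ?b - l * m)" .
  qed
  have fin: "finite ?S" by (rule finite_shell[OF d_pos])
  have "{\<omega> \<in> space M. slow_shell d x k s m (\<lambda>e. \<tau> e \<omega>)}
      = {\<omega> \<in> space M. blocked d x k s (\<lambda>e. \<tau> e \<omega>)} \<union> (\<Union>u\<in>?S. ?T u)"
    unfolding slow_shell_def by auto
  also have "prob \<dots> \<le> prob {\<omega> \<in> space M. blocked d x k s (\<lambda>e. \<tau> e \<omega>)} + prob (\<Union>u\<in>?S. ?T u)"
    using prob_blocked(1)[OF k s] T(1) fin by (intro measure_Un_le sets.finite_UN) auto
  also have "prob (\<Union>u\<in>?S. ?T u) \<le> (\<Sum>u\<in>?S. prob (?T u))"
    using fin T(1) by (intro finite_measure_subadditive_finite) auto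
  also have "\<dots> \<le> (\<Sum>u\<in>?S. exp (real (6 * d * d * k) * ?b - l * m))"
    by (intro sum_mono T(2))
  finally show ?thesis using prob_blocked(2)[OF k s, of x] by simp
qed

text \<open>
  The tilt is \<open>l = Q * ln m / m\<close>, and \<open>\<epsilon>\<close> is chosen so that \<open>exp (l * s)\<close> is only \<open>sqrt m\<close>, which
  keeps the second-order term bounded. The constant \<open>c\<close> makes the mean of the sum a small fraction
  of \<open>m\<close>, and \<open>Q\<close> is large enough for the tail to beat the number of points of the sphere.
\<close>

lemma prob_slow_shell:
  "\<exists>\<epsilon> c C. 0 < \<epsilon> \<and> 0 < c \<and> c \<le> 1 \<and> 0 \<le> C \<and>
    (\<forall>m k x. 1 \<le> m \<longrightarrow> 1 \<le> k \<longrightarrow> real k \<le> c * m \<longrightarrow>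
      prob {\<omega> \<in> space M. slow_shell d x k (\<epsilon> * m) (m / 2) (\<lambda>e. \<tau> e \<omega>)} \<le> C / m)"
proof -
  define n where "n = d - 1"
  have n: "n \<ge> 1" "d = Suc n" using dim by (auto simp: n_def)
  define Q where "Q = 4 * (real d + 1)"
  define \<epsilon> where "\<epsilon> = 1 / (2 * Q)"
  define c where "c = min 1 (1 / (24 * real d * real d * (mean + 1)))"
  define K where "K = exp (96 * real d * real d * second_moment * Q\<^sup>2)"
  define C where "C = 2 * real d ^ 3 * (9 * second_moment / \<epsilon>\<^sup>2) ^ n + 2 * real d * 3 ^ n * K"
  have Q: "0 < Q" by (simp add: Q_def)
  have pos: "0 < \<epsilon>" "0 < c" "c \<le> 1" "0 \<le> C" "0 \<le> K"
    using Q mean_nonneg second_moment_nonneg d_pos by (auto simp: \<epsilon>_def c_def C_def K_def)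
  have main: "prob {\<omega> \<in> space M. slow_shell d x k (\<epsilon> * m) (m / 2) (\<lambda>e. \<tau> e \<omega>)} \<le> C / m"
    if m: "1 \<le> m" and k: "1 \<le> k" "real k \<le> c * m" for m k x
  proof -
    define l where "l = Q * ln m / m"
    define s where "s = \<epsilon> * m"
    have l0: "0 \<le> l" using m Q by (simp add: l_def)
    have s0: "0 < s" using pos m by (simp add: s_def)
    have km: "real k \<le> m" using k(2) pos(3) m mult_right_mono[of c 1 m] by linarith
    have ls: "exp (l * s) = sqrt m"
    proof -
      have "l * s = ln m / 2" using Q m by (simp add: l_def s_def \<epsilon>_def)
      then show ?thesis using m by (simp add: ln_sqrt[symmetric])
    qed
    \<comment> \<open>The logarithm is dominated by the fourth root.\<close>
    have ln2: "(ln m)\<^sup>2 \<le> 16 * sqrt m"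
    proof -
      have "ln (sqrt (sqrt m)) \<le> sqrt (sqrt m) - 1" using m by (intro ln_le_minus_one) simp
      moreover have "ln (sqrt (sqrt m)) = ln m / 4" using m by (simp add: ln_sqrt)
      ultimately have "ln m \<le> 4 * sqrt (sqrt m)" by simp
      then have "(ln m)\<^sup>2 \<le> (4 * sqrt (sqrt m))\<^sup>2" using m by (intro power_mono) auto
      then show ?thesis using m by (simp add: power_mult_distrib)
    qed
    have exponent: "real (6 * d * d * k) * (l * mean + l\<^sup>2 * second_moment * exp (l * s)) - l * (m / 2)
        \<le> 96 * real d * real d * second_moment * Q\<^sup>2 - (real d + 1) * ln m"
    proof -
      have lm: "l * m = Q * ln m" using m by (simp add: l_def)
      have "real (6 * d * d * k) * (l * mean) \<le> (1 / 4) * (Q * ln m)"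
      proof -
        have "24 * real d * real d * (mean + 1) > 0" using d_pos mean_nonneg by simp
        then have "24 * real d * real d * (mean + 1) * c \<le> 1"
          unfolding c_def by (simp add: min_def field_simps split: if_splits)
        moreover have "24 * real d * real d * mean * c \<le> 24 * real d * real d * (mean + 1) * c"
          using pos by (intro mult_right_mono mult_left_mono) auto
        ultimately have "6 * real d * real d * mean * c \<le> 1 / 4" by linarith
        then have "6 * real d * real d * mean * c * (l * m) \<le> (1 / 4) * (l * m)"
          using l0 m by (intro mult_right_mono) auto
        moreover have "real (6 * d * d * k) * (l * mean) \<le> 6 * real d * real d * mean * l * (c * m)"
          using k(2) l0 mean_nonneg
            mult_left_mono[of "real k" "c * m" "6 * real d * real d * mean * l"] by (simp add: algebra_simps)
        moreover have "6 * real d * real d * mean * l * (c * m) = 6 * real d * real d * mean * c * (l * m)"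
          by (simp only: mult_ac)
        ultimately show ?thesis unfolding lm by linarith
      qed
      moreover have "real (6 * d * d * k) * (l\<^sup>2 * second_moment * exp (l * s))
          \<le> 96 * real d * real d * second_moment * Q\<^sup>2"
      proof -
        have "real k * l\<^sup>2 * sqrt m \<le> m * l\<^sup>2 * sqrt m"
          using km m by (intro mult_right_mono) auto
        also have "\<dots> = Q\<^sup>2 * ((ln m)\<^sup>2 * sqrt m / m)"
          using m by (simp add: l_def power_mult_distrib power_divide power2_eq_square)
        also have "\<dots> \<le> Q\<^sup>2 * (16 * sqrt m * sqrt m / m)"
          using ln2 m by (intro mult_left_mono divide_right_mono mult_right_mono) auto
        also have "\<dots> = 16 * Q\<^sup>2" using m by (simp add: mult.assoc)
        finally have "6 * real d * real d * second_moment * (real k * l\<^sup>2 * sqrt m)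
            \<le> 6 * real d * real d * second_moment * (16 * Q\<^sup>2)"
          using second_moment_nonneg by (intro mult_left_mono) auto
        then show ?thesis unfolding ls by (simp add: algebra_simps)
      qed
      moreover have "l * (m / 2) = Q * ln m / 2" using lm by simp
      moreover have "Q * ln m / 4 = (real d + 1) * ln m" by (simp add: Q_def)
      ultimately show ?thesis unfolding distrib_left by linarith
    qed
    have tail: "exp (real (6 * d * d * k) * (l * mean + l\<^sup>2 * second_moment * exp (l * s)) - l * (m / 2))
        \<le> K / m ^ (d + 1)"
    proof -
      have "exp ((real d + 1) * ln m) = exp (real (d + 1) * ln m)" by simp
      also have "\<dots> = exp (ln m) ^ (d + 1)" by (rule exp_of_nat_mult)
      also have "exp (ln m) = m" using m by simp
      finally have "exp (96 * real d * real d * second_moment * Q\<^sup>2 - (real d + 1) * ln m) = K / m ^ (d + 1)"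
        by (simp only: exp_diff K_def)
      then show ?thesis using exponent by (metis exp_le_cancel_iff)
    qed
    have shell_card: "real (card (shell d x (int k))) \<le> 2 * real d * (3 * m) ^ n"
    proof -
      have "real (card (shell d x (int k))) \<le> real (2 * d * nat (2 * int k + 1) ^ (d - 1))"
        using card_shell[OF d_pos, of "int k" x] by (simp only: of_nat_le_iff)
      also have "\<dots> = 2 * real d * (2 * real k + 1) ^ n" by (simp add: n_def nat_add_distrib nat_mult_distrib add.commute)
      also have "\<dots> \<le> 2 * real d * (3 * m) ^ n"
        using km m k by (intro mult_left_mono power_mono) auto
      finally show ?thesis .
    qed
    have steps_card: "real (card (face_steps d x k)) \<le> real d * real d * (2 * real d * (3 * m) ^ n)"
    proof -
      have "real (card (face_steps d x k)) \<le> real (d * d * card (shell d x (int k)))"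
        using finite_face_steps(2)[OF d_pos] by (simp only: of_nat_le_iff)
      also have "\<dots> \<le> real d * real d * (2 * real d * (3 * m) ^ n)"
        using shell_card by (simp add: mult_left_mono)
      finally show ?thesis .
    qed
    have "prob {\<omega> \<in> space M. slow_shell d x k s (m / 2) (\<lambda>e. \<tau> e \<omega>)}
        \<le> real (card (face_steps d x k)) * (3 * (second_moment / s\<^sup>2)) ^ (d - 1)
        + real (card (shell d x (int k)))
        * exp (real (6 * d * d * k) * (l * mean + l\<^sup>2 * second_moment * exp (l * s)) - l * (m / 2))"
      by (rule prob_slow_shell_le[OF k(1) s0 l0])
    also have "\<dots> \<le> real d * real d * (2 * real d * (3 * m) ^ n) * (3 * (second_moment / s\<^sup>2)) ^ n
        + 2 * real d * (3 * m) ^ n * (K / m ^ (d + 1))"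
      unfolding n_def[symmetric] using second_moment_nonneg shell_card steps_card tail m
      by (intro add_mono mult_mono) auto
    also have "real d * real d * (2 * real d * (3 * m) ^ n) * (3 * (second_moment / s\<^sup>2)) ^ n
        = 2 * real d ^ 3 * (9 * second_moment / \<epsilon>\<^sup>2) ^ n / m ^ n"
    proof -
      have "(3 * m) ^ n * (3 * (second_moment / s\<^sup>2)) ^ n = ((3 * m) * (3 * (second_moment / s\<^sup>2))) ^ n"
        by (rule power_mult_distrib[symmetric])
      also have "(3 * m) * (3 * (second_moment / s\<^sup>2)) = 9 * second_moment / \<epsilon>\<^sup>2 / m"
        using m by (simp add: s_def power_mult_distrib power2_eq_square)
      also have "(9 * second_moment / \<epsilon>\<^sup>2 / m) ^ n = (9 * second_moment / \<epsilon>\<^sup>2) ^ n / m ^ n"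
        by (rule power_divide)
      finally have eq: "(3 * m) ^ n * (3 * (second_moment / s\<^sup>2)) ^ n = (9 * second_moment / \<epsilon>\<^sup>2) ^ n / m ^ n" .
      have "real d * real d * (2 * real d * (3 * m) ^ n) * (3 * (second_moment / s\<^sup>2)) ^ n
          = 2 * real d ^ 3 * ((3 * m) ^ n * (3 * (second_moment / s\<^sup>2)) ^ n)"
        by (simp only: power3_eq_cube mult_ac)
      then show ?thesis unfolding eq by simp
    qed
    also have "2 * real d * (3 * m) ^ n * (K / m ^ (d + 1)) = 2 * real d * 3 ^ n * K / m\<^sup>2"
      using m n(2) by (simp add: power_mult_distrib power2_eq_square field_simps)
    also have "2 * real d ^ 3 * (9 * second_moment / \<epsilon>\<^sup>2) ^ n / m ^ n + 2 * real d * 3 ^ n * K / m\<^sup>2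
        \<le> 2 * real d ^ 3 * (9 * second_moment / \<epsilon>\<^sup>2) ^ n / m + 2 * real d * 3 ^ n * K / m"
    proof (intro add_mono divide_left_mono)
      show "m \<le> m ^ n" using m n(1) power_increasing[of 1 n m] by simp
      show "m \<le> m\<^sup>2" using m power_increasing[of 1 2 m] by simp
    qed (use m pos second_moment_nonneg in auto)
    finally show ?thesis by (simp add: s_def C_def add_divide_distrib)
  qed
  show ?thesis by (intro exI[of _ \<epsilon>] exI[of _ c] exI[of _ C] conjI allI impI pos(1-4) main)
qed

end

section \<open>Events covering a heavy edge on an optimal path\<close>

context first_passage
begin

definition target :: "nat \<Rightarrow> vertex" where "target N = (\<lambda>i. int N * e1 i)"

lemma target_in_lattice: "target N \<in> lattice d"
  using d_pos by (simp add: target_def e1_def lattice_def)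

lemma straight_path:
  obtains \<gamma> where "is_path d origin (target N) \<gamma>" "length (path_edges \<gamma>) = N"
proof -
  have "\<exists>\<gamma>. is_path d origin (target N) \<gamma> \<and> length (path_edges \<gamma>) = N"
  proof (induction N)
    case 0
    have "target 0 = origin" by (simp add: target_def origin_def)
    then show ?case by (intro exI[of _ "[origin]"]) (simp add: is_path_def)
  next
    case (Suc N)
    then obtain \<gamma> where \<gamma>: "is_path d origin (target N) \<gamma>" "length (path_edges \<gamma>) = N" by blast
    have "target (Suc N) = raise 0 1 (target N)"
      by (auto simp: target_def raise_def e1_def fun_eq_iff)
    then have adj: "adjacent d (target N) (target (Suc N))"
      using adjacent_raise[OF d_pos target_in_lattice, of 1] by simp
    have "is_path d (target N) (target (Suc N)) [target N, target (Suc N)]"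
      using adj target_in_lattice by (simp add: is_path_def)
    from is_path_join(1)[OF \<gamma>(1) this] have "is_path d origin (target (Suc N)) (\<gamma> @ [target (Suc N)])" by simp
    moreover have "length (path_edges (\<gamma> @ [target (Suc N)])) = Suc N"
      using \<gamma> path_edges_append[of \<gamma> "[target (Suc N)]"] by (simp add: is_path_def)
    ultimately show ?case by blast
  qed
  then show thesis using that by blast
qed

lemma expectation_path_time:
  assumes "set (path_edges \<gamma>) \<subseteq> edges d"
  shows "integrable M (\<lambda>\<omega>. path_time (\<lambda>e. \<tau> e \<omega>) \<gamma>)"
    and "expectation (\<lambda>\<omega>. path_time (\<lambda>e. \<tau> e \<omega>) \<gamma>) = real (length (path_edges \<gamma>)) * mean"
proof -
  have "integrable M (\<lambda>\<omega>. \<Sum>e\<leftarrow>xs. \<tau> e \<omega>) \<and> expectation (\<lambda>\<omega>. \<Sum>e\<leftarrow>xs. \<tau> e \<omega>) = real (length xs) * mean"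
    if "set xs \<subseteq> edges d" for xs
    using that
  proof (induction xs)
    case (Cons e xs)
    then show ?case using weight_integrable[of e] expectation_weight(1)[of e]
      by (simp add: algebra_simps)
  qed simp
  from this[OF assms] show "integrable M (\<lambda>\<omega>. path_time (\<lambda>e. \<tau> e \<omega>) \<gamma>)"
    "expectation (\<lambda>\<omega>. path_time (\<lambda>e. \<tau> e \<omega>) \<gamma>) = real (length (path_edges \<gamma>)) * mean"
    by (simp_all add: path_time_def)
qed

text \<open>
  Comparing with each of the countably many paths avoids the infimum and shows that optimality is
  a measurable condition.
\<close>

lemma optimal_paths_iff:
  assumes "\<omega> \<in> space M" "v \<in> lattice d"
  shows "\<gamma> \<in> optimal_paths d (\<lambda>e. \<tau> e \<omega>) v w \<longleftrightarrow> is_path d v w \<gamma> \<and>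
    (\<forall>\<delta>. is_path d v w \<delta> \<longrightarrow> path_time (\<lambda>e. \<tau> e \<omega>) \<gamma> \<le> path_time (\<lambda>e. \<tau> e \<omega>) \<delta>)"
proof -
  let ?t = "\<lambda>e. \<tau> e \<omega>"
  have nonneg: "0 \<le> ?t e" if "e \<in> edges d" for e using weight_nonneg[OF that assms(1)] .
  have "path_time ?t \<gamma> = passage_time d ?t v w \<longleftrightarrow> (\<forall>\<delta>. is_path d v w \<delta> \<longrightarrow> path_time ?t \<gamma> \<le> path_time ?t \<delta>)"
    if \<gamma>: "is_path d v w \<gamma>"
  proof
    assume "path_time ?t \<gamma> = passage_time d ?t v w"
    then show "\<forall>\<delta>. is_path d v w \<delta> \<longrightarrow> path_time ?t \<gamma> \<le> path_time ?t \<delta>"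
      using passage_time_le[of d ?t, OF nonneg] by simp
  next
    assume least: "\<forall>\<delta>. is_path d v w \<delta> \<longrightarrow> path_time ?t \<gamma> \<le> path_time ?t \<delta>"
    have "path_time ?t \<gamma> \<le> passage_time d ?t v w"
      unfolding passage_time_def using least \<gamma> by (intro cINF_greatest) auto
    moreover have "passage_time d ?t v w \<le> path_time ?t \<gamma>"
      by (rule passage_time_le[of d ?t, OF nonneg \<gamma>])
    ultimately show "path_time ?t \<gamma> = passage_time d ?t v w" by simp
  qed
  then show ?thesis by (auto simp: optimal_paths_def)
qed

lemma countable_paths: "countable {\<gamma>. is_path d v w \<gamma>}"
  by (rule countable_subset[OF _ countable_lists[OF countable_lattice[of d]]]) (auto simp: is_path_def)

definition light_event :: "nat \<Rightarrow> real \<Rightarrow> 'a set" where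
  "light_event N m = {\<omega> \<in> space M.
    (SUP \<gamma>\<in>optimal_paths d (\<lambda>e. \<tau> e \<omega>) origin (target N). max_weight (\<lambda>e. \<tau> e \<omega>) \<gamma>) \<le> ereal m}"

lemma light_event_iff:
  assumes "\<omega> \<in> space M"
  shows "\<omega> \<in> light_event N m \<longleftrightarrow>
    (\<forall>\<gamma>\<in>optimal_paths d (\<lambda>e. \<tau> e \<omega>) origin (target N). \<forall>e\<in>set (path_edges \<gamma>). \<tau> e \<omega> \<le> m)"
  using assms by (simp add: light_event_def max_weight_def SUP_le_iff)

lemma light_event_measurable: "light_event N m \<in> events"
proof -
  let ?P = "{\<gamma>. is_path d origin (target N) \<gamma>}"
  have eq: "light_event N m = {\<omega> \<in> space M. \<forall>\<gamma>\<in>?P.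
      (\<forall>\<delta>\<in>?P. path_time (\<lambda>e. \<tau> e \<omega>) \<gamma> \<le> path_time (\<lambda>e. \<tau> e \<omega>) \<delta>) \<longrightarrow>
      (\<forall>e\<in>set (path_edges \<gamma>). \<tau> e \<omega> \<le> m)}"
  proof (intro set_eqI iffI)
    fix \<omega> assume "\<omega> \<in> light_event N m"
    moreover from this have "\<omega> \<in> space M" by (simp add: light_event_def)
    ultimately show "\<omega> \<in> {\<omega> \<in> space M. \<forall>\<gamma>\<in>?P.
      (\<forall>\<delta>\<in>?P. path_time (\<lambda>e. \<tau> e \<omega>) \<gamma> \<le> path_time (\<lambda>e. \<tau> e \<omega>) \<delta>) \<longrightarrow>
      (\<forall>e\<in>set (path_edges \<gamma>). \<tau> e \<omega> \<le> m)}"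
      by (simp add: light_event_iff optimal_paths_iff)
  next
    fix \<omega> assume *: "\<omega> \<in> {\<omega> \<in> space M. \<forall>\<gamma>\<in>?P.
      (\<forall>\<delta>\<in>?P. path_time (\<lambda>e. \<tau> e \<omega>) \<gamma> \<le> path_time (\<lambda>e. \<tau> e \<omega>) \<delta>) \<longrightarrow>
      (\<forall>e\<in>set (path_edges \<gamma>). \<tau> e \<omega> \<le> m)}"
    then have "\<omega> \<in> space M" by simp
    then show "\<omega> \<in> light_event N m" using * by (auto simp: light_event_iff optimal_paths_iff)
  qed
  have edges: "set (path_edges \<gamma>) \<subseteq> edges d" if "\<gamma> \<in> ?P" for \<gamma>
    using that path_edges_in_edges by (auto simp: is_path_def)
  have time: "(\<lambda>\<omega>. path_time (\<lambda>e. \<tau> e \<omega>) \<gamma>) \<in> borel_measurable M" if "\<gamma> \<in> ?P" for \<gamma>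
    using expectation_path_time(1)[OF edges[OF that]] by simp
  have le: "Measurable.pred M (\<lambda>\<omega>. path_time (\<lambda>e. \<tau> e \<omega>) \<gamma> \<le> path_time (\<lambda>e. \<tau> e \<omega>) \<delta>)"
    if "\<gamma> \<in> ?P" "\<delta> \<in> ?P" for \<gamma> \<delta>
  proof -
    note [measurable] = time[OF that(1)] time[OF that(2)]
    show ?thesis by measurable
  qed
  have light: "Measurable.pred M (\<lambda>\<omega>. \<tau> e \<omega> \<le> m)" if "\<gamma> \<in> ?P" "e \<in> set (path_edges \<gamma>)" for \<gamma> e
  proof -
    have "e \<in> edges d" using edges that by blast
    note [measurable] = weight_measurable[OF this]
    show ?thesis by measurable
  qed
  have "{\<omega> \<in> space M. path_time (\<lambda>e. \<tau> e \<omega>) \<gamma> \<le> path_time (\<lambda>e. \<tau> e \<omega>) \<delta>} \<in> events"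
    if "\<gamma> \<in> ?P" "\<delta> \<in> ?P" for \<gamma> \<delta>
    using le[OF that] by (simp add: pred_def)
  moreover have "{\<omega> \<in> space M. \<tau> e \<omega> \<le> m} \<in> events" if "\<gamma> \<in> ?P" "e \<in> set (path_edges \<gamma>)" for \<gamma> e
    using light[OF that] by (simp add: pred_def)
  ultimately show ?thesis unfolding eq
    by (intro sets.sets_Collect_countable_All' sets.sets_Collect_imp countable_paths)
      (auto intro: countable_finite)
qed

lemma prob_heavy_edge_in:
  assumes "finite S" "0 < m"
  shows "{\<omega> \<in> space M. \<exists>e\<in>inner_edges d S. m < \<tau> e \<omega>} \<in> events"
    and "prob {\<omega> \<in> space M. \<exists>e\<in>inner_edges d S. m < \<tau> e \<omega>} \<le> 2 ^ card S * (second_moment / m\<^sup>2)"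
proof -
  have eq: "{\<omega> \<in> space M. \<exists>e\<in>inner_edges d S. m < \<tau> e \<omega>} = (\<Union>e\<in>inner_edges d S. {\<omega> \<in> space M. m < \<tau> e \<omega>})"
    by auto
  have fin: "finite (inner_edges d S)" by (rule finite_inner_edges[OF assms(1)])
  have ev: "{\<omega> \<in> space M. m < \<tau> e \<omega>} \<in> events" if "e \<in> inner_edges d S" for e
  proof -
    have "e \<in> edges d" using that inner_edges_subset by blast
    note [measurable] = weight_measurable[OF this]
    show ?thesis by measurable
  qed
  show "{\<omega> \<in> space M. \<exists>e\<in>inner_edges d S. m < \<tau> e \<omega>} \<in> events"
    unfolding eq using fin ev by (intro sets.finite_UN) auto
  have "prob (\<Union>e\<in>inner_edges d S. {\<omega> \<in> space M. m < \<tau> e \<omega>}) \<le> (\<Sum>e\<in>inner_edges d S. prob {\<omega> \<in> space M. m < \<tau> e \<omega>})"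
    using fin ev by (intro finite_measure_subadditive_finite) auto
  also have "\<dots> \<le> (\<Sum>e\<in>inner_edges d S. second_moment / m\<^sup>2)"
    using inner_edges_subset assms(2) by (intro sum_mono prob_heavy_weight) auto
  also have "\<dots> \<le> 2 ^ card S * (second_moment / m\<^sup>2)"
  proof -
    have "card (inner_edges d S) \<le> card (Pow S)"
      using assms(1) by (intro card_mono) (auto simp: inner_edges_def)
    then have "real (card (inner_edges d S)) \<le> 2 ^ card S"
      using assms(1) by (simp add: card_Pow)
    then show ?thesis unfolding sum_constant using second_moment_nonneg by (intro mult_right_mono) auto
  qed
  finally show "prob {\<omega> \<in> space M. \<exists>e\<in>inner_edges d S. m < \<tau> e \<omega>} \<le> 2 ^ card S * (second_moment / m\<^sup>2)"
    unfolding eq .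
qed

text \<open>
  The five terms bound the probabilities that the straight path is slow, that a fast path leaves the
  box of size \<open>R\<close>, that there is a heavy edge close to an end of the path, that \<open>d + 1\<close> spheres are
  slow about a vertex within distance \<open>J\<close> of an end, and that \<open>J\<close> spheres are slow about a vertex of
  the box. Outside these events every edge of every optimal path is light.
\<close>

lemma light_event_bound:
  fixes R :: nat
  assumes slow: "\<And>k x. 1 \<le> k \<Longrightarrow> k \<le> J \<Longrightarrow>
      prob {\<omega> \<in> space M. slow_shell d x k s (m / 2) (\<lambda>e. \<tau> e \<omega>)} \<le> q"
    and J: "d + 1 \<le> J" and "0 < m" "0 < r" and V: "V \<in> events"
      "{\<omega> \<in> space M. \<exists>z \<gamma>. is_path d origin z \<gamma> \<and> int R \<le> supdist d origin z
          \<and> path_time (\<lambda>e. \<tau> e \<omega>) \<gamma> \<le> r} \<subseteq> V"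
  shows "1 - prob (light_event N m) \<le> real N * mean / r + prob V
    + 2 * 2 ^ ((2 * d + 3) ^ d) * (second_moment / m\<^sup>2)
    + 2 * (2 * real J + 1) ^ d * q ^ (d + 1) + (2 * real R + 1) ^ d * q ^ J"
proof -
  obtain \<gamma>0 where \<gamma>0: "is_path d origin (target N) \<gamma>0" "length (path_edges \<gamma>0) = N" by (rule straight_path)
  have \<gamma>0_edges: "set (path_edges \<gamma>0) \<subseteq> edges d" using \<gamma>0(1) path_edges_in_edges by (simp add: is_path_def)
  define U where "U = {\<omega> \<in> space M. path_time (\<lambda>e. \<tau> e \<omega>) \<gamma>0 \<ge> r}"
  define H where "H z = {\<omega> \<in> space M. \<exists>e\<in>inner_edges d (cube d z (int d + 1)). m < \<tau> e \<omega>}" for z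
  define A where "A x j = {\<omega> \<in> space M. \<forall>k\<in>{1..j}. slow_shell d x k s (m / 2) (\<lambda>e. \<tau> e \<omega>)}" for x and j :: nat
  define B where "B z n j = (\<Union>x\<in>cube d z (int n). A x j)" for z and n j :: nat
  have q: "0 \<le> q" using order_trans[OF measure_nonneg slow[of 1 origin]] J by simp
  have U: "U \<in> events" "prob U \<le> real N * mean / r"
  proof -
    have [measurable]: "(\<lambda>\<omega>. path_time (\<lambda>e. \<tau> e \<omega>) \<gamma>0) \<in> borel_measurable M"
      using expectation_path_time(1)[OF \<gamma>0_edges] by simp
    show "U \<in> events" unfolding U_def by measurable
    have "AE \<omega> in M. 0 \<le> path_time (\<lambda>e. \<tau> e \<omega>) \<gamma>0"
      using \<gamma>0(1) weight_nonneg by (intro AE_I2 path_time_nonneg[of d]) (auto simp: is_path_def)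
    then show "prob U \<le> real N * mean / r"
      using integral_Markov_inequality_measure[OF expectation_path_time(1)[OF \<gamma>0_edges], of "{}" r]
        expectation_path_time(2)[OF \<gamma>0_edges] \<gamma>0(2) \<open>0 < r\<close> by (simp add: U_def)
  qed
  have H: "H z \<in> events" "prob (H z) \<le> 2 ^ ((2 * d + 3) ^ d) * (second_moment / m\<^sup>2)" for z
  proof -
    note fin = finite_cube[OF d_pos, of z "int d + 1"]
    show "H z \<in> events" unfolding H_def by (rule prob_heavy_edge_in(1)[OF fin \<open>0 < m\<close>])
    have "card (cube d z (int d + 1)) = (2 * d + 3) ^ d"
      by (simp add: card_cube[OF d_pos] nat_add_distrib nat_mult_distrib add.commute)
    then show "prob (H z) \<le> 2 ^ ((2 * d + 3) ^ d) * (second_moment / m\<^sup>2)"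
      using prob_heavy_edge_in(2)[OF fin \<open>0 < m\<close>] by (simp add: H_def)
  qed
  have A: "A x j \<in> events" "prob (A x j) \<le> q ^ j" if "j \<le> J" for x j
  proof -
    show "A x j \<in> events" unfolding A_def
      by (intro sets.sets_Collect_finite_All slow_shell_event) auto
    show "prob (A x j) \<le> q ^ j" unfolding A_def using slow that by (intro prob_all_shells_slow) auto
  qed
  have B: "B z n j \<in> events" "prob (B z n j) \<le> (2 * real n + 1) ^ d * q ^ j" if "j \<le> J" for z n j
  proof -
    note fin = finite_cube[OF d_pos, of z "int n"]
    show "B z n j \<in> events" unfolding B_def using A(1)[OF that] fin by (intro sets.finite_UN) auto
    have "prob (B z n j) \<le> (\<Sum>x\<in>cube d z (int n). prob (A x j))"
      unfolding B_def using A(1)[OF that] fin by (intro finite_measure_subadditive_finite) auto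
    also have "\<dots> \<le> (\<Sum>x\<in>cube d z (int n). q ^ j)" by (intro sum_mono A(2)[OF that])
    also have "\<dots> = (2 * real n + 1) ^ d * q ^ j"
      by (simp add: card_cube[OF d_pos] nat_add_distrib nat_mult_distrib add.commute)
    finally show "prob (B z n j) \<le> (2 * real n + 1) ^ d * q ^ j" .
  qed
  let ?w = "target N"
  have cover: "space M - light_event N m \<subseteq> U \<union> V \<union> (H origin \<union> H ?w)
      \<union> (B origin J (d + 1) \<union> B ?w J (d + 1)) \<union> B origin R J"
  proof
    fix \<omega> assume \<omega>: "\<omega> \<in> space M - light_event N m"
    then have sp: "\<omega> \<in> space M" by simp
    let ?t = "\<lambda>e. \<tau> e \<omega>"
    have nonneg: "0 \<le> ?t e" if "e \<in> edges d" for e using weight_nonneg[OF that sp] .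
    obtain \<gamma> e where \<gamma>: "\<gamma> \<in> optimal_paths d ?t origin ?w" "e \<in> set (path_edges \<gamma>)" "m < ?t e"
      using \<omega> light_event_iff[OF sp] by (auto simp: not_le)
    obtain \<alpha> x y \<beta> where split: "\<gamma> = \<alpha> @ x # y # \<beta>" "e = {x, y}" by (rule path_edges_split[OF \<gamma>(2)])
    have path: "is_path d origin ?w \<gamma>" using \<gamma>(1) by (simp add: optimal_paths_def)
    have xy: "adjacent d x y" "x \<in> lattice d" "y \<in> lattice d"
      using path unfolding split is_path_def by (auto simp: successively_append_iff successively_Cons)
    have slow_at: "\<omega> \<in> A x j" if "int j \<le> supdist d x origin" "int j \<le> supdist d x ?w" for j
      unfolding A_def
      using shells_slow_around_heavy_edge[OF dim nonneg \<gamma>(1) split(1), where m = "m / 2" and s = s]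
        \<gamma>(3) split(2) that sp by auto
    have heavy_near: "\<omega> \<in> H z" if "supdist d z x \<le> int d" for z
    proof -
      have "supdist d z y \<le> int d + 1" using supdist_step[OF xy(1) d_pos, of z] that by linarith
      then have "e \<in> inner_edges d (cube d z (int d + 1))"
        using xy that by (simp add: split(2) edge_in_inner_edges_iff cube_def)
      then show ?thesis using sp \<gamma>(3) by (auto simp: H_def)
    qed
    have in_B: "\<omega> \<in> B z n j" if "supdist d z x \<le> int n" "\<omega> \<in> A x j" for z n j
      using that xy(2) by (auto simp: B_def cube_def)
    show "\<omega> \<in> U \<union> V \<union> (H origin \<union> H ?w) \<union> (B origin J (d + 1) \<union> B ?w J (d + 1)) \<union> B origin R J"
    proof (cases "\<omega> \<in> U \<union> V \<union> (H origin \<union> H ?w)")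
      case False
      have "path_time ?t \<gamma> \<le> path_time ?t \<gamma>0"
        using \<gamma>(1) \<gamma>0(1) optimal_paths_iff[OF sp origin_in_lattice] by blast
      then have "path_time ?t \<gamma> \<le> r" using False sp by (simp add: U_def)
      moreover have "path_time ?t (\<alpha> @ [x]) \<le> path_time ?t \<gamma>"
      proof -
        have "successively (adjacent d) (x # y # \<beta>)"
          using path unfolding split is_path_def by (simp add: successively_append_iff)
        then have "0 \<le> path_time ?t (x # y # \<beta>)" using path_time_nonneg[of d ?t] nonneg by blast
        then show ?thesis unfolding split(1) path_time_join[of ?t \<alpha> x "y # \<beta>"] by simp
      qed
      moreover have "is_path d origin x (\<alpha> @ [x])"
        using path unfolding split is_path_def
        by (auto simp: successively_append_iff successively_Cons hd_append split: if_splits)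
      ultimately have reach: "is_path d origin x (\<alpha> @ [x])" "path_time ?t (\<alpha> @ [x]) \<le> r" by linarith+
      have "\<omega> \<notin> V" using False by simp
      then have "\<not> int R \<le> supdist d origin x" using V(2) sp reach by blast
      then have xR: "supdist d origin x \<le> int R" by simp
      have far: "int d + 1 \<le> supdist d origin x" "int d + 1 \<le> supdist d ?w x"
        using heavy_near[of origin] heavy_near[of ?w] False by force+
      have A_small: "\<omega> \<in> A x (d + 1)"
        using far by (intro slow_at) (simp_all add: supdist_commute[of d x])
      consider "supdist d origin x \<le> int J" | "supdist d ?w x \<le> int J"
        | "int J \<le> supdist d origin x" "int J \<le> supdist d ?w x" by linarith
      then show ?thesis
      proof cases
        case 1 then show ?thesis using in_B[OF _ A_small] by blast
      next
        case 2 then show ?thesis using in_B[OF _ A_small] by blast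
      next
        case 3
        then have "\<omega> \<in> A x J" by (intro slow_at) (simp_all add: supdist_commute[of d x])
        then show ?thesis using in_B[OF xR] by blast
      qed
    qed blast
  qed
  have "1 - prob (light_event N m) = prob (space M - light_event N m)"
    by (rule prob_compl[OF light_event_measurable, symmetric])
  also have "\<dots> \<le> prob (U \<union> V \<union> (H origin \<union> H ?w) \<union> (B origin J (d + 1) \<union> B ?w J (d + 1)) \<union> B origin R J)"
    using cover U(1) V(1) H(1) B(1)[OF J] B(1)[OF order_refl] by (intro finite_measure_mono) auto
  also have "\<dots> \<le> (prob U + prob V + (prob (H origin) + prob (H ?w))
      + (prob (B origin J (d + 1)) + prob (B ?w J (d + 1)))) + prob (B origin R J)"
    using U(1) V(1) H(1) B(1)[OF J] B(1)[OF order_refl]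
    by (intro order_trans[OF measure_Un_le] add_mono order_refl sets.Un) auto
  also have "\<dots> \<le> real N * mean / r + prob V + 2 * 2 ^ ((2 * d + 3) ^ d) * (second_moment / m\<^sup>2)
    + 2 * (2 * real J + 1) ^ d * q ^ (d + 1) + (2 * real R + 1) ^ d * q ^ J"
    using U(2) H(2)[of origin] H(2)[of ?w] B(2)[OF J, of origin J] B(2)[OF J, of ?w J]
      B(2)[OF order_refl, of origin R] by simp
  finally show ?thesis .
qed

end

section \<open>The limit\<close>

text \<open>
  The number of vertices contributes \<open>3 * D * ln N\<close> to the exponent, and the spheres contribute
  \<open>- (3 * D + 1) * ln N\<close> to leading order.
\<close>

lemma bulk_error_tendsto_0:
  fixes A B L D :: real
  assumes "A > 0" "B > 0" "L > 0" "D > 0"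
  shows "(\<lambda>N::nat. exp (- ((3 * D + 1) * (ln (real N) / ln (ln (real N))) - 1)
      * (ln (A * (ln (real N) / ln (ln (real N)))) - ln B)
      + D * (3 * ln (real N) + ln (3 * L)))) \<longlonglongrightarrow> 0"
  using assms by real_asymp

lemma confinement_error_tendsto_0:
  fixes l \<rho> :: real
  assumes "0 \<le> l" "0 < \<rho>" "\<rho> < 1"
  shows "(\<lambda>N::nat. exp (l * (real N)\<^sup>2) * \<rho> ^ (N ^ 3)) \<longlonglongrightarrow> 0"
proof -
  have "ln \<rho> < 0" using assms by simp
  then have "(\<lambda>N::nat. exp (l * (real N)\<^sup>2 + (real N) ^ 3 * ln \<rho>)) \<longlonglongrightarrow> 0"
    using assms(1) by real_asymp
  moreover have "exp (l * (real N)\<^sup>2 + (real N) ^ 3 * ln \<rho>) = exp (l * (real N)\<^sup>2) * \<rho> ^ (N ^ 3)" for N :: nat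
    using exp_of_nat_mult[of "N ^ 3" "ln \<rho>"] assms by (simp add: exp_add)
  ultimately show ?thesis by simp
qed

context first_passage
begin

text \<open>
  The box has size \<open>N ^ 3 * L\<close>, because the growth estimate must beat the time \<open>N\<^sup>2\<close> allowed to the
  straight path. The constant \<open>A\<close> is such that \<open>c * A\<close> exceeds the exponent \<open>3 * d\<close> of the volume.
\<close>

theorem maximal_weight_on_optimal_paths:
  assumes "zero_prob < critical_prob d"
  shows "\<exists>A>0. (\<lambda>N. prob (light_event N (A * (ln (real N) / ln (ln (real N)))))) \<longlonglongrightarrow> 1"
proof -
  obtain \<epsilon> c C0 where pos: "0 < \<epsilon>" "0 < c" "c \<le> 1" "0 \<le> C0"
    and slow0: "\<forall>m k x. 1 \<le> m \<longrightarrow> 1 \<le> k \<longrightarrow> real k \<le> c * m \<longrightarrow>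
      prob {\<omega> \<in> space M. slow_shell d x k (\<epsilon> * m) (m / 2) (\<lambda>e. \<tau> e \<omega>)} \<le> C0 / m"
    using prob_slow_shell by blast
  obtain l L \<rho>0 where l: "0 \<le> l" "0 < L" "0 \<le> \<rho>0" "\<rho>0 < 1"
    and growth: "\<forall>m s. \<exists>V\<in>events. prob V \<le> exp (l * s) * \<rho>0 ^ m \<and>
      {\<omega> \<in> space M. \<exists>z \<gamma>. is_path d origin z \<gamma> \<and> int (m * L) \<le> supdist d origin z
        \<and> path_time (\<lambda>e. \<tau> e \<omega>) \<gamma> \<le> s} \<subseteq> V"
    using linear_growth[OF assms] by blast
  define B where "B = max C0 1"
  define \<rho> where "\<rho> = max \<rho>0 (1 / 2)"
  define D where "D = real d"
  define A where "A = (3 * D + 1) / c"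
  define m where "m N = A * (ln (real N) / ln (ln (real N)))" for N :: nat
  define J where "J N = nat \<lfloor>c * m N\<rfloor>" for N
  define K where "K = 2 * 2 ^ ((2 * d + 3) ^ d) * second_moment"
  define b where "b N = mean * (real N / (real N)\<^sup>2) + exp (l * (real N)\<^sup>2) * \<rho> ^ (N ^ 3)
    + K * (inverse (m N))\<^sup>2 + 2 * 3 ^ d * B ^ (d + 1) * inverse (m N)
    + exp (- (c * m N - 1) * (ln (m N) - ln B) + D * (3 * ln (real N) + ln (3 * real L)))" for N :: nat
  have B: "1 \<le> B" "C0 \<le> B" by (simp_all add: B_def)
  have \<rho>: "0 < \<rho>" "\<rho> < 1" "\<rho>0 \<le> \<rho>" using l by (simp_all add: \<rho>_def)
  have D: "0 < D" using d_pos by (simp add: D_def)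
  have A: "0 < A" using D pos by (simp add: A_def)
  have m_top: "filterlim m at_top sequentially" unfolding m_def using A by real_asymp
  have inv: "(\<lambda>N. inverse (m N)) \<longlonglongrightarrow> 0"
    by (rule tendsto_inverse_0_at_top[OF m_top])
  have b_lim: "b \<longlonglongrightarrow> 0"
  proof -
    have cm: "c * m N = (3 * D + 1) * (ln (real N) / ln (ln (real N)))" for N
      using pos by (simp add: m_def A_def)
    have bulk: "(\<lambda>N. exp (- (c * m N - 1) * (ln (m N) - ln B) + D * (3 * ln (real N) + ln (3 * real L)))) \<longlonglongrightarrow> 0"
      unfolding cm unfolding m_def
      by (rule bulk_error_tendsto_0[OF A _ _ D]) (use B l(2) in auto)
    have "(\<lambda>N::nat. real N / (real N)\<^sup>2) \<longlonglongrightarrow> 0" by real_asymp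
    then have "b \<longlonglongrightarrow> mean * 0 + 0 + K * 0\<^sup>2 + 2 * 3 ^ d * B ^ (d + 1) * 0 + 0"
      unfolding b_def
      by (intro tendsto_add tendsto_mult tendsto_power tendsto_const inv bulk
          confinement_error_tendsto_0[OF l(1) \<rho>(1,2)])
    then show ?thesis by simp
  qed
  have "\<forall>\<^sub>F N in sequentially. max B ((real d + 1) / c) \<le> m N \<and> 1 \<le> N"
    using m_top[unfolded filterlim_at_top, rule_format] eventually_ge_at_top by (rule eventually_conj)
  then have lower: "\<forall>\<^sub>F N in sequentially. 1 - b N \<le> prob (light_event N (m N))"
  proof (rule eventually_mono, elim conjE)
    fix N :: nat assume mN: "max B ((real d + 1) / c) \<le> m N" and N: "1 \<le> N"
    have m1: "1 \<le> m N" "B \<le> m N" using mN B by auto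
    have "real d + 1 \<le> c * m N" using mN pos by (simp add: field_simps)
    then have J_ge: "d + 1 \<le> J N" unfolding J_def by linarith
    have "0 \<le> c * m N" using pos m1 by simp
    then have J_le: "real (J N) \<le> c * m N" and J_gt: "c * m N - 1 \<le> real (J N)"
      unfolding J_def by linarith+
    have Jm: "real (J N) \<le> m N" using J_le pos m1 mult_right_mono[of c 1 "m N"] by linarith
    obtain V where V: "V \<in> events" "prob V \<le> exp (l * (real N)\<^sup>2) * \<rho>0 ^ (N ^ 3)"
      "{\<omega> \<in> space M. \<exists>z \<gamma>. is_path d origin z \<gamma> \<and> int (N ^ 3 * L) \<le> supdist d origin z
        \<and> path_time (\<lambda>e. \<tau> e \<omega>) \<gamma> \<le> (real N)\<^sup>2} \<subseteq> V"
      using growth[rule_format, where m = "N ^ 3" and s = "(real N)\<^sup>2"] by blast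
    have slow: "prob {\<omega> \<in> space M. slow_shell d x k (\<epsilon> * m N) (m N / 2) (\<lambda>e. \<tau> e \<omega>)} \<le> B / m N"
      if "1 \<le> k" "k \<le> J N" for k x
    proof -
      have "real k \<le> c * m N" using that(2) J_le by linarith
      then have "prob {\<omega> \<in> space M. slow_shell d x k (\<epsilon> * m N) (m N / 2) (\<lambda>e. \<tau> e \<omega>)} \<le> C0 / m N"
        using slow0 m1(1) that(1) by blast
      also have "\<dots> \<le> B / m N" using B(2) m1 by (intro divide_right_mono) auto
      finally show ?thesis .
    qed
    have "1 - prob (light_event N (m N)) \<le> real N * mean / (real N)\<^sup>2 + prob V
      + 2 * 2 ^ ((2 * d + 3) ^ d) * (second_moment / (m N)\<^sup>2)
      + 2 * (2 * real (J N) + 1) ^ d * (B / m N) ^ (d + 1)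
      + (2 * real (N ^ 3 * L) + 1) ^ d * (B / m N) ^ J N"
      using N m1 by (intro light_event_bound[OF slow J_ge _ _ V(1,3)]) auto
    also have "\<dots> \<le> b N"
      unfolding b_def
    proof (intro add_mono)
      show "real N * mean / (real N)\<^sup>2 \<le> mean * (real N / (real N)\<^sup>2)"
        by (simp add: mult.commute)
      show "prob V \<le> exp (l * (real N)\<^sup>2) * \<rho> ^ (N ^ 3)"
        by (rule order_trans[OF V(2) mult_left_mono[OF power_mono[OF \<rho>(3) l(3)]]]) simp
      show "2 * 2 ^ ((2 * d + 3) ^ d) * (second_moment / (m N)\<^sup>2) \<le> K * (inverse (m N))\<^sup>2"
        unfolding K_def power_inverse divide_inverse by (simp only: mult.assoc order_refl)
      show "2 * (2 * real (J N) + 1) ^ d * (B / m N) ^ (d + 1) \<le> 2 * 3 ^ d * B ^ (d + 1) * inverse (m N)"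
      proof -
        have "(2 * real (J N) + 1) ^ d \<le> (3 * m N) ^ d"
          using Jm m1 by (intro power_mono) auto
        then have "2 * (2 * real (J N) + 1) ^ d * (B / m N) ^ (d + 1) \<le> 2 * (3 * m N) ^ d * (B / m N) ^ (d + 1)"
          using B m1 by (intro mult_right_mono mult_left_mono) auto
        also have "\<dots> = 2 * 3 ^ d * B ^ (d + 1) * inverse (m N)"
        proof -
          have "(3 * m N) ^ d * (B / m N) ^ (d + 1) = 3 ^ d * B ^ (d + 1) * ((m N) ^ d / (m N) ^ (d + 1))"
            by (simp only: power_mult_distrib power_divide times_divide_eq_right times_divide_eq_left mult_ac)
          also have "(m N) ^ d / (m N) ^ (d + 1) = inverse (m N)"
            using m1 by (simp add: field_simps)
          finally show ?thesis by (simp only: mult.assoc)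
        qed
        finally show ?thesis .
      qed
      show "(2 * real (N ^ 3 * L) + 1) ^ d * (B / m N) ^ J N
          \<le> exp (- (c * m N - 1) * (ln (m N) - ln B) + D * (3 * ln (real N) + ln (3 * real L)))"
      proof -
        have NL: "1 \<le> real (N ^ 3 * L)" using N l(2) by (simp only: real_of_nat_ge_one_iff) simp
        have "ln (3 * real L * real N ^ 3) = 3 * ln (real N) + ln (3 * real L)"
          using N l(2) by (simp add: ln_mult ln_realpow)
        then have "exp (D * (3 * ln (real N) + ln (3 * real L))) = (exp (ln (3 * real L * real N ^ 3))) ^ d"
          unfolding D_def exp_of_nat_mult by simp
        also have "\<dots> = (3 * real (N ^ 3 * L)) ^ d" using N l(2) by (simp add: mult_ac)
        finally have eq1: "exp (D * (3 * ln (real N) + ln (3 * real L))) = (3 * real (N ^ 3 * L)) ^ d" .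
        have "B / m N = exp (- (ln (m N) - ln B))"
          using B m1 by (simp add: exp_diff)
        then have "(B / m N) ^ J N = exp (real (J N) * (- (ln (m N) - ln B)))"
          by (simp only: exp_of_nat_mult)
        also have "\<dots> \<le> exp (- (c * m N - 1) * (ln (m N) - ln B))"
        proof -
          have "0 \<le> ln (m N) - ln B" using m1 B by simp
          then have "(c * m N - 1) * (ln (m N) - ln B) \<le> real (J N) * (ln (m N) - ln B)"
            using J_gt by (rule mult_right_mono[rotated])
          then show ?thesis unfolding exp_le_cancel_iff mult_minus_right mult_minus_left by linarith
        qed
        finally have eq2: "(B / m N) ^ J N \<le> exp (- (c * m N - 1) * (ln (m N) - ln B))" .
        have "(2 * real (N ^ 3 * L) + 1) ^ d \<le> (3 * real (N ^ 3 * L)) ^ d"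
          by (rule power_mono) (use NL in linarith)+
        then have "(2 * real (N ^ 3 * L) + 1) ^ d * (B / m N) ^ J N
            \<le> exp (D * (3 * ln (real N) + ln (3 * real L))) * exp (- (c * m N - 1) * (ln (m N) - ln B))"
          unfolding eq1 using eq2 B m1 by (intro mult_mono) auto
        then show ?thesis by (simp only: exp_add mult.commute)
      qed
    qed
    finally show "1 - b N \<le> prob (light_event N (m N))" by simp
  qed
  have "(\<lambda>N. 1 - b N) \<longlonglongrightarrow> 1 - 0" by (intro tendsto_diff tendsto_const b_lim)
  then have "(\<lambda>N. prob (light_event N (m N))) \<longlonglongrightarrow> 1"
    using lower by (intro tendsto_sandwich[OF lower _ _ tendsto_const]) auto
  then show ?thesis using A unfolding m_def by blast
qed

end

theorem theorem1p2:
  fixes d :: nat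
    and M :: "'a measure"
    and \<tau> :: "edge \<Rightarrow> 'a \<Rightarrow> real"
  assumes "d \<ge> 2"
    and "prob_space M"
    and "prob_space.indep_vars M (\<lambda>_. borel) \<tau> (edges d)"
    and "\<And>e e'. e \<in> edges d \<Longrightarrow> e' \<in> edges d \<Longrightarrow> distr M borel (\<tau> e) = distr M borel (\<tau> e')"
    and "\<And>e \<omega>. e \<in> edges d \<Longrightarrow> \<omega> \<in> space M \<Longrightarrow> 0 \<le> \<tau> e \<omega>"
    and "\<And>e. e \<in> edges d \<Longrightarrow> integrable M (\<lambda>\<omega>. (\<tau> e \<omega>)\<^sup>2)"
    and "\<And>e. e \<in> edges d \<Longrightarrow> measure M {\<omega> \<in> space M. \<tau> e \<omega> = 0} < critical_prob d"
  shows "\<exists>C::real. C > 0 \<and>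
    (\<lambda>N::nat. measure M {\<omega> \<in> space M.
        (SUP \<gamma>\<in>optimal_paths d (\<lambda>e. \<tau> e \<omega>) origin (\<lambda>i. int N * e1 i). max_weight (\<lambda>e. \<tau> e \<omega>) \<gamma>)
          \<le> ereal (C * (ln (real N) / ln (ln (real N))))})
      \<longlonglongrightarrow> 1"
proof -
  interpret prob_space M by fact
  interpret first_passage M d \<tau> by unfold_locales (rule assms(1,3-6); assumption)+
  have "zero_prob < critical_prob d" unfolding zero_prob_def by (rule assms(7)[OF e0_in_edges])
  from maximal_weight_on_optimal_paths[OF this] show ?thesis
    unfolding light_event_def target_def by blast
qed

end
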